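(* Let $s\ge0$. Then $$\mathcal V^{\mathrm{spec}}_s(M)\hookrightarrow B^s_{2,1}(M)\hookrightarrow B^s_{2,2}(M)=H^s(M)$$ continuously.
   Context: $(M,g)$ is a compact connected smooth Riemannian manifold without boundary, $\nu$ is Riemannian volume normalized so that $\nu(M)=1$, $L^2(M)=L^2(M,\nu)$ (real-valued). $L=-\Delta_M$ is the nonnegative Laplace–Beltrami operator with distinct eigenvalues $0=\mu_0<\mu_1<\cdots$; $E_j=\ker(L-\mu_jI)$ and $P_j:L^2(M)\to E_j$ is the orthogonal projector. For $s\ge0$, $\|f\|_{\mathcal V^{\mathrm{spec}}_s(M)}=\sum_{j\ge0}(1+\mu_j)^{s/2}\|P_jf\|_{L^2(M)}$ and $\mathcal V^{\mathrm{spec}}_s(M)=\{f\in L^2(M):\|f\|_{\mathcal V^{\mathrm{spec}}_s(M)}<\infty\}$. Spectral Sobolev norm: $\|f\|_{H^s(M)}^2=\sum_{j\ge0}(1+\mu_j)^s\|P_jf\|_{L^2(M)}^2$. Besov spaces are taken with the standard compact-manifold Littlewood–Paley characterization: let $\psi_0\in C_c^\infty([0,\infty))$, $\psi\in C_c^\infty((0,\infty))$ form a smooth dyadic partition of unity, $\psi_0(\lambda)+\sum_{n\ge1}\psi(2^{-n}\lambda)=1$ for $\lambda\ge0$, and set $Q_0=\psi_0((I+L)^{1/2})$, $Q_n=\psi(2^{-n}(I+L)^{1/2})$ for $n\ge1$, i.e. $Q_nf=\sum_j\psi(2^{-n}(1+\mu_j)^{1/2})P_jf$. Then $\|f\|_{B^s_{2,r}(M)}=\big(\sum_{n\ge0}(2^{ns}\|Q_nf\|_{L^2(M)})^r\big)^{1/r}$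 and $B^s_{2,r}(M)$ is the set of $f\in L^2(M)$ with finite norm, $r\in\{1,2\}$ (equality of spaces is up to equivalent norms). *)

theory Defs
  imports "HOL-Analysis.Analysis"
begin

section \<open>Smooth maps and closed Riemannian manifolds\<close>

text \<open>The following two notions are meant for open sets \<open>S\<close>.\<close>

primrec Ck_on :: "nat \<Rightarrow> 'a::euclidean_space set \<Rightarrow> ('a \<Rightarrow> 'b::real_normed_vector) \<Rightarrow> bool" where
  "Ck_on 0 S f \<longleftrightarrow> continuous_on S f"
| "Ck_on (Suc k) S f \<longleftrightarrow> (\<forall>x\<in>S. f differentiable (at x)) \<and>
     (\<forall>v. Ck_on k S (\<lambda>x. frechet_derivative f (at x) v))"

definition smooth_on :: "'a::euclidean_space set \<Rightarrow> ('a \<Rightarrow> 'b::real_normed_vector) \<Rightarrow> bool" where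
  "smooth_on S f \<longleftrightarrow> (\<forall>k. Ck_on k S f)"

text \<open>A chart is a pair of its domain and its coordinate map; the values of the coordinate map
  outside the domain are irrelevant.\<close>

type_synonym ('m, 'n) chart = "'m set \<times> ('m \<Rightarrow> real ^ 'n)"

abbreviation chart_dom :: "('m, 'n) chart \<Rightarrow> 'm set" where
  "chart_dom c \<equiv> fst c"

abbreviation chart_map :: "('m, 'n) chart \<Rightarrow> 'm \<Rightarrow> real ^ 'n" where
  "chart_map c \<equiv> snd c"

definition chart_inv :: "('m, 'n) chart \<Rightarrow> real ^ 'n \<Rightarrow> 'm" where
  "chart_inv c = inv_into (chart_dom c) (chart_map c)"

definition chart_image :: "('m, 'n) chart \<Rightarrow> (real ^ 'n) set" where
  "chart_image c = chart_map c ` chart_dom c"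

definition is_chart :: "('m::topological_space, 'n::finite) chart \<Rightarrow> bool" where
  "is_chart c \<longleftrightarrow> open (chart_dom c) \<and> open (chart_image c) \<and>
     homeomorphism (chart_dom c) (chart_image c) (chart_map c) (chart_inv c)"

definition smooth_atlas :: "('m::topological_space, 'n::finite) chart set \<Rightarrow> bool" where
  "smooth_atlas A \<longleftrightarrow> (\<forall>c\<in>A. is_chart c) \<and> (\<Union>c\<in>A. chart_dom c) = UNIV \<and>
     (\<forall>c\<in>A. \<forall>d\<in>A. smooth_on (chart_map c ` (chart_dom c \<inter> chart_dom d))
                       (chart_map d \<circ> chart_inv c))"

text \<open>A Riemannian metric is given by its coefficient matrices \<open>(g\<^sub>i\<^sub>j)\<close> in the charts of the atlas:
  \<open>g c x\<close> is the matrix in the chart \<open>c\<close> at the point with coordinates \<open>x\<close>. The last conjunct is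
  the transformation law of a covariant 2-tensor.\<close>

type_synonym ('m, 'n) metric = "('m, 'n) chart \<Rightarrow> real ^ 'n \<Rightarrow> real ^ 'n ^ 'n"

definition riemannian_metric ::
  "('m::topological_space, 'n::finite) chart set \<Rightarrow> ('m, 'n) metric \<Rightarrow> bool" where
  "riemannian_metric A g \<longleftrightarrow>
     (\<forall>c\<in>A. smooth_on (chart_image c) (g c) \<and>
        (\<forall>x\<in>chart_image c. transpose (g c x) = g c x \<and>
           (\<forall>v. v \<noteq> 0 \<longrightarrow> v \<bullet> (g c x *v v) > 0))) \<and>
     (\<forall>c\<in>A. \<forall>d\<in>A. \<forall>p\<in>chart_dom c \<inter> chart_dom d.
        let J = jacobian (chart_map d \<circ> chart_inv c) (at (chart_map c p)) in
        g c (chart_map c p) = transpose J ** g d (chart_map d p) ** J)"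

definition closed_riemannian_manifold ::
  "('m::{t2_space,second_countable_topology}, 'n::finite) chart set \<Rightarrow> ('m, 'n) metric \<Rightarrow> bool" where
  "closed_riemannian_manifold A g \<longleftrightarrow>
     compact (UNIV :: 'm set) \<and> connected (UNIV :: 'm set) \<and>
     smooth_atlas A \<and> riemannian_metric A g"

definition riemannian_volume ::
  "('m::topological_space, 'n::finite) chart set \<Rightarrow> ('m, 'n) metric \<Rightarrow> 'm measure \<Rightarrow> bool" where
  "riemannian_volume A g V \<longleftrightarrow> sets V = sets borel \<and>
     (\<forall>c\<in>A. \<forall>B\<in>sets borel. B \<subseteq> chart_dom c \<longrightarrow>
        emeasure V B =
          (\<integral>\<^sup>+x. ennreal (sqrt (det (g c x))) * indicator (chart_map c ` B) x \<partial>lborel))"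

definition normalized_volume ::
  "('m::topological_space, 'n::finite) chart set \<Rightarrow> ('m, 'n) metric \<Rightarrow> 'm measure \<Rightarrow> bool" where
  "normalized_volume A g \<nu> \<longleftrightarrow>
     (\<exists>V. riemannian_volume A g V \<and> \<nu> = scale_measure (1 / emeasure V UNIV) V)"


section \<open>Square-integrable functions\<close>

text \<open>Elements of \<open>L\<^sup>2\<close> are represented by functions; equality almost everywhere is not quotiented
  out. The function spaces and norms below
  depend only on almost-everywhere classes. Since the integral of a non-integrable function is
  \<open>0\<close>, \<open>L2_norm\<close> and \<open>L2_tendsto\<close> are meaningful only for functions in \<open>L\<^sup>2\<close>.\<close>

definition L2 :: "'m measure \<Rightarrow> ('m \<Rightarrow> real) set" where
  "L2 \<nu> = {f \<in> borel_measurable \<nu>. integrable \<nu> (\<lambda>x. (f x)\<^sup>2)}"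

definition L2_inner :: "'m measure \<Rightarrow> ('m \<Rightarrow> real) \<Rightarrow> ('m \<Rightarrow> real) \<Rightarrow> real" where
  "L2_inner \<nu> f h = (LINT x|\<nu>. f x * h x)"

definition L2_norm :: "'m measure \<Rightarrow> ('m \<Rightarrow> real) \<Rightarrow> real" where
  "L2_norm \<nu> f = sqrt (LINT x|\<nu>. (f x)\<^sup>2)"

definition L2_tendsto :: "'m measure \<Rightarrow> (nat \<Rightarrow> 'm \<Rightarrow> real) \<Rightarrow> ('m \<Rightarrow> real) \<Rightarrow> bool" where
  "L2_tendsto \<nu> F f \<longleftrightarrow> (\<lambda>k. L2_norm \<nu> (\<lambda>x. F k x - f x)) \<longlonglongrightarrow> 0"


section \<open>The Laplace--Beltrami operator and its spectral decomposition\<close>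

definition smooth_fun :: "('m, 'n::finite) chart set \<Rightarrow> ('m \<Rightarrow> real) \<Rightarrow> bool" where
  "smooth_fun A f \<longleftrightarrow> (\<forall>c\<in>A. smooth_on (chart_image c) (f \<circ> chart_inv c))"

definition partial_deriv :: "'n::finite \<Rightarrow> (real ^ 'n \<Rightarrow> real) \<Rightarrow> real ^ 'n \<Rightarrow> real" where
  "partial_deriv i u x = frechet_derivative u (at x) (axis i 1)"

text \<open>The coordinate expression
  \<open>|G|\<^sup>-\<^sup>1\<^sup>/\<^sup>2 \<Sum>\<^sub>i \<partial>\<^sub>i (|G|\<^sup>1\<^sup>/\<^sup>2 \<Sum>\<^sub>j G\<^sup>i\<^sup>j \<partial>\<^sub>j u)\<close> of \<open>div grad u\<close>.\<close>

definition local_laplacian ::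
  "(real ^ 'n \<Rightarrow> real ^ 'n ^ 'n) \<Rightarrow> (real ^ 'n::finite \<Rightarrow> real) \<Rightarrow> real ^ 'n \<Rightarrow> real" where
  "local_laplacian G u x =
     (\<Sum>i\<in>UNIV. partial_deriv i
        (\<lambda>y. sqrt (det (G y)) * (\<Sum>j\<in>UNIV. matrix_inv (G y) $ i $ j * partial_deriv j u y)) x)
     / sqrt (det (G x))"

text \<open>\<open>h\<close> is \<open>\<Delta>f\<close> for a smooth function \<open>f\<close>. The coordinate expression does not depend on the chart,
  so quantifying over all charts is no restriction.\<close>

definition is_laplacian ::
  "('m, 'n::finite) chart set \<Rightarrow> ('m, 'n) metric \<Rightarrow> ('m \<Rightarrow> real) \<Rightarrow> ('m \<Rightarrow> real) \<Rightarrow> bool" where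
  "is_laplacian A g f h \<longleftrightarrow> smooth_fun A f \<and>
     (\<forall>c\<in>A. \<forall>p\<in>chart_dom c.
        h p = local_laplacian (g c) (f \<circ> chart_inv c) (chart_map c p))"

text \<open>The graph of the operator \<open>L = -\<Delta>\<close> in \<open>L\<^sup>2\<close>, that is, of the closure of \<open>-\<Delta>\<close> on smooth
  functions. On a closed manifold \<open>-\<Delta>\<close> is essentially self-adjoint on smooth functions, so this
  closure is its only self-adjoint extension.\<close>

definition laplace_graph ::
  "('m, 'n::finite) chart set \<Rightarrow> ('m, 'n) metric \<Rightarrow> 'm measure \<Rightarrow> (('m \<Rightarrow> real) \<times> ('m \<Rightarrow> real)) set"
  where
  "laplace_graph A g \<nu> = {(u, w). u \<in> L2 \<nu> \<and> w \<in> L2 \<nu> \<and>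
     (\<exists>F H. (\<forall>k. is_laplacian A g (F k) (H k)) \<and>
        L2_tendsto \<nu> F u \<and> L2_tendsto \<nu> (\<lambda>k x. - H k x) w)}"

definition eigenspace ::
  "('m, 'n::finite) chart set \<Rightarrow> ('m, 'n) metric \<Rightarrow> 'm measure \<Rightarrow> real \<Rightarrow> ('m \<Rightarrow> real) set" where
  "eigenspace A g \<nu> l = {u. (u, \<lambda>x. l * u x) \<in> laplace_graph A g \<nu>}"

definition is_eigenvalue ::
  "('m, 'n::finite) chart set \<Rightarrow> ('m, 'n) metric \<Rightarrow> 'm measure \<Rightarrow> real \<Rightarrow> bool" where
  "is_eigenvalue A g \<nu> l \<longleftrightarrow> (\<exists>u\<in>eigenspace A g \<nu> l. L2_norm \<nu> u \<noteq> 0)"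

definition eigenvalue_enumeration ::
  "('m, 'n::finite) chart set \<Rightarrow> ('m, 'n) metric \<Rightarrow> 'm measure \<Rightarrow> (nat \<Rightarrow> real) \<Rightarrow> bool" where
  "eigenvalue_enumeration A g \<nu> \<mu> \<longleftrightarrow>
     \<mu> 0 = 0 \<and> strict_mono \<mu> \<and> range \<mu> = {l. is_eigenvalue A g \<nu> l}"

text \<open>A representative of the orthogonal projection of \<open>f\<close> onto the closed subspace \<open>W\<close>; it is unique
  up to equality almost everywhere.\<close>

definition orth_projection ::
  "'m measure \<Rightarrow> ('m \<Rightarrow> real) set \<Rightarrow> ('m \<Rightarrow> real) \<Rightarrow> 'm \<Rightarrow> real" where
  "orth_projection \<nu> W f =
     (SOME p. p \<in> W \<and> (\<forall>w\<in>W. L2_inner \<nu> (\<lambda>x. f x - p x) w = 0))"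

definition spectral_projector ::
  "('m, 'n::finite) chart set \<Rightarrow> ('m, 'n) metric \<Rightarrow> 'm measure \<Rightarrow> (nat \<Rightarrow> real) \<Rightarrow> nat
     \<Rightarrow> ('m \<Rightarrow> real) \<Rightarrow> 'm \<Rightarrow> real" where
  "spectral_projector A g \<nu> \<mu> j = orth_projection \<nu> (eigenspace A g \<nu> (\<mu> j))"

text \<open>The functional calculus \<open>m(L) f = \<Sum>\<^sub>j m(\<mu>\<^sub>j) P\<^sub>j f\<close>, with the series converging in \<open>L\<^sup>2\<close>.\<close>

definition spectral_multiplier ::
  "('m, 'n::finite) chart set \<Rightarrow> ('m, 'n) metric \<Rightarrow> 'm measure \<Rightarrow> (nat \<Rightarrow> real)
     \<Rightarrow> (real \<Rightarrow> real) \<Rightarrow> ('m \<Rightarrow> real) \<Rightarrow> 'm \<Rightarrow> real" where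
  "spectral_multiplier A g \<nu> \<mu> m f =
     (SOME h. h \<in> L2 \<nu> \<and>
        L2_tendsto \<nu> (\<lambda>N x. \<Sum>j<N. m (\<mu> j) * spectral_projector A g \<nu> \<mu> j f x) h)"


section \<open>Spectral Barron, Sobolev and Besov spaces\<close>

definition V_norm ::
  "('m, 'n::finite) chart set \<Rightarrow> ('m, 'n) metric \<Rightarrow> 'm measure \<Rightarrow> (nat \<Rightarrow> real)
     \<Rightarrow> real \<Rightarrow> ('m \<Rightarrow> real) \<Rightarrow> real" where
  "V_norm A g \<nu> \<mu> s f =
     (\<Sum>j. (1 + \<mu> j) powr (s / 2) * L2_norm \<nu> (spectral_projector A g \<nu> \<mu> j f))"

definition V_space ::
  "('m, 'n::finite) chart set \<Rightarrow> ('m, 'n) metric \<Rightarrow> 'm measure \<Rightarrow> (nat \<Rightarrow> real)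
     \<Rightarrow> real \<Rightarrow> ('m \<Rightarrow> real) set" where
  "V_space A g \<nu> \<mu> s = {f \<in> L2 \<nu>.
     summable (\<lambda>j. (1 + \<mu> j) powr (s / 2) * L2_norm \<nu> (spectral_projector A g \<nu> \<mu> j f))}"

definition H_norm ::
  "('m, 'n::finite) chart set \<Rightarrow> ('m, 'n) metric \<Rightarrow> 'm measure \<Rightarrow> (nat \<Rightarrow> real)
     \<Rightarrow> real \<Rightarrow> ('m \<Rightarrow> real) \<Rightarrow> real" where
  "H_norm A g \<nu> \<mu> s f =
     sqrt (\<Sum>j. (1 + \<mu> j) powr s * (L2_norm \<nu> (spectral_projector A g \<nu> \<mu> j f))\<^sup>2)"

definition H_space ::
  "('m, 'n::finite) chart set \<Rightarrow> ('m, 'n) metric \<Rightarrow> 'm measure \<Rightarrow> (nat \<Rightarrow> real)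
     \<Rightarrow> real \<Rightarrow> ('m \<Rightarrow> real) set" where
  "H_space A g \<nu> \<mu> s = {f \<in> L2 \<nu>.
     summable (\<lambda>j. (1 + \<mu> j) powr s * (L2_norm \<nu> (spectral_projector A g \<nu> \<mu> j f))\<^sup>2)}"

text \<open>\<open>\<psi>0 \<in> C\<^sub>c\<^sup>\<infinity>([0,\<infinity>))\<close>, smoothness at \<open>0\<close> meaning smooth extendability, and
  \<open>\<psi> \<in> C\<^sub>c\<^sup>\<infinity>((0,\<infinity>))\<close>, where \<open>\<psi>\<close> is extended by zero to the whole line.\<close>

definition dyadic_partition :: "(real \<Rightarrow> real) \<Rightarrow> (real \<Rightarrow> real) \<Rightarrow> bool" where
  "dyadic_partition \<psi>0 \<psi> \<longleftrightarrow>
     (\<exists>\<phi>. smooth_on UNIV \<phi> \<and> (\<forall>t\<ge>0. \<phi> t = \<psi>0 t)) \<and>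
     (\<exists>R. \<forall>t>R. \<psi>0 t = 0) \<and>
     smooth_on UNIV \<psi> \<and>
     (\<exists>a>0. \<exists>b. \<forall>t. t \<notin> {a..b} \<longrightarrow> \<psi> t = 0) \<and>
     (\<forall>t\<ge>0. (\<lambda>n. \<psi> (t / 2 ^ Suc n)) sums (1 - \<psi>0 t))"

definition LP_block ::
  "('m, 'n::finite) chart set \<Rightarrow> ('m, 'n) metric \<Rightarrow> 'm measure \<Rightarrow> (nat \<Rightarrow> real)
     \<Rightarrow> (real \<Rightarrow> real) \<Rightarrow> (real \<Rightarrow> real) \<Rightarrow> nat \<Rightarrow> ('m \<Rightarrow> real) \<Rightarrow> 'm \<Rightarrow> real" where
  "LP_block A g \<nu> \<mu> \<psi>0 \<psi> n =
     spectral_multiplier A g \<nu> \<mu>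
       (\<lambda>t. if n = 0 then \<psi>0 (sqrt (1 + t)) else \<psi> (sqrt (1 + t) / 2 ^ n))"

definition besov_norm ::
  "('m, 'n::finite) chart set \<Rightarrow> ('m, 'n) metric \<Rightarrow> 'm measure \<Rightarrow> (nat \<Rightarrow> real)
     \<Rightarrow> (real \<Rightarrow> real) \<Rightarrow> (real \<Rightarrow> real) \<Rightarrow> real \<Rightarrow> nat \<Rightarrow> ('m \<Rightarrow> real) \<Rightarrow> real" where
  "besov_norm A g \<nu> \<mu> \<psi>0 \<psi> s r f =
     (\<Sum>n. (2 powr (real n * s) * L2_norm \<nu> (LP_block A g \<nu> \<mu> \<psi>0 \<psi> n f)) ^ r) powr (1 / real r)"

definition besov_space ::
  "('m, 'n::finite) chart set \<Rightarrow> ('m, 'n) metric \<Rightarrow> 'm measure \<Rightarrow> (nat \<Rightarrow> real)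
     \<Rightarrow> (real \<Rightarrow> real) \<Rightarrow> (real \<Rightarrow> real) \<Rightarrow> real \<Rightarrow> nat \<Rightarrow> ('m \<Rightarrow> real) set" where
  "besov_space A g \<nu> \<mu> \<psi>0 \<psi> s r = {f \<in> L2 \<nu>.
     summable (\<lambda>n. (2 powr (real n * s) * L2_norm \<nu> (LP_block A g \<nu> \<mu> \<psi>0 \<psi> n f)) ^ r)}"

definition continuously_embedded :: "'a set \<Rightarrow> ('a \<Rightarrow> real) \<Rightarrow> 'a set \<Rightarrow> ('a \<Rightarrow> real) \<Rightarrow> bool" where
  "continuously_embedded X nX Y nY \<longleftrightarrow> X \<subseteq> Y \<and> (\<exists>C. \<forall>f\<in>X. nY f \<le> C * nX f)"

definition equal_equivalent_norms :: "'a set \<Rightarrow> ('a \<Rightarrow> real) \<Rightarrow> 'a set \<Rightarrow> ('a \<Rightarrow> real) \<Rightarrow> bool" where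
  "equal_equivalent_norms X nX Y nY \<longleftrightarrow> X = Y \<and>
     (\<exists>c>0. \<exists>C>0. \<forall>f\<in>X. c * nY f \<le> nX f \<and> nX f \<le> C * nY f)"

end

theory Submission
  imports Defs
begin

text \<open>Each of the norms is determined by the numbers \<open>a\<^sub>j = \<parallel>P\<^sub>jf\<parallel>\<close>. For the Barron and Sobolev norms this is
  their definition: with \<open>t\<^sub>j = (1 + \<mu>\<^sub>j)\<^sup>1\<^sup>/\<^sup>2\<close> they are the \<open>\<ell>\<^sup>1\<close> and \<open>\<ell>\<^sup>2\<close> norms of \<open>t\<^sub>j\<^sup>s a\<^sub>j\<close>. For the Besov norms
  it is Pythagoras: if \<open>m\<^sub>n(t)\<close> denotes the \<open>n\<close>-th dyadic multiplier, then
  \<open>\<parallel>Q\<^sub>nf\<parallel>\<^sup>2 = \<Sum>\<^sub>j m\<^sub>n(t\<^sub>j)\<^sup>2 a\<^sub>j\<^sup>2\<close> (\<open>spectral_multiplier_norm\<close>).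

  Pythagoras requires that the \<open>P\<^sub>j\<close> are orthogonal projections onto closed, pairwise orthogonal
  subspaces. The eigenspaces are closed since \<open>L\<close> is defined as a closure, and projections onto them
  exist by completeness of \<open>L\<^sup>2\<close> (\<open>L2_complete\<close>, \<open>orth_projection\<close>). They are orthogonal since \<open>\<Delta>\<close> is
  symmetric on smooth functions, which passes to the closure. The symmetry is Green's formula
  \<open>\<integral> k \<Delta>f d\<nu> = - \<integral> \<langle>dk, df\<rangle> d\<nu>\<close> (\<open>green_volume\<close>): for \<open>k\<close> supported in one chart it says that a
  compactly supported divergence integrates to zero, and a partition of unity reduces the general
  case to this one, because the pairing of differentials is independent of the chart and linear
  in \<open>k\<close>.

  What remains concerns sequences. For \<open>t \<ge> 1\<close> only boundedly many \<open>m\<^sub>n(t)\<close> are nonzero, and for those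
  \<open>2\<^sup>n\<close> is comparable to \<open>t\<close>; moreover \<open>\<Sum>\<^sub>n m\<^sub>n(t) = 1\<close>. Hence \<open>\<Sum>\<^sub>n 2\<^sup>n\<^sup>s |m\<^sub>n(t)|\<close> is at most a constant times
  \<open>t\<^sup>s\<close>, and \<open>\<Sum>\<^sub>n (2\<^sup>n\<^sup>s m\<^sub>n(t))\<^sup>2\<close> is comparable to \<open>t\<^sup>2\<^sup>s\<close> from both sides
  (\<open>dyadic_block_square_function\<close>). Summing the latter against \<open>a\<^sub>j\<^sup>2\<close> identifies \<open>B\<^sup>s\<^sub>2\<^sub>,\<^sub>2\<close> with \<open>H\<^sup>s\<close>;
  summing the former against \<open>a\<^sub>j\<close>, after \<open>\<parallel>Q\<^sub>nf\<parallel> \<le> \<Sum>\<^sub>j |m\<^sub>n(t\<^sub>j)| a\<^sub>j\<close>, bounds the \<open>B\<^sup>s\<^sub>2\<^sub>,\<^sub>1\<close> norm by the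
  Barron norm. The embedding of \<open>B\<^sup>s\<^sub>2\<^sub>,\<^sub>1\<close> into \<open>B\<^sup>s\<^sub>2\<^sub>,\<^sub>2\<close> is the inclusion of \<open>\<ell>\<^sup>1\<close> in \<open>\<ell>\<^sup>2\<close>.\<close>

section \<open>The Hilbert space of square-integrable functions\<close>

lemma L2D:
  assumes "f \<in> L2 M"
  shows "f \<in> borel_measurable M" "integrable M (\<lambda>x. (f x)\<^sup>2)"
  using assms by (auto simp: L2_def)

lemma L2_integrable_mult:
  assumes "f \<in> L2 M" "h \<in> L2 M"
  shows "integrable M (\<lambda>x. f x * h x)"
proof (rule Bochner_Integration.integrable_bound)
  show "integrable M (\<lambda>x. (f x)\<^sup>2 + (h x)\<^sup>2)"
    using assms by (auto simp: L2_def)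
  show "(\<lambda>x. f x * h x) \<in> borel_measurable M" using assms by (auto simp: L2_def)
  have "\<bar>a * b\<bar> \<le> \<bar>a\<^sup>2 + b\<^sup>2\<bar>" for a b :: real
  proof -
    have "0 \<le> (\<bar>a\<bar> - \<bar>b\<bar>)\<^sup>2" by simp
    then have "2 * (\<bar>a\<bar> * \<bar>b\<bar>) \<le> a\<^sup>2 + b\<^sup>2" by (simp add: power2_diff)
    moreover have "0 \<le> \<bar>a\<bar> * \<bar>b\<bar>" by simp
    ultimately show ?thesis unfolding abs_mult by linarith
  qed
  then show "AE x in M. norm (f x * h x) \<le> norm ((f x)\<^sup>2 + (h x)\<^sup>2)" by simp
qed

lemma L2_lincomb:
  assumes "f \<in> L2 M" "h \<in> L2 M"
  shows "(\<lambda>x. a * f x + b * h x) \<in> L2 M"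
proof -
  have "integrable M (\<lambda>x. a\<^sup>2 * (f x)\<^sup>2 + (2 * a * b) * (f x * h x) + b\<^sup>2 * (h x)\<^sup>2)"
    using assms L2_integrable_mult[OF assms] by (auto simp: L2_def)
  moreover have "(\<lambda>x. (a * f x + b * h x)\<^sup>2)
      = (\<lambda>x. a\<^sup>2 * (f x)\<^sup>2 + (2 * a * b) * (f x * h x) + b\<^sup>2 * (h x)\<^sup>2)"
    by (auto simp: power2_sum power_mult_distrib)
  ultimately show ?thesis using assms by (auto simp: L2_def)
qed

lemma L2_zero: "(\<lambda>x. 0) \<in> L2 M" by (simp add: L2_def)

lemma L2_add: "f \<in> L2 M \<Longrightarrow> h \<in> L2 M \<Longrightarrow> (\<lambda>x. f x + h x) \<in> L2 M"
  using L2_lincomb[of f M h 1 1] by simp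

lemma L2_diff: "f \<in> L2 M \<Longrightarrow> h \<in> L2 M \<Longrightarrow> (\<lambda>x. f x - h x) \<in> L2 M"
  using L2_lincomb[of f M h 1 "-1"] by simp

lemma L2_cmult: "f \<in> L2 M \<Longrightarrow> (\<lambda>x. a * f x) \<in> L2 M"
  using L2_lincomb[of f M f a 0] by simp

lemma L2_sum: "(\<And>i. i \<in> I \<Longrightarrow> f i \<in> L2 M) \<Longrightarrow> (\<lambda>x. \<Sum>i\<in>I. f i x) \<in> L2 M"
  by (induction I rule: infinite_finite_induct) (auto simp: L2_zero L2_add)

lemma L2_abs: "f \<in> L2 M \<Longrightarrow> (\<lambda>x. \<bar>f x\<bar>) \<in> L2 M"
  by (auto simp: L2_def)

lemma L2_inner_commute: "L2_inner M f h = L2_inner M h f"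
  by (simp add: L2_inner_def mult.commute)

lemma L2_inner_lincomb:
  assumes "f \<in> L2 M" "h \<in> L2 M" "k \<in> L2 M"
  shows "L2_inner M (\<lambda>x. a * f x + b * h x) k = a * L2_inner M f k + b * L2_inner M h k"
  using L2_integrable_mult[OF assms(1,3)] L2_integrable_mult[OF assms(2,3)]
  by (simp add: L2_inner_def distrib_right mult.assoc)

lemma L2_inner_diff:
  assumes "f \<in> L2 M" "h \<in> L2 M" "k \<in> L2 M"
  shows "L2_inner M (\<lambda>x. f x - h x) k = L2_inner M f k - L2_inner M h k"
  using L2_inner_lincomb[OF assms, of 1 "-1"] by simp

lemma L2_inner_cmult:
  "L2_inner M (\<lambda>x. a * f x) h = a * L2_inner M f h"
  by (simp add: L2_inner_def mult.assoc)

lemma L2_inner_sum: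
  assumes "\<And>i. i \<in> I \<Longrightarrow> f i \<in> L2 M" "k \<in> L2 M"
  shows "L2_inner M (\<lambda>x. \<Sum>i\<in>I. f i x) k = (\<Sum>i\<in>I. L2_inner M (f i) k)"
  unfolding L2_inner_def sum_distrib_right
  by (rule Bochner_Integration.integral_sum) (use L2_integrable_mult assms in auto)

lemma L2_norm_nonneg [simp]: "0 \<le> L2_norm M f"
  by (simp add: L2_norm_def)

lemma L2_norm_sq: "(L2_norm M f)\<^sup>2 = L2_inner M f f"
  by (simp add: L2_norm_def L2_inner_def power2_eq_square)

lemma L2_norm_cmult: "L2_norm M (\<lambda>x. a * f x) = \<bar>a\<bar> * L2_norm M f"
  by (simp add: L2_norm_def power_mult_distrib real_sqrt_mult)

lemma L2_norm_sq_lincomb: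
  assumes "f \<in> L2 M" "h \<in> L2 M"
  shows "(L2_norm M (\<lambda>x. f x + t * h x))\<^sup>2
       = (L2_norm M f)\<^sup>2 + 2 * t * L2_inner M f h + t\<^sup>2 * (L2_norm M h)\<^sup>2"
proof -
  have k: "(\<lambda>x. f x + t * h x) \<in> L2 M" using L2_lincomb[OF assms, of 1 t] by simp
  have 1: "L2_inner M (\<lambda>x. f x + t * h x) k = L2_inner M f k + t * L2_inner M h k"
    if "k \<in> L2 M" for k
    using L2_inner_lincomb[OF assms that, of 1 t] by simp
  show ?thesis
    unfolding L2_norm_sq 1[OF k] L2_inner_commute[of M f "\<lambda>x. f x + t * h x"]
      L2_inner_commute[of M h "\<lambda>x. f x + t * h x"] 1[OF assms(1)] 1[OF assms(2)]
      L2_inner_commute[of M h f]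
    by (simp add: algebra_simps power2_eq_square)
qed

text \<open>For small \<open>t\<close> the linear term dominates, and it changes its sign at \<open>0\<close>.\<close>

lemma quadratic_nonneg_imp_linear_zero:
  fixes b c :: real
  assumes "\<And>t. 0 \<le> 2 * t * b + t\<^sup>2 * c"
  shows "b = 0"
proof (rule ccontr)
  assume "b \<noteq> 0"
  define e where "e = 1 + \<bar>c\<bar>"
  have "e > 0" "c < e * 2" unfolding e_def by auto
  have "0 \<le> 2 * (- b / e) * b + (- b / e)\<^sup>2 * c" by (rule assms)
  also have "\<dots> = (b / e)\<^sup>2 * (c - 2 * e)"
    using \<open>e > 0\<close> by (simp add: power2_eq_square field_simps)
  also have "\<dots> < 0"
    using \<open>b \<noteq> 0\<close> \<open>e > 0\<close> \<open>c < e * 2\<close> by (intro mult_pos_neg) auto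
  finally show False by simp
qed

lemma L2_Cauchy_Schwarz:
  assumes "f \<in> L2 M" "h \<in> L2 M"
  shows "\<bar>L2_inner M f h\<bar> \<le> L2_norm M f * L2_norm M h"
proof (cases "L2_norm M h = 0")
  case True
  have q: "0 \<le> (L2_norm M f)\<^sup>2 + 2 * t * L2_inner M f h" for t
    using L2_norm_sq_lincomb[OF assms, of t] True
      zero_le_power2[of "L2_norm M (\<lambda>x. f x + t * h x)"] by simp
  have "L2_inner M f h = 0"
  proof (rule ccontr)
    assume n: "L2_inner M f h \<noteq> 0"
    show False
      using q[of "- ((L2_norm M f)\<^sup>2 + 1) / (2 * L2_inner M f h)"] n by (simp add: field_simps)
  qed
  then show ?thesis using True by simp
next
  case False
  define t where "t = - L2_inner M f h / (L2_norm M h)\<^sup>2"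
  have "0 \<le> (L2_norm M f)\<^sup>2 + 2 * t * L2_inner M f h + t\<^sup>2 * (L2_norm M h)\<^sup>2"
    using L2_norm_sq_lincomb[OF assms, of t] by (metis zero_le_power2)
  also have "\<dots> = (L2_norm M f)\<^sup>2 - (L2_inner M f h)\<^sup>2 / (L2_norm M h)\<^sup>2"
    using False by (simp add: t_def power2_eq_square field_simps)
  finally have "(L2_inner M f h)\<^sup>2 \<le> (L2_norm M f * L2_norm M h)\<^sup>2"
    using False by (simp add: field_simps power_mult_distrib)
  then show ?thesis
    by (metis L2_norm_nonneg abs_le_square_iff abs_of_nonneg mult_nonneg_nonneg)
qed

lemma L2_norm_add_le:
  assumes "f \<in> L2 M" "h \<in> L2 M"
  shows "L2_norm M (\<lambda>x. f x + h x) \<le> L2_norm M f + L2_norm M h"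
proof (rule power2_le_imp_le)
  have "(L2_norm M (\<lambda>x. f x + h x))\<^sup>2
      = (L2_norm M f)\<^sup>2 + 2 * L2_inner M f h + (L2_norm M h)\<^sup>2"
    using L2_norm_sq_lincomb[OF assms, of 1] by simp
  also have "\<dots> \<le> (L2_norm M f + L2_norm M h)\<^sup>2"
    using L2_Cauchy_Schwarz[OF assms] by (simp add: power2_sum)
  finally show "(L2_norm M (\<lambda>x. f x + h x))\<^sup>2 \<le> (L2_norm M f + L2_norm M h)\<^sup>2" .
qed simp

lemma L2_norm_minus: "L2_norm M (\<lambda>x. f x - h x) = L2_norm M (\<lambda>x. h x - f x)"
  by (simp add: L2_norm_def power2_commute)

lemma L2_norm_triangle:
  assumes "f \<in> L2 M" "h \<in> L2 M" "k \<in> L2 M"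
  shows "L2_norm M (\<lambda>x. f x - k x) \<le> L2_norm M (\<lambda>x. f x - h x) + L2_norm M (\<lambda>x. h x - k x)"
  using L2_norm_add_le[OF L2_diff[OF assms(1,2)] L2_diff[OF assms(2,3)]] by simp

lemma L2_norm_sum_le:
  assumes "\<And>i. i \<in> I \<Longrightarrow> f i \<in> L2 M"
  shows "L2_norm M (\<lambda>x. \<Sum>i\<in>I. f i x) \<le> (\<Sum>i\<in>I. L2_norm M (f i))"
  using assms
proof (induction I rule: infinite_finite_induct)
  case (insert i I)
  then have "L2_norm M (\<lambda>x. f i x + (\<Sum>i\<in>I. f i x))
      \<le> L2_norm M (f i) + L2_norm M (\<lambda>x. \<Sum>i\<in>I. f i x)"
    by (intro L2_norm_add_le L2_sum) auto
  with insert show ?case by fastforce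
qed (simp_all add: L2_norm_def)

lemma L2_tendsto_norm:
  assumes "\<And>k. F k \<in> L2 M" "f \<in> L2 M" "L2_tendsto M F f"
  shows "(\<lambda>k. L2_norm M (F k)) \<longlonglongrightarrow> L2_norm M f"
proof (rule LIM_zero_cancel, rule Lim_null_comparison[OF _ assms(3)[unfolded L2_tendsto_def]])
  show "\<forall>\<^sub>F k in sequentially. norm (L2_norm M (F k) - L2_norm M f)
      \<le> L2_norm M (\<lambda>x. F k x - f x)"
  proof (intro always_eventually allI)
    fix k
    show "norm (L2_norm M (F k) - L2_norm M f) \<le> L2_norm M (\<lambda>x. F k x - f x)"
      using L2_norm_triangle[OF assms(1)[of k] assms(2) L2_zero]
        L2_norm_triangle[OF assms(2) assms(1)[of k] L2_zero] L2_norm_minus[of M "F k" f]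
      by (simp add: abs_le_iff)
  qed
qed

lemma L2_tendsto_inner:
  assumes F: "\<And>k. F k \<in> L2 M" "f \<in> L2 M" "L2_tendsto M F f"
    and H: "\<And>k. H k \<in> L2 M" "h \<in> L2 M" "L2_tendsto M H h"
  shows "(\<lambda>k. L2_inner M (F k) (H k)) \<longlonglongrightarrow> L2_inner M f h"
proof (rule LIM_zero_cancel, rule Lim_null_comparison)
  let ?B = "\<lambda>k. L2_norm M (\<lambda>x. F k x - f x) * L2_norm M (H k)
               + L2_norm M f * L2_norm M (\<lambda>x. H k x - h x)"
  show "\<forall>\<^sub>F k in sequentially. norm (L2_inner M (F k) (H k) - L2_inner M f h) \<le> ?B k"
  proof (intro always_eventually allI)
    fix k
    have "L2_inner M (F k) (H k) - L2_inner M f h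
        = L2_inner M (\<lambda>x. F k x - f x) (H k) + L2_inner M (\<lambda>x. H k x - h x) f"
      using F H by (simp add: L2_inner_diff L2_inner_commute[of M h f] L2_inner_commute[of M "H k" f])
    also have "norm \<dots> \<le> ?B k"
      using L2_Cauchy_Schwarz[OF L2_diff[OF F(1)[of k] F(2)] H(1)[of k]]
        L2_Cauchy_Schwarz[OF L2_diff[OF H(1)[of k] H(2)] F(2)]
      by (simp add: mult.commute)
    finally show "norm (L2_inner M (F k) (H k) - L2_inner M f h) \<le> ?B k" .
  qed
  have "?B \<longlonglongrightarrow> 0 * L2_norm M h + L2_norm M f * 0"
    by (intro tendsto_intros L2_tendsto_norm H F(3)[unfolded L2_tendsto_def]
        H(3)[unfolded L2_tendsto_def])
  then show "?B \<longlonglongrightarrow> 0" by simp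
qed

lemma L2_norm_nn:
  assumes "f \<in> L2 M"
  shows "(\<integral>\<^sup>+x. ennreal ((f x)\<^sup>2) \<partial>M) = ennreal ((L2_norm M f)\<^sup>2)"
  using assms by (simp add: L2_def L2_norm_def nn_integral_eq_integral)

lemma L2_normI:
  assumes "f \<in> borel_measurable M" "(\<integral>\<^sup>+x. ennreal ((f x)\<^sup>2) \<partial>M) \<le> ennreal (B\<^sup>2)" "0 \<le> B"
  shows "f \<in> L2 M" "L2_norm M f \<le> B"
proof -
  have "integrable M (\<lambda>x. (f x)\<^sup>2)"
  proof (rule integrableI_bounded)
    show "(\<integral>\<^sup>+x. ennreal (norm ((f x)\<^sup>2)) \<partial>M) < \<infinity>"
      using assms(2) by (simp add: order.strict_trans1)
  qed (use assms in simp)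
  then show L: "f \<in> L2 M" using assms(1) by (simp add: L2_def)
  show "L2_norm M f \<le> B"
    using assms(2,3) unfolding L2_norm_nn[OF L] by (simp add: power2_le_iff_abs_le)
qed

text \<open>Riesz--Fischer for sequences whose increments have summable norms: the series of the
  absolute increments is the monotone limit of functions of bounded norm, so it is finite almost
  everywhere, the sequence converges almost everywhere, and Fatou's lemma controls the limit.\<close>

lemma L2_complete_summable:
  assumes F: "\<And>k. F k \<in> L2 M" and sm: "summable (\<lambda>k. L2_norm M (\<lambda>x. F (Suc k) x - F k x))"
  shows "\<exists>f\<in>L2 M. L2_tendsto M F f"
proof -
  let ?d = "\<lambda>k. L2_norm M (\<lambda>x. F (Suc k) x - F k x)"
  define B where "B = (\<Sum>k. ?d k)"
  have B: "(\<Sum>k<N. ?d k) \<le> B" for N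
    unfolding B_def by (rule sum_le_suminf[OF sm]) auto
  have mF [measurable]: "F k \<in> borel_measurable M" for k using F[of k] by (simp add: L2_def)
  define S where "S N x = (\<Sum>k<N. \<bar>F (Suc k) x - F k x\<bar>)" for N x
  have S0: "0 \<le> S N x" for N x unfolding S_def by (intro sum_nonneg) auto
  have S: "S N \<in> L2 M" for N
    unfolding S_def by (intro L2_sum L2_abs L2_diff F)
  have nS: "L2_norm M (S N) \<le> B" for N
  proof -
    have "L2_norm M (S N) \<le> (\<Sum>k<N. L2_norm M (\<lambda>x. \<bar>F (Suc k) x - F k x\<bar>))"
      unfolding S_def by (intro L2_norm_sum_le L2_abs L2_diff F)
    also have "\<dots> = (\<Sum>k<N. ?d k)" by (simp add: L2_norm_def)
    finally show ?thesis using B[of N] by simp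
  qed
  have mono: "incseq (\<lambda>N x. ennreal ((S N x)\<^sup>2))"
    by (intro incseq_SucI le_funI ennreal_leI power_mono S0) (simp add: S_def)
  have "(\<integral>\<^sup>+x. (SUP N. ennreal ((S N x)\<^sup>2)) \<partial>M) = (SUP N. \<integral>\<^sup>+x. ennreal ((S N x)\<^sup>2) \<partial>M)"
    using L2D(1)[OF S] by (intro nn_integral_monotone_convergence_SUP mono) measurable
  also have "\<dots> \<le> ennreal (B\<^sup>2)"
    using nS by (intro SUP_least) (auto simp: L2_norm_nn[OF S] intro!: ennreal_leI power_mono)
  finally have "(\<integral>\<^sup>+x. (SUP N. ennreal ((S N x)\<^sup>2)) \<partial>M) \<noteq> \<infinity>"
    by (metis ennreal_neq_top infinity_ennreal_def neq_top_trans)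
  then have "AE x in M. (SUP N. ennreal ((S N x)\<^sup>2)) \<noteq> \<infinity>"
    using L2D(1)[OF S] by (intro nn_integral_PInf_AE) measurable
  then have conv: "AE x in M. convergent (\<lambda>k. F k x)"
  proof eventually_elim
    case (elim x)
    then obtain C where C: "(SUP N. ennreal ((S N x)\<^sup>2)) = ennreal C" "0 \<le> C"
      by (metis ennreal_cases infinity_ennreal_def)
    have "S N x \<le> sqrt C" for N
    proof -
      have "ennreal ((S N x)\<^sup>2) \<le> ennreal C" unfolding C(1)[symmetric] by (rule SUP_upper) simp
      then show ?thesis using C(2) by (simp add: real_le_rsqrt)
    qed
    then have "(\<Sum>k\<le>N. \<bar>F (Suc k) x - F k x\<bar>) \<le> sqrt C" for N
      unfolding S_def lessThan_Suc_atMost[symmetric] by blast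
    then have "summable (\<lambda>k. \<bar>F (Suc k) x - F k x\<bar>)"
      by (intro bounded_imp_summable[of _ "sqrt C"]) auto
    then have "summable (\<lambda>k. F (Suc k) x - F k x)"
      by (rule summable_rabs_cancel)
    then have "convergent (\<lambda>N. \<Sum>k<N. F (Suc k) x - F k x)"
      by (simp add: summable_iff_convergent)
    then have "convergent (\<lambda>N. F N x - F 0 x)"
      using sum_lessThan_telescope[of "\<lambda>k. F k x"] by simp
    then have "convergent (\<lambda>N. (F N x - F 0 x) + F 0 x)"
      by (intro convergent_add convergent_const)
    then show ?case by simp
  qed
  define f where "f x = lim (\<lambda>k. F k x)" for x
  have mf [measurable]: "f \<in> borel_measurable M" unfolding f_def by measurable
  have lim: "AE x in M. (\<lambda>k. F k x) \<longlonglongrightarrow> f x"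
    using conv by eventually_elim (simp add: f_def convergent_LIMSEQ_iff)
  have tail: "L2_norm M (\<lambda>x. F m x - F k x) \<le> (\<Sum>i. ?d (i + k))" if "k \<le> m" for m k
  proof -
    have "(\<lambda>x. F m x - F k x) = (\<lambda>x. \<Sum>i<m-k. F (Suc (i + k)) x - F (i + k) x)"
      using sum_lessThan_telescope[of "\<lambda>i. F (i + k) _" "m - k"] that by auto
    then have "L2_norm M (\<lambda>x. F m x - F k x) \<le> (\<Sum>i<m-k. ?d (i + k))"
      using L2_norm_sum_le[of "{..<m-k}" "\<lambda>i x. F (Suc (i + k)) x - F (i + k) x" M,
          OF L2_diff[OF F F]] by simp
    also have "\<dots> \<le> (\<Sum>i. ?d (i + k))"
      using summable_ignore_initial_segment[OF sm, of k] by (intro sum_le_suminf) auto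
    finally show ?thesis .
  qed
  have T0: "0 \<le> (\<Sum>i. ?d (i + k))" for k
    using summable_ignore_initial_segment[OF sm, of k] by (intro suminf_nonneg) auto
  have fatou: "(\<integral>\<^sup>+x. ennreal ((f x - F k x)\<^sup>2) \<partial>M) \<le> ennreal ((\<Sum>i. ?d (i + k))\<^sup>2)" for k
  proof -
    have "(\<integral>\<^sup>+x. ennreal ((f x - F k x)\<^sup>2) \<partial>M)
        = (\<integral>\<^sup>+x. liminf (\<lambda>m. ennreal ((F m x - F k x)\<^sup>2)) \<partial>M)"
    proof (rule nn_integral_cong_AE, use lim in eventually_elim)
      case (elim x)
      then have "(\<lambda>m. ennreal ((F m x - F k x)\<^sup>2)) \<longlonglongrightarrow> ennreal ((f x - F k x)\<^sup>2)"
        by (intro tendsto_intros)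
      then show ?case by (intro lim_imp_Liminf[symmetric]) auto
    qed
    also have "\<dots> \<le> liminf (\<lambda>m. \<integral>\<^sup>+x. ennreal ((F m x - F k x)\<^sup>2) \<partial>M)"
      by (rule nn_integral_liminf) measurable
    also have "\<dots> \<le> ennreal ((\<Sum>i. ?d (i + k))\<^sup>2)"
    proof -
      have "\<forall>\<^sub>F m in sequentially. (\<integral>\<^sup>+x. ennreal ((F m x - F k x)\<^sup>2) \<partial>M)
          \<le> ennreal ((\<Sum>i. ?d (i + k))\<^sup>2)"
        using eventually_ge_at_top[of k]
        by eventually_elim
           (auto simp: L2_norm_nn[OF L2_diff[OF F F]] intro!: ennreal_leI power_mono tail)
      then have "liminf (\<lambda>m. \<integral>\<^sup>+x. ennreal ((F m x - F k x)\<^sup>2) \<partial>M)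
          \<le> liminf (\<lambda>m. ennreal ((\<Sum>i. ?d (i + k))\<^sup>2))"
        by (rule Liminf_mono)
      then show ?thesis by (simp add: Liminf_const)
    qed
    finally show ?thesis .
  qed
  have fk: "(\<lambda>x. f x - F k x) \<in> L2 M" "L2_norm M (\<lambda>x. f x - F k x) \<le> (\<Sum>i. ?d (i + k))" for k
    using L2_normI[OF _ fatou T0] by auto
  have "f \<in> L2 M" using L2_add[OF fk(1)[of 0] F[of 0]] by simp
  moreover have "L2_tendsto M F f"
    unfolding L2_tendsto_def
  proof (rule tendsto_sandwich[OF _ _ tendsto_const])
    show "(\<lambda>k. \<Sum>i. ?d (i + k)) \<longlonglongrightarrow> 0" by (rule suminf_exist_split2[OF sm])
  qed (use fk(2) in \<open>auto simp: L2_norm_minus[of M _ f]\<close>)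
  ultimately show ?thesis by blast
qed

text \<open>A Cauchy sequence converges as soon as a subsequence does, and it has a subsequence whose
  increments have norms below \<open>2\<^sup>-\<^sup>k\<close>.\<close>

lemma L2_complete:
  assumes F: "\<And>k. F k \<in> L2 M"
    and cau: "\<And>e. e > 0 \<Longrightarrow> \<exists>N. \<forall>m\<ge>N. \<forall>n\<ge>N. L2_norm M (\<lambda>x. F m x - F n x) < e"
  shows "\<exists>f\<in>L2 M. L2_tendsto M F f"
proof -
  obtain N where N: "\<And>k m n. m \<ge> N k \<Longrightarrow> n \<ge> N k \<Longrightarrow> L2_norm M (\<lambda>x. F m x - F n x) < (1/2) ^ k"
    using cau[of "(1/2) ^ _"] by (metis half_gt_zero_iff zero_less_one zero_less_power)
  define r where "r k = (\<Sum>i\<le>k. N i) + k" for k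
  have rN: "N k \<le> r k" for k
    unfolding r_def by (intro trans_le_add1 member_le_sum) auto
  have rS: "r k \<le> r (Suc k)" for k unfolding r_def by simp
  have rk: "k \<le> r k" for k unfolding r_def by simp
  have "summable (\<lambda>k. L2_norm M (\<lambda>x. F (r (Suc k)) x - F (r k) x))"
  proof (rule summable_comparison_test')
    show "summable (\<lambda>k. (1/2::real) ^ k)" by simp
    show "norm (L2_norm M (\<lambda>x. F (r (Suc k)) x - F (r k) x)) \<le> (1/2) ^ k" if "k \<ge> 0" for k
      using N[of k "r (Suc k)" "r k"] rN[of k] rS[of k] by simp
  qed
  then obtain f where f: "f \<in> L2 M" "L2_tendsto M (\<lambda>k. F (r k)) f"
    using L2_complete_summable[of "\<lambda>k. F (r k)" M] F by auto
  have "(\<lambda>n. L2_norm M (\<lambda>x. F n x - f x)) \<longlonglongrightarrow> 0"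
  proof (rule LIMSEQ_I)
    fix e :: real assume "e > 0"
    then obtain N1 where N1: "\<And>m n. m \<ge> N1 \<Longrightarrow> n \<ge> N1 \<Longrightarrow> L2_norm M (\<lambda>x. F m x - F n x) < e / 2"
      using cau[of "e / 2"] by auto
    obtain N2 where N2: "\<And>k. k \<ge> N2 \<Longrightarrow> L2_norm M (\<lambda>x. F (r k) x - f x) < e / 2"
      using LIMSEQ_D[OF f(2)[unfolded L2_tendsto_def], of "e / 2"] \<open>e > 0\<close> by auto
    have "norm (L2_norm M (\<lambda>x. F n x - f x) - 0) < e" if "n \<ge> N1" for n
    proof -
      let ?k = "max N1 N2"
      have "L2_norm M (\<lambda>x. F n x - F (r ?k) x) < e / 2"
        using N1[OF that, of "r ?k"] rk[of ?k] by simp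
      then show ?thesis
        using N2[of ?k] L2_norm_triangle[OF F[of n] F[of "r ?k"] f(1)] by simp
    qed
    then show "\<exists>no. \<forall>n\<ge>no. norm (L2_norm M (\<lambda>x. F n x - f x) - 0) < e" by blast
  qed
  then show ?thesis using f(1) by (intro bexI[of _ f]) (auto simp: L2_tendsto_def)
qed

text \<open>Closedness under limits includes closedness under changes on null sets, as a constant sequence
  converges to every modification of its value on a null set.\<close>

definition closed_L2_subspace :: "'m measure \<Rightarrow> ('m \<Rightarrow> real) set \<Rightarrow> bool" where
  "closed_L2_subspace M W \<longleftrightarrow> W \<subseteq> L2 M \<and> (\<lambda>x. 0) \<in> W \<and>
     (\<forall>u\<in>W. \<forall>v\<in>W. \<forall>a b. (\<lambda>x. a * u x + b * v x) \<in> W) \<and>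
     (\<forall>F f. (\<forall>k. F k \<in> W) \<longrightarrow> f \<in> L2 M \<longrightarrow> L2_tendsto M F f \<longrightarrow> f \<in> W)"

text \<open>A minimizing sequence for the distance from \<open>f\<close> to \<open>W\<close> is Cauchy by the parallelogram
  identity, and at its limit the first variation of the distance vanishes.\<close>

lemma orth_projection:
  assumes W: "closed_L2_subspace M W" and f: "f \<in> L2 M"
  shows "orth_projection M W f \<in> W"
    and "w \<in> W \<Longrightarrow> L2_inner M (\<lambda>x. f x - orth_projection M W f x) w = 0"
proof -
  have WL: "w \<in> L2 M" if "w \<in> W" for w using W that by (auto simp: closed_L2_subspace_def)
  have Wl: "(\<lambda>x. a * u x + b * v x) \<in> W" if "u \<in> W" "v \<in> W" for u v a b
    using W that by (auto simp: closed_L2_subspace_def)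
  let ?D = "(\<lambda>w. (L2_norm M (\<lambda>x. f x - w x))\<^sup>2) ` W"
  define d where "d = Inf ?D"
  have ne: "?D \<noteq> {}" and bb: "bdd_below ?D"
    using W by (auto simp: closed_L2_subspace_def intro!: bdd_belowI[of _ 0])
  have dle: "d \<le> (L2_norm M (\<lambda>x. f x - w x))\<^sup>2" if "w \<in> W" for w
    unfolding d_def by (rule cInf_lower[OF _ bb]) (use that in simp)
  have "\<exists>w\<in>W. (L2_norm M (\<lambda>x. f x - w x))\<^sup>2 < d + 1 / real (Suc k)" for k
  proof -
    have "d < d + 1 / real (Suc k)" by simp
    then have "Inf ?D < d + 1 / real (Suc k)" unfolding d_def .
    from cInf_lessD[OF ne this] show ?thesis by auto
  qed
  then obtain F where F: "\<And>k. F k \<in> W"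
    "\<And>k. (L2_norm M (\<lambda>x. f x - F k x))\<^sup>2 < d + 1 / real (Suc k)" by metis
  have par: "(L2_norm M (\<lambda>x. F m x - F n x))\<^sup>2 \<le> 2 / real (Suc m) + 2 / real (Suc n)" for m n
  proof -
    let ?u = "\<lambda>x. f x - F m x" and ?v = "\<lambda>x. f x - F n x"
    have L: "?u \<in> L2 M" "?v \<in> L2 M" using L2_diff[OF f WL[OF F(1)]] by auto
    have "(L2_norm M (\<lambda>x. ?u x + (-1) * ?v x))\<^sup>2 + (L2_norm M (\<lambda>x. ?u x + 1 * ?v x))\<^sup>2
        = 2 * (L2_norm M ?u)\<^sup>2 + 2 * (L2_norm M ?v)\<^sup>2"
      unfolding L2_norm_sq_lincomb[OF L] by simp
    moreover have "(L2_norm M (\<lambda>x. ?u x + (-1) * ?v x))\<^sup>2 = (L2_norm M (\<lambda>x. F m x - F n x))\<^sup>2"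
    proof -
      have "(\<lambda>x. ?u x + (-1) * ?v x) = (\<lambda>x. F n x - F m x)" by auto
      then show ?thesis using L2_norm_minus[of M "F m" "F n"] by simp
    qed
    moreover have "(L2_norm M (\<lambda>x. ?u x + 1 * ?v x))\<^sup>2 \<ge> 4 * d"
    proof -
      define e where "e x = f x - (1/2 * F m x + 1/2 * F n x)" for x
      have "(\<lambda>x. ?u x + 1 * ?v x) = (\<lambda>x. 2 * e x)"
        by (auto simp: e_def)
      then have "(L2_norm M (\<lambda>x. ?u x + 1 * ?v x))\<^sup>2 = 4 * (L2_norm M e)\<^sup>2"
        by (simp add: L2_norm_cmult power_mult_distrib)
      moreover have "d \<le> (L2_norm M e)\<^sup>2"
        using dle[OF Wl[OF F(1) F(1)], of "1/2" m "1/2" n] unfolding e_def .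
      ultimately show ?thesis by linarith
    qed
    ultimately have "(L2_norm M (\<lambda>x. F m x - F n x))\<^sup>2
        \<le> 2 * (1 / real (Suc m)) + 2 * (1 / real (Suc n))"
      using F(2)[of m] F(2)[of n] by linarith
    then show ?thesis by simp
  qed
  have "\<exists>p\<in>L2 M. L2_tendsto M F p"
  proof (rule L2_complete)
    fix e :: real assume "e > 0"
    obtain N :: nat where N: "4 / e\<^sup>2 < real N" using reals_Archimedean2 by blast
    have "L2_norm M (\<lambda>x. F m x - F n x) < e" if "m \<ge> N" "n \<ge> N" for m n
    proof (rule power2_less_imp_less)
      have "real N > 0" using N \<open>e > 0\<close> by (smt (verit) divide_nonneg_nonneg zero_le_power2)
      have "2 / real (Suc m) + 2 / real (Suc n) \<le> 2 / real N + 2 / real N"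
        using that \<open>real N > 0\<close> by (intro add_mono divide_left_mono) auto
      also have "\<dots> < e\<^sup>2" using N \<open>e > 0\<close> \<open>real N > 0\<close> by (simp add: field_simps)
      finally show "(L2_norm M (\<lambda>x. F m x - F n x))\<^sup>2 < e\<^sup>2" using par[of m n] by simp
    qed (use \<open>e > 0\<close> in simp)
    then show "\<exists>N. \<forall>m\<ge>N. \<forall>n\<ge>N. L2_norm M (\<lambda>x. F m x - F n x) < e" by blast
  qed (use F WL in blast)
  then obtain p where p: "p \<in> L2 M" "L2_tendsto M F p" by blast
  have pW: "p \<in> W" using W F(1) p unfolding closed_L2_subspace_def by blast
  have "L2_tendsto M (\<lambda>k x. f x - F k x) (\<lambda>x. f x - p x)"
    using p(2) unfolding L2_tendsto_def by (simp add: L2_norm_minus[of M p])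
  then have "(\<lambda>k. L2_norm M (\<lambda>x. f x - F k x)) \<longlonglongrightarrow> L2_norm M (\<lambda>x. f x - p x)"
    by (intro L2_tendsto_norm L2_diff f WL F(1) p(1))
  then have "(\<lambda>k. (L2_norm M (\<lambda>x. f x - F k x))\<^sup>2) \<longlonglongrightarrow> (L2_norm M (\<lambda>x. f x - p x))\<^sup>2"
    by (intro tendsto_intros)
  moreover have "(\<lambda>k. d + 1 / real (Suc k)) \<longlonglongrightarrow> d + 0"
    by (intro tendsto_intros LIMSEQ_Suc[OF lim_1_over_n])
  ultimately have pd: "(L2_norm M (\<lambda>x. f x - p x))\<^sup>2 \<le> d"
    using F(2) by (intro LIMSEQ_le) (auto intro: less_imp_le)
  have "L2_inner M (\<lambda>x. f x - p x) w = 0" if w: "w \<in> W" for w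
  proof (rule quadratic_nonneg_imp_linear_zero)
    fix t
    have "d \<le> (L2_norm M (\<lambda>x. f x - (1 * p x + (- t) * w x)))\<^sup>2" by (intro dle Wl pW w)
    also have "(\<lambda>x. f x - (1 * p x + (- t) * w x)) = (\<lambda>x. (f x - p x) + t * w x)" by auto
    also have "(L2_norm M \<dots>)\<^sup>2 = (L2_norm M (\<lambda>x. f x - p x))\<^sup>2
        + 2 * t * L2_inner M (\<lambda>x. f x - p x) w + t\<^sup>2 * (L2_norm M w)\<^sup>2"
      by (rule L2_norm_sq_lincomb[OF L2_diff[OF f p(1)] WL[OF w]])
    finally show "0 \<le> 2 * t * L2_inner M (\<lambda>x. f x - p x) w + t\<^sup>2 * (L2_norm M w)\<^sup>2"
      using pd by simp
  qed
  with pW have "\<exists>p. p \<in> W \<and> (\<forall>w\<in>W. L2_inner M (\<lambda>x. f x - p x) w = 0)" by blast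
  from someI_ex[OF this] show "orth_projection M W f \<in> W"
    "w \<in> W \<Longrightarrow> L2_inner M (\<lambda>x. f x - orth_projection M W f x) w = 0"
    unfolding orth_projection_def by auto
qed



lemma L2_norm_sq_orthogonal_sum:
  assumes "\<And>j. p j \<in> L2 M" "\<And>i j. i \<noteq> j \<Longrightarrow> L2_inner M (p i) (p j) = 0" "finite I"
  shows "(L2_norm M (\<lambda>x. \<Sum>j\<in>I. c j * p j x))\<^sup>2 = (\<Sum>j\<in>I. (c j)\<^sup>2 * (L2_norm M (p j))\<^sup>2)"
proof -
  have S: "(\<lambda>x. \<Sum>j\<in>I. c j * p j x) \<in> L2 M" by (intro L2_sum L2_cmult assms)
  have "(L2_norm M (\<lambda>x. \<Sum>j\<in>I. c j * p j x))\<^sup>2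
      = (\<Sum>i\<in>I. c i * L2_inner M (p i) (\<lambda>x. \<Sum>j\<in>I. c j * p j x))"
    unfolding L2_norm_sq by (subst L2_inner_sum) (auto intro!: L2_cmult assms(1) S simp: L2_inner_cmult)
  also have "\<dots> = (\<Sum>i\<in>I. c i * (\<Sum>j\<in>I. c j * L2_inner M (p j) (p i)))"
    by (subst L2_inner_commute, subst L2_inner_sum)
       (auto intro!: L2_cmult assms(1) simp: L2_inner_cmult)
  also have "\<dots> = (\<Sum>i\<in>I. c i * (\<Sum>j\<in>I. if j = i then c j * L2_inner M (p j) (p i) else 0))"
    by (intro sum.cong refl arg_cong2[where f = "(*)"]) (use assms(2) in auto)
  also have "\<dots> = (\<Sum>j\<in>I. (c j)\<^sup>2 * (L2_norm M (p j))\<^sup>2)"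
    using assms(3) by (simp add: L2_norm_sq power2_eq_square[of "c _"] mult.assoc)
  finally show ?thesis .
qed

lemma Bessel_summable:
  assumes f: "f \<in> L2 M" and p: "\<And>j. p j \<in> L2 M"
    and orth: "\<And>i j. i \<noteq> j \<Longrightarrow> L2_inner M (p i) (p j) = 0"
    and proj: "\<And>j. L2_inner M (\<lambda>x. f x - p j x) (p j) = 0"
  shows "summable (\<lambda>j. (L2_norm M (p j))\<^sup>2)"
proof (rule bounded_imp_summable[of _ "(L2_norm M f)\<^sup>2"])
  fix n
  let ?S = "\<lambda>x. \<Sum>j\<le>n. p j x"
  have S: "?S \<in> L2 M" by (intro L2_sum p)
  have pyth: "(L2_norm M ?S)\<^sup>2 = (\<Sum>j\<le>n. (L2_norm M (p j))\<^sup>2)"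
    using L2_norm_sq_orthogonal_sum[of p M "{..n}" "\<lambda>_. 1", OF p orth] by simp
  have pf: "L2_inner M (p j) f = (L2_norm M (p j))\<^sup>2" for j
    using proj[of j] L2_inner_diff[OF f p p, of j j] L2_inner_commute[of M f "p j"]
    by (simp add: L2_norm_sq)
  have "L2_inner M f ?S = L2_inner M ?S f" by (rule L2_inner_commute)
  also have "\<dots> = (\<Sum>j\<le>n. (L2_norm M (p j))\<^sup>2)"
    using L2_inner_sum[of "{..n}" p M f, OF p f] by (simp only: pf)
  finally have "(L2_norm M (\<lambda>x. f x + (-1) * ?S x))\<^sup>2
      = (L2_norm M f)\<^sup>2 - (\<Sum>j\<le>n. (L2_norm M (p j))\<^sup>2)"
    using L2_norm_sq_lincomb[OF f S, of "-1"] pyth by (simp del: minus_add_distrib)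
  then show "(\<Sum>j\<le>n. (L2_norm M (p j))\<^sup>2) \<le> (L2_norm M f)\<^sup>2"
    using zero_le_power2[of "L2_norm M (\<lambda>x. f x + (-1) * ?S x)"] by linarith
qed simp

lemma L2_orthogonal_series:
  assumes p: "\<And>j. p j \<in> L2 M" and orth: "\<And>i j. i \<noteq> j \<Longrightarrow> L2_inner M (p i) (p j) = 0"
    and sm: "summable (\<lambda>j. (c j)\<^sup>2 * (L2_norm M (p j))\<^sup>2)"
  shows "\<exists>h\<in>L2 M. L2_tendsto M (\<lambda>N x. \<Sum>j<N. c j * p j x) h"
proof (rule L2_complete)
  fix e :: real assume "e > 0"
  then obtain N where N: "\<And>m n. m \<ge> N \<Longrightarrow>
      norm (\<Sum>j\<in>{m..<n}. (c j)\<^sup>2 * (L2_norm M (p j))\<^sup>2) < e\<^sup>2"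
    using sm unfolding summable_Cauchy by (meson zero_less_power)
  have *: "L2_norm M (\<lambda>x. (\<Sum>j<m. c j * p j x) - (\<Sum>j<n. c j * p j x)) < e"
    if "N \<le> n" "n \<le> m" for m n
  proof (rule power2_less_imp_less)
    have "(\<lambda>x. (\<Sum>j<m. c j * p j x) - (\<Sum>j<n. c j * p j x))
        = (\<lambda>x. \<Sum>j\<in>{n..<m}. c j * p j x)"
      using that sum_diff_nat_ivl[of 0 n m] by (auto simp: lessThan_atLeast0)
    then have "(L2_norm M (\<lambda>x. (\<Sum>j<m. c j * p j x) - (\<Sum>j<n. c j * p j x)))\<^sup>2
        = (\<Sum>j\<in>{n..<m}. (c j)\<^sup>2 * (L2_norm M (p j))\<^sup>2)"
      using L2_norm_sq_orthogonal_sum[of p M "{n..<m}" c, OF p orth] by simp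
    then show "(L2_norm M (\<lambda>x. (\<Sum>j<m. c j * p j x) - (\<Sum>j<n. c j * p j x)))\<^sup>2 < e\<^sup>2"
      using N[OF that(1), of m] by simp
  qed (use \<open>e > 0\<close> in simp)
  have "L2_norm M (\<lambda>x. (\<Sum>j<m. c j * p j x) - (\<Sum>j<n. c j * p j x)) < e"
    if "N \<le> n" "N \<le> m" for m n
    using *[of n m] *[of m n] that L2_norm_minus[of M "\<lambda>x. \<Sum>j<m. c j * p j x" "\<lambda>x. \<Sum>j<n. c j * p j x"]
    by (cases "n \<le> m") auto
  then show "\<exists>N. \<forall>m\<ge>N. \<forall>n\<ge>N. L2_norm M (\<lambda>x. (\<Sum>j<m. c j * p j x) - (\<Sum>j<n. c j * p j x)) < e"
    by blast
qed (intro L2_sum L2_cmult p)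

lemma L2_norm_sq_orthogonal_series:
  assumes p: "\<And>j. p j \<in> L2 M" and orth: "\<And>i j. i \<noteq> j \<Longrightarrow> L2_inner M (p i) (p j) = 0"
    and h: "h \<in> L2 M" "L2_tendsto M (\<lambda>N x. \<Sum>j<N. c j * p j x) h"
  shows "(\<lambda>j. (c j)\<^sup>2 * (L2_norm M (p j))\<^sup>2) sums (L2_norm M h)\<^sup>2"
proof -
  have "(\<lambda>N. (L2_norm M (\<lambda>x. \<Sum>j<N. c j * p j x))\<^sup>2) \<longlonglongrightarrow> (L2_norm M h)\<^sup>2"
    by (intro tendsto_power L2_tendsto_norm h L2_sum L2_cmult p)
  then show ?thesis
    unfolding sums_def using L2_norm_sq_orthogonal_sum[of p M "{..<_}" c, OF p orth] by simp
qed

section \<open>Calculus of continuously differentiable functions\<close>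

abbreviation C1_on :: "'a::euclidean_space set \<Rightarrow> ('a \<Rightarrow> 'b::real_normed_vector) \<Rightarrow> bool" where
  "C1_on S f \<equiv> Ck_on (Suc 0) S f"

lemma C1_onI:
  assumes "\<And>x. x \<in> S \<Longrightarrow> (f has_derivative f' x) (at x)"
    and "\<And>v. continuous_on S (\<lambda>x. f' x v)"
  shows "C1_on S f"
proof -
  have "continuous_on S (\<lambda>x. frechet_derivative f (at x) v)" for v
    using assms(2)[of v] by (rule continuous_on_eq) (metis assms(1) frechet_derivative_at)
  then show ?thesis using assms(1) by (auto simp: differentiable_def)
qed

lemma C1_onD:
  assumes "C1_on S f"
  shows "x \<in> S \<Longrightarrow> (f has_derivative frechet_derivative f (at x)) (at x)"
    and "continuous_on S (\<lambda>x. frechet_derivative f (at x) v)"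
    and "continuous_on S f"
proof -
  have d: "\<And>x. x \<in> S \<Longrightarrow> f differentiable (at x)" using assms by simp
  then show "x \<in> S \<Longrightarrow> (f has_derivative frechet_derivative f (at x)) (at x)"
    using frechet_derivative_works by blast
  show "continuous_on S (\<lambda>x. frechet_derivative f (at x) v)" using assms by simp
  show "continuous_on S f"
    by (meson d differentiable_imp_continuous_within continuous_at_imp_continuous_on)
qed



lemma Ck_on_cong:
  assumes "open S" "\<And>x. x \<in> S \<Longrightarrow> f x = h x" "Ck_on k S f"
  shows "Ck_on k S h"
  using assms
proof (induction k arbitrary: f h)
  case 0
  then show ?case by (auto intro: continuous_on_eq)
next
  case (Suc k)
  have d: "h differentiable at x" "frechet_derivative f (at x) = frechet_derivative h (at x)"
    if "x \<in> S" for x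
  proof -
    have f: "f differentiable at x" using Suc.prems(3) that by simp
    show "frechet_derivative f (at x) = frechet_derivative h (at x)"
      by (rule frechet_derivative_transform_within_open[OF f Suc.prems(1) that])
         (use Suc.prems(2) in auto)
    show "h differentiable at x"
      using f Suc.prems(1,2) that unfolding differentiable_def
      by (metis has_derivative_transform_within_open)
  qed
  have "Ck_on k S (\<lambda>x. frechet_derivative h (at x) v)" for v
    by (rule Suc.IH[of "\<lambda>x. frechet_derivative f (at x) v"])
       (use Suc.prems d in auto)
  with d show ?case by simp
qed

lemma C1_on_Un:
  assumes "open S" "open T" "C1_on S f" "C1_on T f"
  shows "C1_on (S \<union> T) f"
  using assms by (auto intro!: continuous_on_open_Un)

lemma C1_on_const: "C1_on S (\<lambda>x. c)"
  by (rule C1_onI[where f' = "\<lambda>x v. 0"]) auto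

lemma C1_on_bounded_linear:
  assumes "bounded_linear F" "C1_on S f"
  shows "C1_on S (\<lambda>x. F (f x))"
proof (rule C1_onI[where f' = "\<lambda>x v. F (frechet_derivative f (at x) v)"])
  show "((\<lambda>x. F (f x)) has_derivative (\<lambda>v. F (frechet_derivative f (at x) v))) (at x)"
    if "x \<in> S" for x
    using bounded_linear.has_derivative[OF assms(1) C1_onD(1)[OF assms(2) that]] .
  show "continuous_on S (\<lambda>x. F (frechet_derivative f (at x) v))" for v
    using bounded_linear.continuous_on[OF assms(1) C1_onD(2)[OF assms(2)]] .
qed

lemma C1_on_add:
  assumes "C1_on S f" "C1_on S h"
  shows "C1_on S (\<lambda>x. f x + h x)"
  by (rule C1_onI[where
        f' = "\<lambda>x v. frechet_derivative f (at x) v + frechet_derivative h (at x) v"])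
     (auto intro!: derivative_intros continuous_intros C1_onD[OF assms(1)] C1_onD[OF assms(2)]
       simp del: Ck_on.simps)

lemma C1_on_mult:
  fixes f h :: "'a::euclidean_space \<Rightarrow> real"
  assumes "C1_on S f" "C1_on S h"
  shows "C1_on S (\<lambda>x. f x * h x)"
  by (rule C1_onI[where
        f' = "\<lambda>x v. f x * frechet_derivative h (at x) v + frechet_derivative f (at x) v * h x"])
     (auto intro!: has_derivative_mult continuous_intros C1_onD[OF assms(1)] C1_onD[OF assms(2)]
       simp del: Ck_on.simps)

lemma C1_on_sum:
  assumes "\<And>i. i \<in> I \<Longrightarrow> C1_on S (f i)"
  shows "C1_on S (\<lambda>x. \<Sum>i\<in>I. f i x)"
  using assms
proof (induction I rule: infinite_finite_induct)
  case (insert i I)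
  have "C1_on S (\<lambda>x. f i x + (\<Sum>i\<in>I. f i x))"
    using insert by (intro C1_on_add) (auto simp del: Ck_on.simps)
  with insert show ?case by (simp del: Ck_on.simps)
qed (simp_all add: C1_on_const del: Ck_on.simps)

lemma C1_on_prod:
  fixes f :: "'i \<Rightarrow> 'a::euclidean_space \<Rightarrow> real"
  assumes "\<And>i. i \<in> I \<Longrightarrow> C1_on S (f i)"
  shows "C1_on S (\<lambda>x. \<Prod>i\<in>I. f i x)"
  using assms
proof (induction I rule: infinite_finite_induct)
  case (insert i I)
  have "C1_on S (\<lambda>x. f i x * (\<Prod>i\<in>I. f i x))"
    using insert by (intro C1_on_mult) (auto simp del: Ck_on.simps)
  with insert show ?case by (simp del: Ck_on.simps)
qed (simp_all add: C1_on_const del: Ck_on.simps)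

text \<open>The derivative of a composite is expanded in the standard basis, because continuity of
  the derivative is only given direction by direction.\<close>

lemma C1_on_compose:
  fixes f :: "'a::euclidean_space \<Rightarrow> 'b::euclidean_space" and h :: "'b \<Rightarrow> real"
  assumes f: "C1_on S f" and h: "C1_on T h" and sub: "f ` S \<subseteq> T"
  shows "C1_on S (\<lambda>x. h (f x))"
proof (rule C1_onI[where
      f' = "\<lambda>x v. frechet_derivative h (at (f x)) (frechet_derivative f (at x) v)"])
  show "((\<lambda>x. h (f x)) has_derivative
      (\<lambda>v. frechet_derivative h (at (f x)) (frechet_derivative f (at x) v))) (at x)"
    if "x \<in> S" for x
  proof -
    have "f x \<in> T" using sub that by auto
    from has_derivative_compose[OF C1_onD(1)[OF f that] C1_onD(1)[OF h this]] show ?thesis .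
  qed
  show "continuous_on S
      (\<lambda>x. frechet_derivative h (at (f x)) (frechet_derivative f (at x) v))" for v
  proof -
    have c: "continuous_on S (\<lambda>x. \<Sum>b\<in>Basis.
        (frechet_derivative f (at x) v \<bullet> b) * frechet_derivative h (at (f x)) b)"
      by (intro continuous_intros C1_onD[OF f]
          continuous_on_compose2[OF C1_onD(2)[OF h] C1_onD(3)[OF f] sub])
    have e: "(\<Sum>b\<in>Basis. (frechet_derivative f (at x) v \<bullet> b) * frechet_derivative h (at (f x)) b)
        = frechet_derivative h (at (f x)) (frechet_derivative f (at x) v)" if "x \<in> S" for x
    proof -
      have "f x \<in> T" using sub that by auto
      then have l: "linear (frechet_derivative h (at (f x)))"
        using C1_onD(1)[OF h] has_derivative_linear by blast
      have "frechet_derivative h (at (f x)) (frechet_derivative f (at x) v)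
         = frechet_derivative h (at (f x))
             (\<Sum>b\<in>Basis. (frechet_derivative f (at x) v \<bullet> b) *\<^sub>R b)"
        by (simp add: euclidean_representation)
      also have "\<dots> = (\<Sum>b\<in>Basis. (frechet_derivative f (at x) v \<bullet> b)
                          * frechet_derivative h (at (f x)) b)"
        by (simp add: linear_sum[OF l] linear_cmul[OF l])
      finally show ?thesis by simp
    qed
    show ?thesis by (rule continuous_on_eq[OF c e])
  qed
qed

lemma C1_on_real_compose:
  fixes f :: "'a::euclidean_space \<Rightarrow> real" and q :: "real \<Rightarrow> real"
  assumes f: "C1_on S f"
    and q: "\<And>y. y \<in> T \<Longrightarrow> (q has_real_derivative q' y) (at y)" "continuous_on T q'"
    and sub: "f ` S \<subseteq> T"
  shows "C1_on S (\<lambda>x. q (f x))"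
proof (rule C1_on_compose[OF f _ sub])
  show "C1_on T q"
    by (rule C1_onI[where f' = "\<lambda>y v. q' y * v"])
       (use q in \<open>auto simp: has_field_derivative_def intro!: continuous_intros\<close>)
qed

lemma C1_on_inverse:
  fixes f :: "'a::euclidean_space \<Rightarrow> real"
  assumes "C1_on S f" "\<And>x. x \<in> S \<Longrightarrow> f x \<noteq> 0"
  shows "C1_on S (\<lambda>x. inverse (f x))"
proof (rule C1_on_real_compose[OF assms(1), where T = "- {0}"
      and q' = "\<lambda>y. - (inverse y ^ Suc (Suc 0))"])
  show "(inverse has_real_derivative - (inverse y ^ Suc (Suc 0))) (at y)"
    if "y \<in> - {0}" for y :: real
    using DERIV_inverse[of y UNIV] that by simp
qed (use assms(2) in \<open>auto intro!: continuous_intros\<close>)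

lemma C1_on_divide:
  fixes f h :: "'a::euclidean_space \<Rightarrow> real"
  assumes "C1_on S f" "C1_on S h" "\<And>x. x \<in> S \<Longrightarrow> h x \<noteq> 0"
  shows "C1_on S (\<lambda>x. f x / h x)"
  using C1_on_mult[OF assms(1) C1_on_inverse[OF assms(2,3)]] by (simp add: divide_inverse)

lemma C1_on_sqrt:
  fixes f :: "'a::euclidean_space \<Rightarrow> real"
  assumes "C1_on S f" "\<And>x. x \<in> S \<Longrightarrow> f x > 0"
  shows "C1_on S (\<lambda>x. sqrt (f x))"
  by (rule C1_on_real_compose[OF assms(1), where T = "{0<..}"
      and q' = "\<lambda>y. inverse (sqrt y) / 2"])
     (use assms(2) in \<open>auto intro!: continuous_intros DERIV_real_sqrt\<close>)

lemma C1_on_det: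
  fixes G :: "'a::euclidean_space \<Rightarrow> real ^ 'n::finite ^ 'n"
  assumes "\<And>i j. C1_on S (\<lambda>x. G x $ i $ j)"
  shows "C1_on S (\<lambda>x. det (G x))"
  unfolding det_def by (intro C1_on_sum C1_on_mult C1_on_prod C1_on_const assms)

text \<open>Cramer's rule shows that the entries of the inverse are rational functions of the entries, so
  they inherit differentiability.\<close>

lemma matrix_inv_entry:
  fixes B :: "real ^ 'n::finite ^ 'n"
  assumes "det B \<noteq> 0"
  shows "matrix_inv B $ k $ l
       = det (\<chi> i j. if j = k then (if i = l then 1 else 0) else B $ i $ j) / det B"
proof -
  have "invertible B" using assms by (simp add: invertible_det_nz)
  then have "B ** matrix_inv B = mat 1"
    unfolding invertible_def matrix_inv_def by (rule someI2_ex) blast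
  then have "B *v (matrix_inv B *v axis l 1) = axis l 1"
    by (simp add: matrix_vector_mul_assoc)
  then have "matrix_inv B *v axis l 1
      = (\<chi> k. det (\<chi> i j. if j = k then axis l 1 $ i else B $ i $ j) / det B)"
    using cramer[OF assms] by blast
  then have "(matrix_inv B *v axis l 1) $ k
      = det (\<chi> i j. if j = k then axis l 1 $ i else B $ i $ j) / det B" by simp
  moreover have "(matrix_inv B *v axis l 1) $ k = matrix_inv B $ k $ l"
    by (simp add: matrix_vector_mult_basis column_def)
  ultimately show ?thesis by (simp add: axis_def eq_commute[of l] cong: if_cong)
qed

lemma C1_on_matrix_inv:
  fixes G :: "'a::euclidean_space \<Rightarrow> real ^ 'n::finite ^ 'n"
  assumes "\<And>i j. C1_on S (\<lambda>x. G x $ i $ j)" "\<And>x. x \<in> S \<Longrightarrow> det (G x) \<noteq> 0" "open S"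
  shows "C1_on S (\<lambda>x. matrix_inv (G x) $ k $ l)"
proof (rule Ck_on_cong[OF assms(3)])
  let ?B = "\<lambda>x. (\<chi> i j. if j = k then (if i = l then 1 else 0) else G x $ i $ j) :: real ^ 'n ^ 'n"
  show "C1_on S (\<lambda>x. det (?B x) / det (G x))"
  proof (intro C1_on_divide C1_on_det assms(1,2))
    show "C1_on S (\<lambda>x. ?B x $ i $ j)" for i j
      using assms(1)[of i j] C1_on_const[where S = S]
      by (cases "j = k") (auto simp del: Ck_on.simps)
  qed
  show "det (?B x) / det (G x) = matrix_inv (G x) $ k $ l" if "x \<in> S" for x
    using matrix_inv_entry[OF assms(2)[OF that], of k l] by simp
qed

lemma Ck_on_const: "Ck_on k S (\<lambda>x. c)"
proof (induction k arbitrary: c)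
  case (Suc k)
  show ?case using Suc.IH[of 0] by simp
qed simp

lemma Ck_on_lincomb:
  fixes f h :: "'a::euclidean_space \<Rightarrow> real"
  assumes "open S" "Ck_on k S f" "Ck_on k S h"
  shows "Ck_on k S (\<lambda>x. a * f x + b * h x)"
  using assms
proof (induction k arbitrary: f h)
  case 0
  then show ?case by (auto intro!: continuous_intros)
next
  case (Suc k)
  have d: "((\<lambda>x. a * f x + b * h x) has_derivative (\<lambda>v. a * frechet_derivative f (at x) v
      + b * frechet_derivative h (at x) v)) (at x)" if "x \<in> S" for x
    using Suc.prems that frechet_derivative_works[of f "at x"] frechet_derivative_works[of h "at x"]
    by (auto intro!: derivative_intros)
  have "Ck_on k S (\<lambda>x. frechet_derivative (\<lambda>x. a * f x + b * h x) (at x) v)" for v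
  proof (rule Ck_on_cong[OF Suc.prems(1)])
    show "Ck_on k S (\<lambda>x. a * frechet_derivative f (at x) v + b * frechet_derivative h (at x) v)"
      using Suc.IH[OF Suc.prems(1)] Suc.prems by simp
  qed (use frechet_derivative_at[OF d] in \<open>auto dest: fun_cong\<close>)
  then show ?case using d by (auto simp: differentiable_def)
qed

lemma smooth_on_C1: "smooth_on S f \<Longrightarrow> C1_on S f"
  unfolding smooth_on_def by blast

lemma smooth_on_C1_derivative:
  assumes "smooth_on S f"
  shows "C1_on S (\<lambda>x. frechet_derivative f (at x) v)"
proof -
  have "Ck_on (Suc (Suc 0)) S f" using assms unfolding smooth_on_def by blast
  then show ?thesis by simp
qed

text \<open>Along the segment from the identity to \<open>B\<close> all matrices are positive definite, hence
  nonsingular, so the determinant cannot change its sign.\<close>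

lemma det_positive_definite:
  fixes B :: "real ^ 'n::finite ^ 'n"
  assumes "\<And>v. v \<noteq> 0 \<Longrightarrow> v \<bullet> (B *v v) > 0"
  shows "det B > 0"
proof (rule ccontr)
  assume neg: "\<not> det B > 0"
  define H where "H t = (1 - t) *\<^sub>R mat 1 + t *\<^sub>R B" for t :: real
  have H: "H t *v v = (1 - t) *\<^sub>R v + t *\<^sub>R (B *v v)" for t v
    by (simp add: H_def matrix_vector_mult_add_rdistrib scaleR_matrix_vector_assoc[symmetric])
  have nz: "det (H t) \<noteq> 0" if "0 \<le> t" "t \<le> 1" for t
  proof -
    have "v = 0" if v: "H t *v v = 0" for v
    proof (rule ccontr)
      assume "v \<noteq> 0"
      then have p: "v \<bullet> (B *v v) > 0" "v \<bullet> v > 0" using assms by auto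
      have "0 = (1 - t) * (v \<bullet> v) + t * (v \<bullet> (B *v v))"
        using v H[of t v] by (metis inner_add_right inner_scaleR_right inner_zero_right)
      moreover have "(1 - t) * (v \<bullet> v) + t * (v \<bullet> (B *v v)) > 0"
        using p \<open>0 \<le> t\<close> \<open>t \<le> 1\<close>
        by (cases "t = 0") (auto intro!: add_nonneg_pos)
      ultimately show False by simp
    qed
    then have "\<exists>B. B ** H t = mat 1" by (subst matrix_left_invertible_ker) blast
    then show ?thesis by (simp add: invertible_det_nz[symmetric] invertible_left_inverse)
  qed
  have c: "continuous_on {0..1} (\<lambda>t. det (H t))"
    unfolding det_def H_def by (auto intro!: continuous_intros)
  have "\<exists>t\<ge>0. t \<le> 1 \<and> det (H t) = 0"
    by (rule IVT2') (use neg c in \<open>auto simp: H_def\<close>)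
  with nz show False by blast
qed

text \<open>Translating \<open>w\<close> does not change its integral, so the difference quotients of \<open>w\<close> in a fixed
  direction integrate to zero; they converge boundedly to the directional derivative.\<close>

lemma integral_derivative_compact_support:
  fixes w :: "'a::euclidean_space \<Rightarrow> real"
  assumes w: "C1_on UNIV w" and K: "compact K" "\<And>x. x \<notin> K \<Longrightarrow> w x = 0"
  shows "(LINT x|lborel. frechet_derivative w (at x) v) = 0"
    and "integrable lborel (\<lambda>x. frechet_derivative w (at x) v)"
proof -
  let ?D = "\<lambda>x. frechet_derivative w (at x) v"
  have cw: "continuous_on UNIV w" and cD: "continuous_on UNIV ?D"
    using C1_onD[OF w] by auto
  \<comment> \<open>Outside \<open>K'\<close> the segment from \<open>x\<close> to \<open>x + v\<close> misses \<open>K\<close>, so all difference quotients vanish.\<close>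
  define K' where "K' = (\<lambda>(x, t). x - t *\<^sub>R v) ` (K \<times> {0..1})"
  have K': "compact K'"
    unfolding K'_def case_prod_unfold
    by (intro compact_continuous_image compact_Times K compact_Icc continuous_intros)
  have out: "?D x = 0" if "x \<notin> K" for x
  proof -
    have "frechet_derivative w (at x) = frechet_derivative (\<lambda>_. 0) (at x)"
      by (rule frechet_derivative_transform_within_open[of _ _ "- K"])
         (use w that K in \<open>auto simp: compact_imp_closed open_Compl\<close>)
    then show ?thesis by simp
  qed
  have "bounded (?D ` K)"
    using K(1) cD by (meson compact_continuous_image compact_imp_bounded continuous_on_subset subset_UNIV)
  then obtain B0 where B0: "\<And>x. x \<in> K \<Longrightarrow> \<bar>?D x\<bar> \<le> B0"
    unfolding bounded_iff by auto
  define B where "B = max B0 0"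
  have B: "\<bar>?D x\<bar> \<le> B" for x
  proof (cases "x \<in> K")
    case True
    then show ?thesis using B0[OF True] unfolding B_def by linarith
  qed (simp add: out B_def)
  define q where "q n x = (w (x + (1 / real (Suc n)) *\<^sub>R v) - w x) / (1 / real (Suc n))" for n x
  have mw: "w \<in> borel_measurable borel" using cw by (rule borel_measurable_continuous_onI)
  have deriv: "((\<lambda>t. w (x + t *\<^sub>R v)) has_real_derivative ?D (x + t *\<^sub>R v)) (at t)" for x t
  proof -
    have l: "linear (frechet_derivative w (at (x + t *\<^sub>R v)))"
      using C1_onD(1)[OF w] has_derivative_linear by blast
    have "((\<lambda>t. w (x + t *\<^sub>R v)) has_derivative
        (\<lambda>h. frechet_derivative w (at (x + t *\<^sub>R v)) (h *\<^sub>R v))) (at t)"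
      by (rule has_derivative_compose[OF _ C1_onD(1)[OF w]]) (auto intro!: derivative_eq_intros)
    then show ?thesis
      unfolding has_field_derivative_def by (simp add: linear_cmul[OF l] mult_commute_abs)
  qed
  have mvt: "\<exists>\<tau>. 0 < \<tau> \<and> \<tau> < 1 \<and> q n x = ?D (x + \<tau> *\<^sub>R v)" for n x
  proof -
    have "0 < 1 / real (Suc n)" by simp
    then obtain \<tau> where \<tau>: "0 < \<tau>" "\<tau> < 1 / real (Suc n)"
      "w (x + (1 / real (Suc n)) *\<^sub>R v) - w (x + 0 *\<^sub>R v)
         = (1 / real (Suc n) - 0) * ?D (x + \<tau> *\<^sub>R v)"
      using MVT2[of 0 "1 / real (Suc n)" "\<lambda>t. w (x + t *\<^sub>R v)" "\<lambda>t. ?D (x + t *\<^sub>R v)"] deriv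
      by blast
    have "q n x = ?D (x + \<tau> *\<^sub>R v)" using \<tau>(3) unfolding q_def by simp
    moreover have "\<tau> < 1" by (rule less_le_trans[OF \<tau>(2)]) simp
    ultimately show ?thesis using \<tau>(1) by blast
  qed
  have bound: "norm (q n x) \<le> B * indicator K' x" for n x
  proof -
    obtain \<tau> where \<tau>: "0 < \<tau>" "\<tau> < 1" "q n x = ?D (x + \<tau> *\<^sub>R v)" using mvt by blast
    show ?thesis
    proof (cases "x + \<tau> *\<^sub>R v \<in> K")
      case True
      then have "x \<in> K'"
        unfolding K'_def using \<tau> by (intro image_eqI[of _ _ "(x + \<tau> *\<^sub>R v, \<tau>)"]) auto
      then show ?thesis using B \<tau> by simp
    next
      case False
      then show ?thesis using out \<tau> by (simp add: indicator_def B_def)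
    qed
  qed
  have lim: "(\<lambda>n. q n x) \<longlonglongrightarrow> ?D x" for x
  proof -
    have "((\<lambda>t. (w (x + (0 + t) *\<^sub>R v) - w (x + 0 *\<^sub>R v)) / t) \<longlongrightarrow> ?D (x + 0 *\<^sub>R v)) (at 0)"
      using deriv[of x 0] unfolding DERIV_def by simp
    moreover have "filterlim (\<lambda>n. 1 / real (Suc n)) (at 0) sequentially"
      unfolding filterlim_at using LIMSEQ_Suc[OF lim_1_over_n[where 'a = real]] by simp
    ultimately show ?thesis
      unfolding q_def by (auto dest: filterlim_compose)
  qed
  have dom: "integrable lborel (\<lambda>x. B * indicator K' x)"
    using K' emeasure_bounded_finite[OF compact_imp_bounded[OF K']]
    by (intro integrable_mult_right integrable_real_indicator) (auto simp: borel_compact)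
  have mq: "q n \<in> borel_measurable lborel" for n
    unfolding q_def using mw by measurable
  have mD: "?D \<in> borel_measurable lborel"
    using cD by (simp add: borel_measurable_continuous_onI)
  have L: "(\<lambda>n. LINT x|lborel. q n x) \<longlonglongrightarrow> (LINT x|lborel. ?D x)"
    by (rule integral_dominated_convergence[where s = q and w = "\<lambda>x. B * indicator K' x", OF mD mq dom]) (use bound lim in auto)
  show "integrable lborel ?D"
    by (rule integrable_dominated_convergence[where s = q and w = "\<lambda>x. B * indicator K' x", OF mD mq dom]) (use bound lim in auto)
  have "bounded (w ` K)"
    using K(1) cw by (meson compact_continuous_image compact_imp_bounded continuous_on_subset subset_UNIV)
  then obtain C where C: "\<And>x. x \<in> K \<Longrightarrow> \<bar>w x\<bar> \<le> C"
    unfolding bounded_iff by auto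
  have iw: "integrable lborel w"
  proof (rule Bochner_Integration.integrable_bound)
    show "integrable lborel (\<lambda>x. C * indicator K x)"
      using K emeasure_bounded_finite[OF compact_imp_bounded[OF K(1)]]
      by (intro integrable_mult_right integrable_real_indicator) (auto simp: borel_compact)
    show "AE x in lborel. norm (w x) \<le> norm (C * indicator K x)"
      using order_trans[OF C abs_ge_self] K by (intro AE_I2) (auto simp: indicator_def)
  qed (use mw in simp)
  have shift: "(LINT x|lborel. w (x + a)) = (LINT x|lborel. w x)"
    "integrable lborel (\<lambda>x. w (x + a))" for a
  proof -
    have d: "distr lborel borel ((+) a) = (lborel :: 'a measure)"
      using lborel_distr_plus[of a] by simp
    have "(LINT x|lborel. w x) = (LINT x|distr lborel borel ((+) a). w x)" by (simp add: d)
    also have "\<dots> = (LINT x|lborel. w (a + x))"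
      using mw by (subst integral_distr) auto
    finally show "(LINT x|lborel. w (x + a)) = (LINT x|lborel. w x)"
      by (simp add: add.commute)
    have "integrable (distr lborel borel ((+) a)) w" using iw by (simp add: d)
    then have "integrable lborel (\<lambda>x. w (a + x))"
      using mw by (subst (asm) integrable_distr_eq) auto
    then show "integrable lborel (\<lambda>x. w (x + a))" by (simp add: add.commute)
  qed
  have "(LINT x|lborel. q n x) = 0" for n
    unfolding q_def by (simp only: integral_divide_zero
        Bochner_Integration.integral_diff[OF shift(2) iw] shift(1)) simp
  then have "(\<lambda>n. LINT x|lborel. q n x) \<longlonglongrightarrow> 0" by simp
  with L show "(LINT x|lborel. ?D x) = 0" by (rule LIMSEQ_unique)
qed

section \<open>Functions on a closed Riemannian manifold\<close>

definition gradient :: "(real ^ 'n::finite \<Rightarrow> real) \<Rightarrow> real ^ 'n \<Rightarrow> real ^ 'n" where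
  "gradient u x = (\<chi> i. partial_deriv i u x)"

lemma derivative_eq_gradient:
  assumes "u differentiable (at x)"
  shows "frechet_derivative u (at x) v = gradient u x \<bullet> v"
proof -
  have l: "linear (frechet_derivative u (at x))"
    using assms by (rule linear_frechet_derivative)
  have "frechet_derivative u (at x) v = frechet_derivative u (at x) (\<Sum>i\<in>UNIV. v $ i *\<^sub>R axis i 1)"
    by (simp add: basis_expansion scalar_mult_eq_scaleR[symmetric])
  also have "\<dots> = (\<Sum>i\<in>UNIV. v $ i * frechet_derivative u (at x) (axis i 1))"
    by (simp add: linear_sum[OF l] linear_cmul[OF l])
  finally show ?thesis
    by (simp add: gradient_def partial_deriv_def inner_vec_def mult.commute)
qed

text \<open>The pairing \<open>G\<^sup>i\<^sup>j \<partial>\<^sub>iu \<partial>\<^sub>jv\<close> of the differentials of \<open>u\<close> and \<open>v\<close>.\<close>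

definition gradient_pairing ::
  "(real ^ 'n \<Rightarrow> real ^ 'n ^ 'n) \<Rightarrow> (real ^ 'n::finite \<Rightarrow> real) \<Rightarrow> (real ^ 'n \<Rightarrow> real)
     \<Rightarrow> real ^ 'n \<Rightarrow> real" where
  "gradient_pairing G u v x = gradient u x \<bullet> (matrix_inv (G x) *v gradient v x)"

text \<open>The components of \<open>\<surd>|G| grad u\<close>; the divergence in coordinates of this field is \<open>\<surd>|G| \<Delta>u\<close>.\<close>

definition flux ::
  "(real ^ 'n \<Rightarrow> real ^ 'n ^ 'n) \<Rightarrow> (real ^ 'n::finite \<Rightarrow> real) \<Rightarrow> 'n \<Rightarrow> real ^ 'n \<Rightarrow> real" where
  "flux G u i y = sqrt (det (G y)) * (\<Sum>j\<in>UNIV. matrix_inv (G y) $ i $ j * partial_deriv j u y)"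

lemma local_laplacian_flux:
  "local_laplacian G u x = (\<Sum>i\<in>UNIV. partial_deriv i (flux G u i) x) / sqrt (det (G x))"
  by (simp add: local_laplacian_def flux_def[abs_def])

lemma gradient_pairing_flux:
  "sqrt (det (G x)) * gradient_pairing G u v x
     = (\<Sum>i\<in>UNIV. partial_deriv i u x * flux G v i x)"
  by (simp add: gradient_pairing_def flux_def gradient_def inner_vec_def matrix_vector_mult_def
      sum_distrib_left mult_ac)

lemma matrix_inv_mult:
  fixes B :: "real ^ 'n::finite ^ 'n"
  assumes "det B \<noteq> 0"
  shows "B ** matrix_inv B = mat 1" "matrix_inv B ** B = mat 1"
proof -
  have "invertible B" using assms by (simp add: invertible_det_nz)
  then have "B ** matrix_inv B = mat 1 \<and> matrix_inv B ** B = mat 1"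
    unfolding invertible_def matrix_inv_def by (rule someI_ex)
  then show "B ** matrix_inv B = mat 1" "matrix_inv B ** B = mat 1" by auto
qed

lemma inner_transpose: "(transpose J *v a) \<bullet> w = a \<bullet> (J *v w)"
  for J :: "real ^ 'n::finite ^ 'm::finite"
  by (simp add: dot_lmul_matrix)

text \<open>Covectors transform with the transposed Jacobian, so the pairing of covectors induced by the
  inverse of the metric is the same in both coordinate systems.\<close>

lemma covector_pairing_invariant:
  fixes J G :: "real ^ 'n::finite ^ 'n"
  assumes d: "det (transpose J ** G ** J) \<noteq> 0"
  shows "(transpose J *v a) \<bullet> (matrix_inv (transpose J ** G ** J) *v (transpose J *v b))
       = a \<bullet> (matrix_inv G *v b)"
proof -
  let ?H = "transpose J ** G ** J"
  have nz: "det J \<noteq> 0" "det G \<noteq> 0" using d by (auto simp: det_mul)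
  have nt: "det (transpose J) \<noteq> 0" using nz by simp
  define w where "w = matrix_inv ?H *v (transpose J *v b)"
  have "?H *v w = transpose J *v b"
    by (simp add: w_def matrix_vector_mul_assoc matrix_inv_mult[OF d] matrix_mul_assoc)
  then have "transpose J *v (G *v (J *v w)) = transpose J *v b"
    by (simp add: matrix_vector_mul_assoc matrix_mul_assoc)
  then have "matrix_inv (transpose J) *v (transpose J *v (G *v (J *v w)))
      = matrix_inv (transpose J) *v (transpose J *v b)" by simp
  then have "G *v (J *v w) = b"
    unfolding matrix_vector_mul_assoc[of "matrix_inv (transpose J)"] matrix_inv_mult[OF nt]
    by simp
  then have "matrix_inv G *v (G *v (J *v w)) = matrix_inv G *v b" by simp
  then have "J *v w = matrix_inv G *v b"
    unfolding matrix_vector_mul_assoc[of "matrix_inv G"] matrix_inv_mult[OF nz(2)] by simp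
  then show ?thesis by (simp only: inner_transpose w_def[symmetric])
qed

lemma C1_on_square_pos_part: "C1_on UNIV (\<lambda>s::real. (max 0 s)\<^sup>2)"
proof (rule C1_onI[where f' = "\<lambda>s v. (2 * max 0 s) * v"])
  fix s :: real
  have "((\<lambda>s. (max 0 s)\<^sup>2) has_real_derivative 2 * max 0 s) (at s)"
  proof -
    consider "s > 0" | "s < 0" | "s = 0" by linarith
    then show ?thesis
    proof cases
      case 1
      have "((\<lambda>s. s\<^sup>2) has_real_derivative 2 * s) (at s)" by (auto intro!: derivative_eq_intros)
      then have "((\<lambda>s. (max 0 s)\<^sup>2) has_real_derivative 2 * s) (at s)"
        by (rule has_field_derivative_transform_within_open[of _ _ _ "{0<..}"]) (use 1 in auto)
      then show ?thesis using 1 by simp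
    next
      case 2
      have "((\<lambda>s::real. 0::real) has_real_derivative 0) (at s)" by simp
      then have "((\<lambda>s. (max 0 s)\<^sup>2) has_real_derivative 0) (at s)"
        by (rule has_field_derivative_transform_within_open[of _ _ _ "{..<0}"]) (use 2 in auto)
      then show ?thesis using 2 by simp
    next
      case 3
      have "((\<lambda>h. ((max 0 (0 + h))\<^sup>2 - (max 0 0)\<^sup>2) / h) \<longlongrightarrow> 0) (at (0::real))"
      proof (rule Lim_null_comparison)
        have "\<bar>(max 0 h)\<^sup>2 / h\<bar> \<le> \<bar>h\<bar>" for h :: real
          by (cases "h > 0") (auto simp: power2_eq_square max_def)
        then show "\<forall>\<^sub>F h in at (0::real). norm (((max 0 (0 + h))\<^sup>2 - (max 0 0)\<^sup>2) / h) \<le> \<bar>h\<bar>"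
          by simp
        show "((\<lambda>h::real. \<bar>h\<bar>) \<longlongrightarrow> 0) (at 0)" by (rule tendsto_rabs_zero) simp
      qed
      then show ?thesis using 3 by (simp add: DERIV_def)
    qed
  qed
  then show "((\<lambda>s. (max 0 s)\<^sup>2) has_derivative (\<lambda>v. (2 * max 0 s) * v)) (at s)"
    by (simp add: has_field_derivative_def)
qed (auto intro!: continuous_intros)

lemma C1_on_bump:
  fixes x0 :: "'a::euclidean_space"
  shows "C1_on UNIV (\<lambda>x. (max 0 (r\<^sup>2 - (x - x0) \<bullet> (x - x0)))\<^sup>2)"
proof (rule C1_on_compose[OF _ C1_on_square_pos_part])
  show "C1_on UNIV (\<lambda>x. r\<^sup>2 - (x - x0) \<bullet> (x - x0))"
    by (rule C1_onI[where f' = "\<lambda>x v. - (2 * ((x - x0) \<bullet> v))"])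
       (auto intro!: derivative_eq_intros continuous_intros simp: inner_commute)
qed simp

definition C1_fun :: "('m, 'n::finite) chart set \<Rightarrow> ('m \<Rightarrow> real) \<Rightarrow> bool" where
  "C1_fun A u \<longleftrightarrow> (\<forall>c\<in>A. C1_on (chart_image c) (\<lambda>x. u (chart_inv c x)))"

lemma C1_fun_mult: "C1_fun A u \<Longrightarrow> C1_fun A v \<Longrightarrow> C1_fun A (\<lambda>p. u p * v p)"
  unfolding C1_fun_def using C1_on_mult by blast

lemma C1_fun_sum: "(\<And>i. i \<in> I \<Longrightarrow> C1_fun A (u i)) \<Longrightarrow> C1_fun A (\<lambda>p. \<Sum>i\<in>I. u i p)"
  unfolding C1_fun_def by (auto intro!: C1_on_sum simp del: Ck_on.simps)

lemma C1_fun_divide: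
  "C1_fun A u \<Longrightarrow> C1_fun A v \<Longrightarrow> (\<And>p. v p \<noteq> 0) \<Longrightarrow> C1_fun A (\<lambda>p. u p / v p)"
  unfolding C1_fun_def by (auto intro!: C1_on_divide simp del: Ck_on.simps)

lemma smooth_fun_C1: "smooth_fun A u \<Longrightarrow> C1_fun A u"
  unfolding smooth_fun_def C1_fun_def using smooth_on_C1 by (fastforce simp: o_def simp del: Ck_on.simps)

text \<open>The pairing \<open>\<langle>du, dv\<rangle>\<close> of differentials. For continuously differentiable \<open>u\<close> and \<open>v\<close> the choice of
  the chart is immaterial, see \<open>differential_pairing_chart\<close> below.\<close>

definition differential_pairing ::
  "('m, 'n::finite) chart set \<Rightarrow> ('m, 'n) metric \<Rightarrow> ('m \<Rightarrow> real) \<Rightarrow> ('m \<Rightarrow> real) \<Rightarrow> 'm \<Rightarrow> real" where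
  "differential_pairing A g u v p =
     (let c = SOME c. c \<in> A \<and> p \<in> chart_dom c
      in gradient_pairing (g c) (\<lambda>x. u (chart_inv c x)) (\<lambda>x. v (chart_inv c x)) (chart_map c p))"

locale closed_manifold =
  fixes A :: "('m::{t2_space,second_countable_topology}, 'n::finite) chart set"
    and g :: "('m, 'n) metric"
  assumes manifold: "closed_riemannian_manifold A g"
begin

lemma chart_homeomorphism:
  "c \<in> A \<Longrightarrow> homeomorphism (chart_dom c) (chart_image c) (chart_map c) (chart_inv c)"
  and open_dom: "c \<in> A \<Longrightarrow> open (chart_dom c)"
  and open_chart_image: "c \<in> A \<Longrightarrow> open (chart_image c)"
  using manifold by (auto simp: closed_riemannian_manifold_def smooth_atlas_def is_chart_def)

lemma chart_inv_map [simp]: "c \<in> A \<Longrightarrow> p \<in> chart_dom c \<Longrightarrow> chart_inv c (chart_map c p) = p"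
  and chart_map_inv [simp]: "c \<in> A \<Longrightarrow> x \<in> chart_image c \<Longrightarrow> chart_map c (chart_inv c x) = x"
  and chart_inv_in: "c \<in> A \<Longrightarrow> x \<in> chart_image c \<Longrightarrow> chart_inv c x \<in> chart_dom c"
  and chart_map_in: "c \<in> A \<Longrightarrow> p \<in> chart_dom c \<Longrightarrow> chart_map c p \<in> chart_image c"
  and continuous_chart_map: "c \<in> A \<Longrightarrow> continuous_on (chart_dom c) (chart_map c)"
  and continuous_chart_inv: "c \<in> A \<Longrightarrow> continuous_on (chart_image c) (chart_inv c)"
  using chart_homeomorphism[of c] by (auto simp: homeomorphism_def)

lemma covered: "\<exists>c\<in>A. p \<in> chart_dom c"
  using manifold by (auto simp: closed_riemannian_manifold_def smooth_atlas_def)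

lemma open_map_image:
  assumes "c \<in> A" "open W" "W \<subseteq> chart_dom c"
  shows "open (chart_map c ` W)"
proof -
  have "openin (top_of_set (chart_dom c)) W" using assms by (simp add: open_subset)
  from homeomorphism_imp_open_map[OF chart_homeomorphism[OF assms(1)] this]
  show ?thesis using open_chart_image[OF assms(1)] openin_open_trans by blast
qed

lemma open_map_vimage:
  assumes "c \<in> A" "open W"
  shows "open (chart_dom c \<inter> chart_map c -` W)"
  using continuous_on_open_vimage[OF open_dom[OF assms(1)], of "chart_map c"] continuous_chart_map[OF assms(1)] assms(2)
  by (metis Int_commute)

lemma transition_C1:
  assumes "c \<in> A" "d \<in> A"
  shows "C1_on (chart_map c ` (chart_dom c \<inter> chart_dom d)) (\<lambda>x. chart_map d (chart_inv c x))"
  using manifold assms smooth_on_C1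
  by (fastforce simp: closed_riemannian_manifold_def smooth_atlas_def o_def simp del: Ck_on.simps)

lemma metric_smooth: "c \<in> A \<Longrightarrow> smooth_on (chart_image c) (g c)"
  and metric_symmetric: "c \<in> A \<Longrightarrow> x \<in> chart_image c \<Longrightarrow> transpose (g c x) = g c x"
  and metric_positive: "c \<in> A \<Longrightarrow> x \<in> chart_image c \<Longrightarrow> v \<noteq> 0 \<Longrightarrow> v \<bullet> (g c x *v v) > 0"
  using manifold by (auto simp: closed_riemannian_manifold_def riemannian_metric_def)

lemma metric_transform:
  assumes "c \<in> A" "d \<in> A" "p \<in> chart_dom c \<inter> chart_dom d"
  defines "J \<equiv> jacobian (\<lambda>x. chart_map d (chart_inv c x)) (at (chart_map c p))"
  shows "g c (chart_map c p) = transpose J ** g d (chart_map d p) ** J"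
proof -
  have "riemannian_metric A g" using manifold unfolding closed_riemannian_manifold_def by blast
  note conjunct2[OF this[unfolded riemannian_metric_def]]
  from bspec[OF bspec[OF bspec[OF this assms(1)] assms(2)] assms(3)]
  show ?thesis unfolding J_def Let_def o_def .
qed

lemma metric_entry_C1: "c \<in> A \<Longrightarrow> C1_on (chart_image c) (\<lambda>x. g c x $ i $ j)"
  by (rule C1_on_bounded_linear[OF bounded_linear_compose[OF bounded_linear_vec_nth
        bounded_linear_vec_nth] smooth_on_C1[OF metric_smooth]])

lemma metric_det_pos: "c \<in> A \<Longrightarrow> x \<in> chart_image c \<Longrightarrow> det (g c x) > 0"
  by (intro det_positive_definite metric_positive)

lemma metric_inv_C1: "c \<in> A \<Longrightarrow> C1_on (chart_image c) (\<lambda>x. matrix_inv (g c x) $ i $ j)"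
  by (intro C1_on_matrix_inv metric_entry_C1 open_chart_image)
     (use metric_det_pos in fastforce)+

lemma sqrt_det_C1: "c \<in> A \<Longrightarrow> C1_on (chart_image c) (\<lambda>x. sqrt (det (g c x)))"
  by (intro C1_on_sqrt C1_on_det metric_entry_C1 metric_det_pos)

lemma flux_C1:
  assumes "c \<in> A" "smooth_on (chart_image c) u"
  shows "C1_on (chart_image c) (flux (g c) u i)"
  unfolding flux_def[abs_def] partial_deriv_def
  by (intro C1_on_mult C1_on_sum sqrt_det_C1 metric_inv_C1 smooth_on_C1_derivative assms)

lemma C1_fun_on: "C1_fun A u \<Longrightarrow> c \<in> A \<Longrightarrow> C1_on (chart_image c) (\<lambda>x. u (chart_inv c x))"
  by (simp add: C1_fun_def del: Ck_on.simps)



lemma continuous_on_charts: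
  fixes F :: "'m \<Rightarrow> real"
  assumes "\<And>c. c \<in> A \<Longrightarrow> continuous_on (chart_image c) (\<lambda>x. F (chart_inv c x))"
  shows "continuous_on UNIV F"
proof -
  have "continuous_on (\<Union>(chart_dom ` A)) F"
  proof (rule continuous_on_open_Union)
    fix s assume "s \<in> chart_dom ` A"
    then obtain c where c: "c \<in> A" "s = chart_dom c" by auto
    show "open s" using open_dom c by simp
    have "continuous_on (chart_dom c) (\<lambda>p. F (chart_inv c (chart_map c p)))"
      by (rule continuous_on_compose2[OF assms[OF c(1)] continuous_chart_map[OF c(1)]])
         (use chart_map_in[OF c(1)] in auto)
    then show "continuous_on s F" unfolding c(2) by (rule continuous_on_eq) (use c in simp)
  qed
  moreover have "\<Union>(chart_dom ` A) = UNIV" using covered by auto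
  ultimately show ?thesis by simp
qed

lemma C1_fun_continuous: "C1_fun A u \<Longrightarrow> continuous_on UNIV u"
  by (rule continuous_on_charts) (rule C1_onD(3)[OF C1_fun_on])

lemma C1_fun_derivative:
  assumes "C1_fun A u" "c \<in> A" "x \<in> chart_image c"
  shows "(\<lambda>x. u (chart_inv c x)) differentiable (at x)"
  using C1_onD(1)[OF C1_fun_on[OF assms(1,2)] assms(3)] by (auto simp: differentiable_def)

text \<open>The chain rule for the change of coordinates.\<close>

lemma gradient_transform:
  assumes u: "C1_fun A u" and cd: "c \<in> A" "d \<in> A" and p: "p \<in> chart_dom c \<inter> chart_dom d"
  shows "gradient (\<lambda>x. u (chart_inv c x)) (chart_map c p)
       = transpose (jacobian (\<lambda>x. chart_map d (chart_inv c x)) (at (chart_map c p)))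
           *v gradient (\<lambda>x. u (chart_inv d x)) (chart_map d p)"
proof -
  let ?x = "chart_map c p" and ?W = "chart_map c ` (chart_dom c \<inter> chart_dom d)"
  let ?\<tau> = "\<lambda>x. chart_map d (chart_inv c x)"
  let ?uc = "\<lambda>x. u (chart_inv c x)" and ?ud = "\<lambda>x. u (chart_inv d x)"
  have W: "open ?W" "?x \<in> ?W" using p cd by (auto intro!: open_map_image open_Int open_dom)
  have \<tau>x: "?\<tau> ?x = chart_map d p" using p cd by simp
  have \<tau>d: "(?\<tau> has_derivative frechet_derivative ?\<tau> (at ?x)) (at ?x)"
    by (rule C1_onD(1)[OF transition_C1[OF cd] W(2)])
  have J: "frechet_derivative ?\<tau> (at ?x) v = jacobian ?\<tau> (at ?x) *v v" for v
    using has_derivative_linear[OF \<tau>d] by (simp add: jacobian_def matrix_works)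
  have dd: "?ud differentiable at (chart_map d p)"
    using C1_fun_derivative[OF u cd(2)] chart_map_in[OF cd(2)] p by blast
  have "((\<lambda>x. ?ud (?\<tau> x)) has_derivative
      (\<lambda>v. frechet_derivative ?ud (at (?\<tau> ?x)) (frechet_derivative ?\<tau> (at ?x) v))) (at ?x)"
    by (rule has_derivative_compose[OF \<tau>d]) (use dd frechet_derivative_works \<tau>x in auto)
  then have "(?uc has_derivative
      (\<lambda>v. frechet_derivative ?ud (at (?\<tau> ?x)) (frechet_derivative ?\<tau> (at ?x) v))) (at ?x)"
    by (rule has_derivative_transform_within_open[OF _ W]) (use cd in auto)
  then have fd: "frechet_derivative ?uc (at ?x) v
      = gradient ?ud (chart_map d p) \<bullet> (jacobian ?\<tau> (at ?x) *v v)" for v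
    using frechet_derivative_at[symmetric] J derivative_eq_gradient[OF dd] \<tau>x by fastforce
  show ?thesis
  proof (subst vec_eq_iff, intro allI)
    fix i
    have "gradient ?uc ?x $ i = gradient ?ud (chart_map d p) \<bullet> (jacobian ?\<tau> (at ?x) *v axis i 1)"
      by (simp add: gradient_def partial_deriv_def fd)
    also have "\<dots> = (transpose (jacobian ?\<tau> (at ?x)) *v gradient ?ud (chart_map d p)) \<bullet> axis i 1"
      by (simp only: inner_transpose)
    finally show "gradient ?uc ?x $ i
        = (transpose (jacobian ?\<tau> (at ?x)) *v gradient ?ud (chart_map d p)) $ i"
      by (simp add: inner_axis)
  qed
qed

lemma differential_pairing_chart:
  assumes u: "C1_fun A u" and v: "C1_fun A v" and c: "c \<in> A" "p \<in> chart_dom c"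
  shows "differential_pairing A g u v p
       = gradient_pairing (g c) (\<lambda>x. u (chart_inv c x)) (\<lambda>x. v (chart_inv c x)) (chart_map c p)"
proof -
  define d where "d = (SOME d. d \<in> A \<and> p \<in> chart_dom d)"
  have d: "d \<in> A" "p \<in> chart_dom d" using someI[of "\<lambda>d. d \<in> A \<and> p \<in> chart_dom d" c] c
    unfolding d_def by auto
  let ?J = "jacobian (\<lambda>x. chart_map c (chart_inv d x)) (at (chart_map d p))"
  have p: "p \<in> chart_dom d \<inter> chart_dom c" using c d by simp
  note G = metric_transform[OF d(1) c(1) p]
  have nz: "det (transpose ?J ** g c (chart_map c p) ** ?J) \<noteq> 0"
    using metric_det_pos[OF d(1) chart_map_in[OF d]] G by simp
  show ?thesis
    unfolding differential_pairing_def Let_def d_def[symmetric] gradient_pairing_def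
      gradient_transform[OF u d(1) c(1) p] gradient_transform[OF v d(1) c(1) p] G
    by (rule covector_pairing_invariant[OF nz])
qed

lemma differential_pairing_continuous:
  assumes u: "C1_fun A u" and v: "C1_fun A v"
  shows "continuous_on UNIV (differential_pairing A g u v)"
proof (rule continuous_on_charts)
  fix c assume c: "c \<in> A"
  let ?P = "gradient_pairing (g c) (\<lambda>x. u (chart_inv c x)) (\<lambda>x. v (chart_inv c x))"
  have "continuous_on (chart_image c) ?P"
    unfolding gradient_pairing_def inner_vec_def matrix_vector_mult_def gradient_def
      partial_deriv_def
    by (auto intro!: continuous_intros C1_onD(2)[OF C1_fun_on[OF u c]]
        C1_onD(2)[OF C1_fun_on[OF v c]] C1_onD(3)[OF metric_inv_C1[OF c]])
  then show "continuous_on (chart_image c) (\<lambda>x. differential_pairing A g u v (chart_inv c x))"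
    by (rule continuous_on_eq)
       (simp add: differential_pairing_chart[OF u v c chart_inv_in[OF c]] c)
qed

lemma metric_inv_symmetric:
  assumes "c \<in> A" "x \<in> chart_image c"
  shows "transpose (matrix_inv (g c x)) = matrix_inv (g c x)"
proof -
  have nz: "det (g c x) \<noteq> 0" using metric_det_pos[OF assms] by simp
  have "transpose (matrix_inv (g c x)) ** g c x = transpose (g c x ** matrix_inv (g c x))"
    by (simp add: matrix_transpose_mul metric_symmetric[OF assms])
  then have 1: "transpose (matrix_inv (g c x)) ** g c x = mat 1"
    by (simp add: matrix_inv_mult[OF nz] transpose_mat)
  have "transpose (matrix_inv (g c x)) = transpose (matrix_inv (g c x)) ** (g c x ** matrix_inv (g c x))"
    by (simp add: matrix_inv_mult[OF nz])
  also have "\<dots> = matrix_inv (g c x)" by (simp add: matrix_mul_assoc 1)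
  finally show ?thesis .
qed

lemma differential_pairing_commute:
  assumes u: "C1_fun A u" and v: "C1_fun A v"
  shows "differential_pairing A g u v p = differential_pairing A g v u p"
proof -
  obtain c where c: "c \<in> A" "p \<in> chart_dom c" using covered by blast
  show ?thesis
    unfolding differential_pairing_chart[OF u v c] differential_pairing_chart[OF v u c]
      gradient_pairing_def
    by (metis inner_transpose inner_commute metric_inv_symmetric[OF c(1) chart_map_in[OF c]])
qed

lemma differential_pairing_sum:
  assumes u: "\<And>i. i \<in> I \<Longrightarrow> C1_fun A (u i)" and v: "C1_fun A v"
  shows "differential_pairing A g (\<lambda>p. \<Sum>i\<in>I. u i p) v p
       = (\<Sum>i\<in>I. differential_pairing A g (u i) v p)"
proof -
  obtain c where c: "c \<in> A" "p \<in> chart_dom c" using covered by blast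
  note x = chart_map_in[OF c]
  have "((\<lambda>x. \<Sum>i\<in>I. u i (chart_inv c x)) has_derivative
      (\<lambda>w. \<Sum>i\<in>I. frechet_derivative (\<lambda>x. u i (chart_inv c x)) (at (chart_map c p)) w))
      (at (chart_map c p))"
    by (intro has_derivative_sum C1_onD(1)[OF C1_fun_on[OF u c(1)] x])
  then have "gradient (\<lambda>x. \<Sum>i\<in>I. u i (chart_inv c x)) (chart_map c p)
      = (\<Sum>i\<in>I. gradient (\<lambda>x. u i (chart_inv c x)) (chart_map c p))"
    unfolding gradient_def partial_deriv_def
    by (simp add: vec_eq_iff frechet_derivative_at[symmetric])
  then show ?thesis
    using differential_pairing_chart[OF u v c]
    by (simp add: differential_pairing_chart[OF C1_fun_sum[OF u] v c] gradient_pairing_def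
        inner_sum_left)
qed

lemma differential_pairing_local_zero:
  assumes u: "C1_fun A u" and v: "C1_fun A v" and U: "open U" "p \<in> U" "\<And>q. q \<in> U \<Longrightarrow> u q = 0"
  shows "differential_pairing A g u v p = 0"
proof -
  obtain c where c: "c \<in> A" "p \<in> chart_dom c" using covered by blast
  let ?W = "chart_map c ` (chart_dom c \<inter> U)"
  have "frechet_derivative (\<lambda>x. u (chart_inv c x)) (at (chart_map c p))
      = frechet_derivative (\<lambda>x. 0) (at (chart_map c p))"
  proof (rule frechet_derivative_transform_within_open)
    show "(\<lambda>x. u (chart_inv c x)) differentiable (at (chart_map c p))"
      by (rule C1_fun_derivative[OF u c(1) chart_map_in[OF c]])
    show "open ?W" by (rule open_map_image) (use U c in \<open>auto intro: open_dom\<close>)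
  qed (use U c in auto)
  then have "gradient (\<lambda>x. u (chart_inv c x)) (chart_map c p) = 0"
    by (simp add: gradient_def partial_deriv_def vec_eq_iff)
  then show ?thesis
    by (simp add: differential_pairing_chart[OF u v c] gradient_pairing_def)
qed

text \<open>The bump \<open>(r\<^sup>2 - |x - x\<^sub>0|\<^sup>2)\<^sub>+\<^sup>2\<close> is only continuously differentiable, which is all that
  integration by parts needs.\<close>

lemma exists_bump:
  obtains c K \<eta> where "c \<in> A" "compact K" "K \<subseteq> chart_dom c" "C1_fun A \<eta>" "\<And>q. \<eta> q \<ge> 0" "\<eta> p > 0"
    "\<And>q. q \<notin> K \<Longrightarrow> \<eta> q = 0"
proof -
  obtain c where c: "c \<in> A" "p \<in> chart_dom c" using covered by blast
  let ?x0 = "chart_map c p"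
  obtain r where r: "r > 0" "cball ?x0 r \<subseteq> chart_image c"
    using open_contains_cball open_chart_image[OF c(1)] chart_map_in[OF c] by blast
  define b where "b x = (max 0 (r\<^sup>2 - (x - ?x0) \<bullet> (x - ?x0)))\<^sup>2" for x
  have b: "C1_on UNIV b" unfolding b_def[abs_def] by (rule C1_on_bump)
  have b0: "b x = 0" if "x \<notin> cball ?x0 r" for x
  proof -
    have "r < norm (x - ?x0)" using that by (simp add: dist_norm norm_minus_commute)
    then have "r\<^sup>2 < (norm (x - ?x0))\<^sup>2" using r(1) by (intro power_strict_mono) auto
    then show ?thesis by (simp add: b_def power2_norm_eq_inner)
  qed
  define \<eta> where "\<eta> q = (if q \<in> chart_dom c then b (chart_map c q) else 0)" for q
  define K where "K = chart_inv c ` cball ?x0 r"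
  have K: "compact K" "K \<subseteq> chart_dom c"
    unfolding K_def using continuous_chart_inv[OF c(1)] r chart_inv_in[OF c(1)]
    by (auto intro!: compact_continuous_image intro: continuous_on_subset)
  have \<eta>0: "\<eta> q = 0" if "q \<notin> K" for q
  proof (cases "q \<in> chart_dom c")
    case True
    then have "chart_map c q \<notin> cball ?x0 r" using that c(1) unfolding K_def
      by (metis chart_inv_map imageI)
    then show ?thesis using b0 by (simp add: \<eta>_def)
  qed (simp add: \<eta>_def)
  have "C1_fun A \<eta>"
    unfolding C1_fun_def
  proof
    fix d assume d: "d \<in> A"
    let ?U = "chart_map d ` (chart_dom d \<inter> chart_dom c)" and ?U' = "chart_map d ` (chart_dom d - K)"
    have U: "open ?U" "open ?U'"
      using d c(1) K(1)
      by (auto intro!: open_map_image open_Int open_Diff open_dom compact_imp_closed)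
    have "C1_on ?U (\<lambda>x. b (chart_map c (chart_inv d x)))"
      by (rule C1_on_compose[OF transition_C1[OF d c(1)] b]) simp
    then have 1: "C1_on ?U (\<lambda>x. \<eta> (chart_inv d x))"
      by (rule Ck_on_cong[OF U(1), rotated]) (use d in \<open>auto simp: \<eta>_def\<close>)
    have 2: "C1_on ?U' (\<lambda>x. \<eta> (chart_inv d x))"
      by (rule Ck_on_cong[OF U(2) _ C1_on_const[of _ 0]]) (use d \<eta>0 in auto)
    have "chart_image d = ?U \<union> ?U'" unfolding chart_image_def using K(2) by auto
    then show "C1_on (chart_image d) (\<lambda>x. \<eta> (chart_inv d x))"
      using C1_on_Un[OF U 1 2] by (simp del: Ck_on.simps)
  qed
  moreover have "\<eta> p > 0" using c(2) r(1) by (simp add: \<eta>_def b_def)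
  moreover have "\<eta> q \<ge> 0" for q by (simp add: \<eta>_def b_def)
  ultimately show ?thesis using that[OF c(1) K] \<eta>0 by blast
qed

text \<open>By compactness finitely many bumps have a positive sum, and dividing by it normalizes them.\<close>

lemma partition_of_unity:
  obtains I :: "'m set" and \<theta> where "finite I" "\<And>i. i \<in> I \<Longrightarrow> C1_fun A (\<theta> i)" "\<And>p. (\<Sum>i\<in>I. \<theta> i p) = 1"
    "\<And>i. i \<in> I \<Longrightarrow> \<exists>c\<in>A. \<exists>K. compact K \<and> K \<subseteq> chart_dom c \<and> (\<forall>q. q \<notin> K \<longrightarrow> \<theta> i q = 0)"
proof -
  have "\<forall>p. \<exists>\<eta>. C1_fun A \<eta> \<and> (\<forall>q. \<eta> q \<ge> 0) \<and> \<eta> p > 0 \<and>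
      (\<exists>c\<in>A. \<exists>K. compact K \<and> K \<subseteq> chart_dom c \<and> (\<forall>q. q \<notin> K \<longrightarrow> \<eta> q = 0))"
    by (intro allI) (rule exists_bump, blast)
  then obtain \<eta> where \<eta>: "\<And>p. C1_fun A (\<eta> p)" "\<And>p q. \<eta> p q \<ge> 0" "\<And>p. \<eta> p p > 0"
    "\<And>p. \<exists>c\<in>A. \<exists>K. compact K \<and> K \<subseteq> chart_dom c \<and> (\<forall>q. q \<notin> K \<longrightarrow> \<eta> p q = 0)"
    by metis
  have op: "open {q. \<eta> p q > 0}" for p
    using C1_fun_continuous[OF \<eta>(1)] by (intro open_Collect_less continuous_on_const)
  have "compact (UNIV :: 'm set)" using manifold by (simp add: closed_riemannian_manifold_def)
  moreover have "UNIV \<subseteq> (\<Union>p\<in>UNIV. {q. \<eta> p q > 0})" using \<eta>(3) by auto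
  ultimately obtain I where I: "I \<subseteq> UNIV" "finite I" "UNIV \<subseteq> (\<Union>p\<in>I. {q. \<eta> p q > 0})"
    by (rule compactE_image[OF _ op])
  define S where "S q = (\<Sum>p\<in>I. \<eta> p q)" for q
  have S: "S q > 0" for q
  proof -
    obtain p where "p \<in> I" "\<eta> p q > 0" using I(3) by auto
    then show ?thesis unfolding S_def using \<eta>(2) by (intro sum_pos2[OF I(2)]) auto
  qed
  have S0: "S q \<noteq> 0" for q using S[of q] by simp
  have CS: "C1_fun A S" unfolding S_def[abs_def] by (intro C1_fun_sum \<eta>(1))
  show ?thesis
  proof (rule that[of I "\<lambda>i q. \<eta> i q / S q"])
    show "C1_fun A (\<lambda>q. \<eta> i q / S q)" for i
      by (intro C1_fun_divide \<eta>(1) CS S0)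
    show "(\<Sum>i\<in>I. \<eta> i p / S p) = 1" for p
      using S[of p] by (simp add: sum_divide_distrib[symmetric] S_def)
    show "\<exists>c\<in>A. \<exists>K. compact K \<and> K \<subseteq> chart_dom c \<and> (\<forall>q. q \<notin> K \<longrightarrow> \<eta> i q / S q = 0)" for i
      using \<eta>(4)[of i] by (simp add: S0)
  qed (rule I(2))
qed

lemma smooth_fun_on: "smooth_fun A f \<Longrightarrow> c \<in> A \<Longrightarrow> smooth_on (chart_image c) (\<lambda>x. f (chart_inv c x))"
  by (auto simp: smooth_fun_def o_def)

lemma is_laplacianD:
  assumes "is_laplacian A g f h"
  shows "smooth_fun A f"
    and "c \<in> A \<Longrightarrow> x \<in> chart_image c \<Longrightarrow>
      h (chart_inv c x) = local_laplacian (g c) (\<lambda>x. f (chart_inv c x)) x"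
  using assms chart_inv_in by (auto simp: is_laplacian_def o_def)

lemma laplacian_continuous:
  assumes "is_laplacian A g f h"
  shows "continuous_on UNIV h"
proof (rule continuous_on_charts)
  fix c assume c: "c \<in> A"
  have "sqrt (det (g c x)) \<noteq> 0" if "x \<in> chart_image c" for x
    using metric_det_pos[OF c that] by simp
  then have "continuous_on (chart_image c) (local_laplacian (g c) (\<lambda>x. f (chart_inv c x)))"
    unfolding local_laplacian_flux[abs_def] partial_deriv_def
    by (intro continuous_intros C1_onD(2)[OF flux_C1] C1_onD(3)[OF sqrt_det_C1] c
        smooth_fun_on[OF is_laplacianD(1)[OF assms]]) auto
  then show "continuous_on (chart_image c) (\<lambda>x. h (chart_inv c x))"
    by (rule continuous_on_eq) (simp add: is_laplacianD(2)[OF assms c])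
qed

text \<open>The flux of the linear combination is the linear combination of the fluxes only on the image of
  the chart; this suffices, as the image is open and partial derivatives are local.\<close>

lemma laplacian_lincomb:
  assumes 1: "is_laplacian A g f1 h1" and 2: "is_laplacian A g f2 h2"
  shows "is_laplacian A g (\<lambda>p. a * f1 p + b * f2 p) (\<lambda>p. a * h1 p + b * h2 p)"
  unfolding is_laplacian_def
proof (intro conjI ballI)
  show "smooth_fun A (\<lambda>p. a * f1 p + b * f2 p)"
    using is_laplacianD(1)[OF 1] is_laplacianD(1)[OF 2]
    unfolding smooth_fun_def smooth_on_def
    by (auto simp: o_def intro!: Ck_on_lincomb open_chart_image)
next
  fix c p assume c: "c \<in> A" "p \<in> chart_dom c"
  let ?x = "chart_map c p" and ?S = "chart_image c"
  let ?u = "\<lambda>x. f1 (chart_inv c x)" and ?v = "\<lambda>x. f2 (chart_inv c x)"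
  have x: "?x \<in> ?S" by (rule chart_map_in[OF c])
  note s1 = smooth_fun_on[OF is_laplacianD(1)[OF 1] c(1)]
  note s2 = smooth_fun_on[OF is_laplacianD(1)[OF 2] c(1)]
  have lin: "partial_deriv i (\<lambda>y. a * u y + b * v y) y
      = a * partial_deriv i u y + b * partial_deriv i v y"
    if "C1_on ?S u" "C1_on ?S v" "y \<in> ?S" for u v i y
  proof -
    have "((\<lambda>y. a * u y + b * v y) has_derivative
        (\<lambda>w. a * frechet_derivative u (at y) w + b * frechet_derivative v (at y) w)) (at y)"
      by (intro derivative_intros C1_onD(1)[OF that(1,3)] C1_onD(1)[OF that(2,3)])
    from fun_cong[OF frechet_derivative_at[OF this], of "axis i 1"] show ?thesis
      by (simp add: partial_deriv_def)
  qed
  have fl: "flux (g c) (\<lambda>y. a * ?u y + b * ?v y) i y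
      = a * flux (g c) ?u i y + b * flux (g c) ?v i y" if "y \<in> ?S" for i y
    unfolding flux_def lin[OF smooth_on_C1[OF s1] smooth_on_C1[OF s2] that]
    by (simp add: distrib_left sum.distrib sum_distrib_left mult_ac)
  have pf: "partial_deriv i (flux (g c) (\<lambda>y. a * ?u y + b * ?v y) i) ?x
      = a * partial_deriv i (flux (g c) ?u i) ?x + b * partial_deriv i (flux (g c) ?v i) ?x" for i
  proof -
    have C: "C1_on ?S (\<lambda>y. a * flux (g c) ?u i y + b * flux (g c) ?v i y)"
      by (intro C1_on_add C1_on_mult C1_on_const flux_C1 c s1 s2)
    have "frechet_derivative (\<lambda>y. a * flux (g c) ?u i y + b * flux (g c) ?v i y) (at ?x)
        = frechet_derivative (flux (g c) (\<lambda>y. a * ?u y + b * ?v y) i) (at ?x)"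
      by (rule frechet_derivative_transform_within_open[OF _ open_chart_image[OF c(1)] x])
         (use C1_onD(1)[OF C x] fl in \<open>auto simp: differentiable_def\<close>)
    then show ?thesis
      using lin[OF flux_C1[OF c(1) s1] flux_C1[OF c(1) s2] x]
      unfolding partial_deriv_def by metis
  qed
  have "local_laplacian (g c) (\<lambda>y. a * ?u y + b * ?v y) ?x
      = a * local_laplacian (g c) ?u ?x + b * local_laplacian (g c) ?v ?x"
    unfolding local_laplacian_flux pf
    by (simp add: sum.distrib sum_distrib_left add_divide_distrib)
  then show "a * h1 p + b * h2 p
      = local_laplacian (g c) ((\<lambda>p. a * f1 p + b * f2 p) \<circ> chart_inv c) (chart_map c p)"
    using is_laplacianD(2)[OF 1 c(1) x] is_laplacianD(2)[OF 2 c(1) x] c by (simp add: o_def)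
qed

lemma laplacian_zero: "is_laplacian A g (\<lambda>p. 0) (\<lambda>p. 0)"
  by (auto simp: is_laplacian_def smooth_fun_def smooth_on_def o_def Ck_on_const local_laplacian_def
      partial_deriv_def)

end

section \<open>Integration on the manifold and Green's formula\<close>

context closed_manifold
begin

context
  fixes V :: "'m measure"
  assumes V: "riemannian_volume A g V"
begin

lemma sets_volume [measurable_cong]: "sets V = sets borel"
  using V by (simp add: riemannian_volume_def)

lemma space_volume [simp]: "space V = UNIV"
  using sets_eq_imp_space_eq[OF sets_volume] by simp

lemma continuous_volume_measurable:
  fixes F :: "'m \<Rightarrow> real"
  shows "continuous_on UNIV F \<Longrightarrow> F \<in> borel_measurable V"
  using borel_measurable_continuous_onI measurable_cong_sets[OF sets_volume refl] by blast

lemma emeasure_volume: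
  "c \<in> A \<Longrightarrow> B \<in> sets borel \<Longrightarrow> B \<subseteq> chart_dom c \<Longrightarrow> emeasure V B
     = (\<integral>\<^sup>+x. ennreal (sqrt (det (g c x))) * indicator (chart_map c ` B) x \<partial>lborel)"
  using V by (simp add: riemannian_volume_def)

lemma volume_density_measurable:
  assumes c: "c \<in> A"
  shows "(\<lambda>x. indicator (chart_image c) x * sqrt (det (g c x))) \<in> borel_measurable borel"
  using borel_measurable_continuous_on_indicator[OF borel_open[OF open_chart_image[OF c]]
      C1_onD(3)[OF sqrt_det_C1[OF c]]] by simp

text \<open>The volume restricted to the domain of a chart is the image of \<open>\<surd>|G| dx\<close> under the inverse of the
  chart; both measures agree on Borel sets by the definition of the volume.\<close>

lemma integral_in_chart:
  fixes F :: "'m \<Rightarrow> real"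
  assumes c: "c \<in> A" and F: "F \<in> borel_measurable borel" "\<And>p. p \<notin> chart_dom c \<Longrightarrow> F p = 0"
  shows "(LINT p|V. F p)
       = (LINT x|lborel. indicator (chart_image c) x * sqrt (det (g c x)) * F (chart_inv c x))"
proof -
  let ?S = "chart_image c" and ?D = "chart_dom c"
  define \<rho> where "\<rho> x = indicator ?S x * sqrt (det (g c x))" for x
  have \<rho> [measurable]: "\<rho> \<in> borel_measurable borel"
    unfolding \<rho>_def[abs_def] by (rule volume_density_measurable[OF c])
  have \<rho>0: "0 \<le> \<rho> x" for x
    using metric_det_pos[OF c, of x] by (auto simp: \<rho>_def indicator_def)
  have Sm [measurable]: "?S \<in> sets borel" and Dm [measurable]: "?D \<in> sets borel"
    using open_chart_image[OF c] open_dom[OF c] by auto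
  define q where "q x = (if x \<in> ?S then chart_inv c x else undefined)" for x
  have q [measurable]: "q \<in> borel_measurable borel"
    unfolding q_def[abs_def]
    using borel_measurable_continuous_on_restrict[OF continuous_chart_inv[OF c]]
    by (subst (asm) measurable_restrict_space_iff[where c = undefined]) auto
  have DV [measurable]: "?D \<in> sets V" by (simp add: sets_volume)
  have eq: "density V (\<lambda>p. ennreal (indicator ?D p)) = distr (density lborel (\<lambda>x. ennreal (\<rho> x))) borel q"
  proof (rule measure_eqI)
    show "sets (density V (\<lambda>p. ennreal (indicator ?D p)))
        = sets (distr (density lborel (\<lambda>x. ennreal (\<rho> x))) borel q)" by (simp add: sets_volume)
    fix B assume "B \<in> sets (density V (\<lambda>p. ennreal (indicator ?D p)))"
    then have B [measurable]: "B \<in> sets borel" by (simp add: sets_volume)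
    then have BV: "B \<in> sets V" by (simp add: sets_volume)
    have qB: "q -` B \<in> sets borel" using measurable_sets[OF q B] by simp
    have "emeasure (density V (\<lambda>p. ennreal (indicator ?D p))) B
        = (\<integral>\<^sup>+p. ennreal (indicator ?D p) * indicator B p \<partial>V)"
      using DV BV by (intro emeasure_density) auto
    also have "\<dots> = (\<integral>\<^sup>+p. indicator (B \<inter> ?D) p \<partial>V)"
      by (intro nn_integral_cong) (auto simp: indicator_def)
    also have "\<dots> = emeasure V (B \<inter> ?D)" using BV DV by (intro nn_integral_indicator) auto
    also have "\<dots> = (\<integral>\<^sup>+x. ennreal (sqrt (det (g c x))) * indicator (chart_map c ` (B \<inter> ?D)) x \<partial>lborel)"
      by (rule emeasure_volume[OF c]) auto
    also have "\<dots> = (\<integral>\<^sup>+x. ennreal (\<rho> x) * indicator (q -` B) x \<partial>lborel)"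
    proof (rule nn_integral_cong)
      fix x
      have "x \<in> chart_map c ` (B \<inter> ?D) \<longleftrightarrow> x \<in> ?S \<and> q x \<in> B"
      proof
        assume "x \<in> ?S \<and> q x \<in> B"
        then show "x \<in> chart_map c ` (B \<inter> ?D)"
          using chart_inv_in[OF c, of x] chart_map_inv[OF c, of x]
          by (intro image_eqI[of _ _ "chart_inv c x"]) (auto simp: q_def)
      qed (use c chart_map_in[OF c] in \<open>auto simp: q_def\<close>)
      then show "ennreal (sqrt (det (g c x))) * indicator (chart_map c ` (B \<inter> ?D)) x
          = ennreal (\<rho> x) * indicator (q -` B) x"
        by (auto simp: indicator_def \<rho>_def)
    qed
    also have "\<dots> = emeasure (density lborel (\<lambda>x. ennreal (\<rho> x))) (q -` B)"
      using qB by (intro emeasure_density[symmetric]) auto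
    also have "\<dots> = emeasure (distr (density lborel (\<lambda>x. ennreal (\<rho> x))) borel q) B"
      by (subst emeasure_distr) auto
    finally show "emeasure (density V (\<lambda>p. ennreal (indicator ?D p))) B
        = emeasure (distr (density lborel (\<lambda>x. ennreal (\<rho> x))) borel q) B" .
  qed
  have FV: "F \<in> borel_measurable V" using F(1) measurable_cong_sets[OF sets_volume refl] by blast
  have "(LINT p|V. F p) = (LINT p|V. indicator ?D p *\<^sub>R F p)"
    by (intro Bochner_Integration.integral_cong refl) (use F(2) in \<open>auto simp: indicator_def\<close>)
  also have "\<dots> = (LINT p|density V (\<lambda>p. ennreal (indicator ?D p)). F p)"
    using FV DV by (intro integral_density[symmetric]) auto
  also have "\<dots> = (LINT x|density lborel (\<lambda>x. ennreal (\<rho> x)). F (q x))"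
    unfolding eq using F(1) by (intro integral_distr) auto
  also have "\<dots> = (LINT x|lborel. \<rho> x *\<^sub>R F (q x))"
    using F(1) \<rho>0 by (intro integral_density) auto
  also have "\<dots> = (LINT x|lborel. indicator ?S x * sqrt (det (g c x)) * F (chart_inv c x))"
    by (intro Bochner_Integration.integral_cong refl) (auto simp: q_def \<rho>_def indicator_def)
  finally show ?thesis .
qed

text \<open>A chart can have infinite volume, but the points over a small coordinate ball form an open set
  of finite volume, and finitely many such sets cover the manifold.\<close>

lemma volume_finite: "emeasure V UNIV < \<infinity>"
proof -
  have "\<exists>U. open U \<and> p \<in> U \<and> emeasure V U < \<infinity>" for p
  proof -
    obtain c where c: "c \<in> A" "p \<in> chart_dom c" using covered by blast
    let ?x0 = "chart_map c p"
    obtain r where r: "r > 0" "cball ?x0 r \<subseteq> chart_image c"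
      using open_contains_cball open_chart_image[OF c(1)] chart_map_in[OF c] by blast
    have "continuous_on (cball ?x0 r) (\<lambda>x. sqrt (det (g c x)))"
      using C1_onD(3)[OF sqrt_det_C1[OF c(1)]] r(2) continuous_on_subset by blast
    then have "bounded ((\<lambda>x. sqrt (det (g c x))) ` cball ?x0 r)"
      by (intro compact_imp_bounded compact_continuous_image compact_cball)
    then obtain B where B: "\<And>x. x \<in> cball ?x0 r \<Longrightarrow> sqrt (det (g c x)) \<le> B"
      unfolding bounded_iff by (fastforce dest: abs_le_D1)
    define U where "U = chart_dom c \<inter> chart_map c -` ball ?x0 r"
    have U: "open U" "p \<in> U" "U \<subseteq> chart_dom c"
      using open_map_vimage[OF c(1) open_ball] c(2) r(1) by (auto simp: U_def)
    have "emeasure V U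
        = (\<integral>\<^sup>+x. ennreal (sqrt (det (g c x))) * indicator (chart_map c ` U) x \<partial>lborel)"
      by (rule emeasure_volume[OF c(1)]) (use U in auto)
    also have "\<dots> \<le> (\<integral>\<^sup>+x. ennreal B * indicator (cball ?x0 r) x \<partial>lborel)"
    proof (rule nn_integral_mono)
      fix x
      show "ennreal (sqrt (det (g c x))) * indicator (chart_map c ` U) x
          \<le> ennreal B * indicator (cball ?x0 r) x"
        using B[of x] unfolding U_def by (auto simp: indicator_def intro!: ennreal_leI)
    qed
    also have "\<dots> = ennreal B * emeasure lborel (cball ?x0 r)"
      by (intro nn_integral_cmult_indicator) simp
    also have "\<dots> < \<infinity>"
      using emeasure_bounded_finite[OF bounded_cball, of ?x0 r]
      by (simp add: ennreal_mult_less_top)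
    finally show ?thesis using U by blast
  qed
  then obtain U where U: "\<And>p. open (U p)" "\<And>p. p \<in> U p" "\<And>p. emeasure V (U p) < \<infinity>"
    by metis
  have "compact (UNIV :: 'm set)" using manifold by (simp add: closed_riemannian_manifold_def)
  moreover have "UNIV \<subseteq> (\<Union>p\<in>UNIV. U p)" using U(2) by auto
  ultimately obtain I where I: "I \<subseteq> UNIV" "finite I" "UNIV \<subseteq> (\<Union>p\<in>I. U p)"
    by (rule compactE_image[OF _ U(1)])
  have "emeasure V UNIV \<le> emeasure V (\<Union>p\<in>I. U p)"
    using I U(1) by (intro emeasure_mono) (auto simp: sets_volume)
  also have "\<dots> \<le> (\<Sum>p\<in>I. emeasure V (U p))"
    using I U(1) by (intro emeasure_subadditive_finite) (auto simp: sets_volume)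
  also have "\<dots> < \<infinity>" using U(3) I(2) by simp
  finally show ?thesis .
qed

lemma finite_measure_volume: "finite_measure V"
  using volume_finite by (intro finite_measureI) simp

lemma continuous_bounded:
  fixes F :: "'m \<Rightarrow> real"
  assumes "continuous_on UNIV F"
  obtains B where "\<And>p. \<bar>F p\<bar> \<le> B"
proof -
  have "compact (UNIV :: 'm set)" using manifold by (simp add: closed_riemannian_manifold_def)
  then have "bounded (range F)" by (intro compact_imp_bounded compact_continuous_image assms)
  then show ?thesis using that unfolding bounded_iff by auto
qed

lemma continuous_integrable:
  fixes F :: "'m \<Rightarrow> real"
  assumes F: "continuous_on UNIV F"
  shows "integrable V F"
proof -
  obtain B where "\<And>p. \<bar>F p\<bar> \<le> B" by (rule continuous_bounded[OF F]) (rule that)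
  then show ?thesis
    by (intro finite_measure.integrable_const_bound[OF finite_measure_volume, of _ B]
        continuous_volume_measurable[OF F]) auto
qed

text \<open>In the chart, \<open>\<surd>|G| (\<eta> \<Delta>f + \<langle>d\<eta>, df\<rangle>)\<close> is the divergence of the compactly supported field
  \<open>\<eta> \<surd>|G| G\<^sup>i\<^sup>j \<partial>\<^sub>jf\<close>.\<close>

lemma green_in_chart:
  assumes c: "c \<in> A" and K: "compact K" "K \<subseteq> chart_dom c" and \<eta>: "C1_fun A \<eta>" "\<And>q. q \<notin> K \<Longrightarrow> \<eta> q = 0"
    and f: "is_laplacian A g f h"
  shows "(LINT p|V. \<eta> p * h p + differential_pairing A g \<eta> f p) = 0"
proof -
  let ?S = "chart_image c" and ?F = "\<lambda>p. \<eta> p * h p + differential_pairing A g \<eta> f p"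
  let ?e = "\<lambda>x. \<eta> (chart_inv c x)" and ?u = "\<lambda>x. f (chart_inv c x)"
  note smooth = is_laplacianD(1)[OF f]
  note Cf = smooth_fun_C1[OF smooth]
  note fl = flux_C1[OF c smooth_fun_on[OF smooth c]]
  note e1 = C1_fun_on[OF \<eta>(1) c]
  have "continuous_on UNIV ?F"
    by (intro continuous_intros C1_fun_continuous[OF \<eta>(1)] laplacian_continuous[OF f]
        differential_pairing_continuous[OF \<eta>(1) Cf])
  then have Fm: "?F \<in> borel_measurable borel" by (rule borel_measurable_continuous_onI)
  have F0: "?F p = 0" if "p \<notin> chart_dom c" for p
  proof -
    have "p \<in> - K" "open (- K)" using that K compact_imp_closed by (auto intro: open_Compl)
    then show ?thesis
      using differential_pairing_local_zero[OF \<eta>(1) Cf, of "- K" p] \<eta>(2) by simp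
  qed
  define K' where "K' = chart_map c ` K"
  have K': "compact K'" "K' \<subseteq> ?S"
    unfolding K'_def using K chart_map_in[OF c] continuous_on_subset[OF continuous_chart_map[OF c]]
    by (auto intro!: compact_continuous_image)
  have e0: "?e x = 0" if "x \<in> ?S" "x \<notin> K'" for x
  proof (rule \<eta>(2))
    show "chart_inv c x \<notin> K" using that chart_map_inv[OF c that(1)] unfolding K'_def by (metis imageI)
  qed
  define w where "w i x = (if x \<in> ?S then ?e x * flux (g c) ?u i x else 0)" for i x
  have w0: "w i x = 0" if "x \<notin> K'" for i x using e0[of x] that by (auto simp: w_def)
  have oK: "open (- K')" using K'(1) compact_imp_closed by (auto intro: open_Compl)
  have wC: "C1_on UNIV (w i)" for i
  proof -
    have "C1_on ?S (w i)"
      by (rule Ck_on_cong[OF open_chart_image[OF c] _ C1_on_mult[OF e1 fl[where i = i]]]) (simp add: w_def)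
    moreover have "C1_on (- K') (w i)"
      by (rule Ck_on_cong[OF oK _ C1_on_const[of _ 0]]) (use w0 in auto)
    moreover have "?S \<union> - K' = UNIV" using K'(2) by auto
    ultimately show ?thesis using C1_on_Un[OF open_chart_image[OF c] oK] by metis
  qed
  have dw: "frechet_derivative (w i) (at x) (axis i 1)
      = indicator ?S x * (partial_deriv i ?e x * flux (g c) ?u i x
          + ?e x * partial_deriv i (flux (g c) ?u i) x)" for i x
  proof (cases "x \<in> ?S")
    case True
    have "((\<lambda>x. ?e x * flux (g c) ?u i x) has_derivative
        (\<lambda>v. ?e x * frechet_derivative (flux (g c) ?u i) (at x) v
          + frechet_derivative ?e (at x) v * flux (g c) ?u i x)) (at x)"
      by (intro has_derivative_mult C1_onD(1)[OF e1 True] C1_onD(1)[OF fl True])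
    then have "(w i has_derivative
        (\<lambda>v. ?e x * frechet_derivative (flux (g c) ?u i) (at x) v
          + frechet_derivative ?e (at x) v * flux (g c) ?u i x)) (at x)"
      by (rule has_derivative_transform_within_open[OF _ open_chart_image[OF c] True])
         (simp add: w_def)
    from fun_cong[OF frechet_derivative_at[OF this], of "axis i 1"]
    show ?thesis using True by (simp add: partial_deriv_def)
  next
    case False
    then have x: "x \<in> - K'" using K'(2) by auto
    have "((\<lambda>x. 0::real) has_derivative (\<lambda>v. 0)) (at x)" by simp
    then have "(w i has_derivative (\<lambda>v. 0)) (at x)"
      by (rule has_derivative_transform_within_open[OF _ oK x]) (use w0 in auto)
    from fun_cong[OF frechet_derivative_at[OF this], of "axis i 1"]
    show ?thesis using False by simp
  qed
  have "(LINT p|V. ?F p) = (LINT x|lborel. indicator ?S x * sqrt (det (g c x)) * ?F (chart_inv c x))"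
    by (rule integral_in_chart[OF c Fm F0])
  also have "\<dots> = (LINT x|lborel. (\<Sum>i\<in>UNIV. frechet_derivative (w i) (at x) (axis i 1)))"
  proof (rule Bochner_Integration.integral_cong[OF refl])
    fix x
    show "indicator ?S x * sqrt (det (g c x)) * ?F (chart_inv c x)
        = (\<Sum>i\<in>UNIV. frechet_derivative (w i) (at x) (axis i 1))"
    proof (cases "x \<in> ?S")
      case True
      have dp: "differential_pairing A g \<eta> f (chart_inv c x) = gradient_pairing (g c) ?e ?u x"
        using differential_pairing_chart[OF \<eta>(1) Cf c chart_inv_in[OF c True]] True c by simp
      have sd: "sqrt (det (g c x)) \<noteq> 0" using metric_det_pos[OF c True] by simp
      then have ll: "sqrt (det (g c x)) * local_laplacian (g c) ?u x
          = (\<Sum>i\<in>UNIV. partial_deriv i (flux (g c) ?u i) x)"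
        by (simp add: local_laplacian_flux)
      have "sqrt (det (g c x)) * ?F (chart_inv c x)
          = ?e x * (sqrt (det (g c x)) * local_laplacian (g c) ?u x)
            + sqrt (det (g c x)) * gradient_pairing (g c) ?e ?u x"
        by (simp add: dp is_laplacianD(2)[OF f c True] algebra_simps)
      also have "\<dots> = (\<Sum>i\<in>UNIV. partial_deriv i ?e x * flux (g c) ?u i x
          + ?e x * partial_deriv i (flux (g c) ?u i) x)"
        unfolding ll gradient_pairing_flux by (simp add: sum.distrib sum_distrib_left)
      finally show ?thesis using True by (simp add: dw)
    qed (simp add: dw)
  qed
  also have "\<dots> = (\<Sum>i\<in>UNIV. (LINT x|lborel. frechet_derivative (w i) (at x) (axis i 1)))"
    by (intro Bochner_Integration.integral_sum integral_derivative_compact_support(2)[OF wC K'(1)] w0)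
  also have "\<dots> = 0"
    by (simp add: integral_derivative_compact_support(1)[OF wC K'(1) w0])
  finally show ?thesis .
qed

text \<open>The chart version is applied to each \<open>\<theta>\<^sub>ik\<close>. In the sum over \<open>i\<close> the differentials of the \<open>\<theta>\<^sub>i\<close>
  disappear, as \<open>\<theta>\<^sub>1k + \<theta>\<^sub>2k + \<dots> = k\<close> and the pairing is additive.\<close>

lemma green_volume:
  assumes k: "C1_fun A k" and f: "is_laplacian A g f h"
  shows "(LINT p|V. k p * h p) = - (LINT p|V. differential_pairing A g k f p)"
proof (rule partition_of_unity)
  fix I :: "'m set" and \<theta>
  assume I: "finite I" "\<And>i. i \<in> I \<Longrightarrow> C1_fun A (\<theta> i)" "\<And>p. (\<Sum>i\<in>I. \<theta> i p) = 1"
    "\<And>i. i \<in> I \<Longrightarrow> \<exists>c\<in>A. \<exists>K. compact K \<and> K \<subseteq> chart_dom c \<and> (\<forall>q. q \<notin> K \<longrightarrow> \<theta> i q = 0)"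
  note Cf = smooth_fun_C1[OF is_laplacianD(1)[OF f]]
  have Ck: "C1_fun A (\<lambda>p. \<theta> i p * k p)" if "i \<in> I" for i by (rule C1_fun_mult[OF I(2)[OF that] k])
  have split: "(\<lambda>p. \<Sum>i\<in>I. \<theta> i p * k p) = k" by (simp add: sum_distrib_right[symmetric] I(3))
  let ?F = "\<lambda>i p. \<theta> i p * k p * h p + differential_pairing A g (\<lambda>p. \<theta> i p * k p) f p"
  have int: "integrable V (?F i)" if "i \<in> I" for i
    by (intro continuous_integrable continuous_intros C1_fun_continuous I(2)[OF that] k
        laplacian_continuous[OF f] differential_pairing_continuous[OF Ck[OF that] Cf])
  have zero: "(LINT p|V. ?F i p) = 0" if i: "i \<in> I" for i
  proof -
    obtain c K where "c \<in> A" "compact K" "K \<subseteq> chart_dom c" "\<And>q. q \<notin> K \<Longrightarrow> \<theta> i q = 0"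
      using I(4)[OF i] by blast
    then show ?thesis using green_in_chart[OF _ _ _ Ck[OF i] _ f, of c K] by simp
  qed
  have "(\<Sum>i\<in>I. ?F i p) = k p * h p + differential_pairing A g k f p" for p
    using differential_pairing_sum[of I "\<lambda>i p. \<theta> i p * k p" f p, OF Ck Cf]
    by (simp add: split sum.distrib sum_distrib_right[symmetric] I(3))
  then have "(LINT p|V. k p * h p + differential_pairing A g k f p) = (LINT p|V. (\<Sum>i\<in>I. ?F i p))"
    by simp
  also have "\<dots> = (\<Sum>i\<in>I. (LINT p|V. ?F i p))"
    by (rule Bochner_Integration.integral_sum) (rule int)
  also have "\<dots> = 0" by (simp add: zero)
  also have "(LINT p|V. k p * h p + differential_pairing A g k f p)
      = (LINT p|V. k p * h p) + (LINT p|V. differential_pairing A g k f p)"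
    by (intro Bochner_Integration.integral_add continuous_integrable continuous_intros
        C1_fun_continuous k laplacian_continuous[OF f] differential_pairing_continuous Cf)
  finally show ?thesis by linarith
qed

lemma laplacian_symmetric_volume:
  assumes "is_laplacian A g f1 h1" "is_laplacian A g f2 h2"
  shows "(LINT p|V. h1 p * f2 p) = (LINT p|V. f1 p * h2 p)"
proof -
  note C = smooth_fun_C1[OF is_laplacianD(1)[OF assms(1)]] smooth_fun_C1[OF is_laplacianD(1)[OF assms(2)]]
  have "(LINT p|V. h1 p * f2 p) = - (LINT p|V. differential_pairing A g f2 f1 p)"
    using green_volume[OF C(2) assms(1)] by (simp add: mult.commute)
  also have "\<dots> = - (LINT p|V. differential_pairing A g f1 f2 p)"
    by (simp add: differential_pairing_commute[OF C(2,1)])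
  finally show ?thesis using green_volume[OF C(1) assms(2)] by simp
qed

end

text \<open>Should the total volume vanish, the normalizing factor is infinite, but then both measures are
  zero and any finite factor will do.\<close>

lemma normalized_volume_density:
  assumes "normalized_volume A g \<nu>"
  obtains V r where "riemannian_volume A g V" "r \<ge> 0" "\<nu> = density V (\<lambda>_. ennreal r)"
proof -
  obtain V where V: "riemannian_volume A g V" "\<nu> = scale_measure (1 / emeasure V UNIV) V"
    using assms by (auto simp: normalized_volume_def)
  note sp = space_volume[OF V(1)]
  show ?thesis
  proof (cases "emeasure V UNIV = 0")
    case True
    then have z: "emeasure V B = 0" for B
      by (metis emeasure_space sp le_zero_eq)
    have "\<nu> = density V (\<lambda>_. ennreal 1)"
      unfolding V(2) by (rule measure_eqI) (auto simp: z emeasure_density)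
    then show ?thesis using that[OF V(1), of 1] by simp
  next
    case False
    define r where "r = 1 / enn2real (emeasure V UNIV)"
    have "enn2real (emeasure V UNIV) > 0"
      using False volume_finite[OF V(1)] by (simp add: enn2real_positive_iff less_top zero_less_iff_neq_zero)
    then have r: "ennreal r = 1 / emeasure V UNIV"
      unfolding r_def using volume_finite[OF V(1)]
      by (metis divide_ennreal ennreal_1 ennreal_enn2real zero_le_one infinity_ennreal_def)
    have "\<nu> = density V (\<lambda>_. ennreal r)"
      unfolding V(2) r[symmetric]
      by (rule measure_eqI) (auto simp: emeasure_density nn_integral_cmult_indicator)
    then show ?thesis using that[OF V(1), of r] by (simp add: r_def)
  qed
qed

context
  fixes \<nu> :: "'m measure"
  assumes \<nu>: "normalized_volume A g \<nu>"
begin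

lemma continuous_L2:
  assumes "continuous_on UNIV F"
  shows "F \<in> L2 \<nu>"
proof -
  obtain V r where V: "riemannian_volume A g V" "r \<ge> 0" "\<nu> = density V (\<lambda>_. ennreal r)"
    by (rule normalized_volume_density[OF \<nu>]) (rule that)
  have m: "(\<lambda>x. (F x)\<^sup>2) \<in> borel_measurable V" "F \<in> borel_measurable V"
    using assms by (auto intro!: continuous_volume_measurable[OF V(1)] continuous_intros)
  have "integrable V (\<lambda>x. r *\<^sub>R (F x)\<^sup>2)"
    using assms by (intro continuous_integrable[OF V(1)] continuous_intros)
  then show ?thesis
    unfolding L2_def V(3) using m V(2) by (simp add: integrable_density)
qed

lemma laplacian_symmetric:
  assumes "is_laplacian A g f1 h1" "is_laplacian A g f2 h2"
  shows "L2_inner \<nu> h1 f2 = L2_inner \<nu> f1 h2"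
proof -
  obtain V r where V: "riemannian_volume A g V" "r \<ge> 0" "\<nu> = density V (\<lambda>_. ennreal r)"
    by (rule normalized_volume_density[OF \<nu>]) (rule that)
  have *: "L2_inner \<nu> F G = r * (LINT p|V. F p * G p)"
    if "continuous_on UNIV F" "continuous_on UNIV G" for F G
  proof -
    have "(\<lambda>p. F p * G p) \<in> borel_measurable V"
      using that by (intro continuous_volume_measurable[OF V(1)] continuous_intros)
    then show ?thesis
      unfolding L2_inner_def V(3) using V(2) by (subst integral_density) auto
  qed
  have "continuous_on UNIV f1" "continuous_on UNIV f2"
    using assms by (auto intro!: C1_fun_continuous smooth_fun_C1 dest: is_laplacianD(1))
  then show ?thesis
    using laplacian_symmetric_volume[OF V(1) assms] laplacian_continuous[OF assms(1)]
      laplacian_continuous[OF assms(2)] by (simp add: *)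
qed

end

end

section \<open>Eigenspaces and spectral multipliers\<close>

lemma L2_tendsto_lincomb:
  assumes "\<And>k. F k \<in> L2 M" "f \<in> L2 M" "L2_tendsto M F f"
    and "\<And>k. H k \<in> L2 M" "h \<in> L2 M" "L2_tendsto M H h"
  shows "L2_tendsto M (\<lambda>k x. a * F k x + b * H k x) (\<lambda>x. a * f x + b * h x)"
  unfolding L2_tendsto_def
proof (rule Lim_null_comparison)
  let ?B = "\<lambda>k. \<bar>a\<bar> * L2_norm M (\<lambda>x. F k x - f x) + \<bar>b\<bar> * L2_norm M (\<lambda>x. H k x - h x)"
  show "\<forall>\<^sub>F k in sequentially.
      norm (L2_norm M (\<lambda>x. a * F k x + b * H k x - (a * f x + b * h x))) \<le> ?B k"
  proof (intro always_eventually allI)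
    fix k
    have "(\<lambda>x. a * F k x + b * H k x - (a * f x + b * h x))
        = (\<lambda>x. a * (F k x - f x) + b * (H k x - h x))"
      by (auto simp: algebra_simps)
    moreover have "L2_norm M (\<lambda>x. a * (F k x - f x) + b * (H k x - h x)) \<le> ?B k"
      using L2_norm_add_le[OF L2_cmult[OF L2_diff[OF assms(1)[of k] assms(2)], of a]
          L2_cmult[OF L2_diff[OF assms(4)[of k] assms(5)], of b]]
      by (simp add: L2_norm_cmult)
    ultimately show "norm (L2_norm M (\<lambda>x. a * F k x + b * H k x - (a * f x + b * h x))) \<le> ?B k"
      by simp
  qed
  have "?B \<longlonglongrightarrow> \<bar>a\<bar> * 0 + \<bar>b\<bar> * 0"
    by (intro tendsto_intros assms(3,6)[unfolded L2_tendsto_def])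
  then show "?B \<longlonglongrightarrow> 0" by simp
qed

context closed_manifold
begin

context
  fixes \<nu> :: "'m measure"
  assumes \<nu>: "normalized_volume A g \<nu>"
begin

lemma laplacian_L2:
  assumes "is_laplacian A g f h"
  shows "f \<in> L2 \<nu>" "h \<in> L2 \<nu>" "(\<lambda>x. - h x) \<in> L2 \<nu>"
proof -
  show "f \<in> L2 \<nu>"
    by (intro continuous_L2[OF \<nu>] C1_fun_continuous smooth_fun_C1 is_laplacianD(1)[OF assms])
  show "h \<in> L2 \<nu>" "(\<lambda>x. - h x) \<in> L2 \<nu>"
    by (intro continuous_L2[OF \<nu>] continuous_intros laplacian_continuous[OF assms])+
qed

lemma eigenspaceD:
  assumes "u \<in> eigenspace A g \<nu> l"
  obtains F H where "u \<in> L2 \<nu>" "\<And>k. is_laplacian A g (F k) (H k)" "L2_tendsto \<nu> F u"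
    "L2_tendsto \<nu> (\<lambda>k x. - H k x) (\<lambda>x. l * u x)"
  using assms unfolding eigenspace_def laplace_graph_def by blast

lemma eigenspaceI:
  assumes "u \<in> L2 \<nu>" "\<And>k. is_laplacian A g (F k) (H k)" "L2_tendsto \<nu> F u"
    "L2_tendsto \<nu> (\<lambda>k x. - H k x) (\<lambda>x. l * u x)"
  shows "u \<in> eigenspace A g \<nu> l"
  using assms L2_cmult[OF assms(1)] unfolding eigenspace_def laplace_graph_def by blast

text \<open>Closedness holds because \<open>L\<close> is a closure: approximations by smooth functions of the members of
  a convergent sequence can be chosen diagonally.\<close>

lemma eigenspace_closed: "closed_L2_subspace \<nu> (eigenspace A g \<nu> l)"
  unfolding closed_L2_subspace_def
proof (intro conjI ballI allI impI)
  show "eigenspace A g \<nu> l \<subseteq> L2 \<nu>" by (auto elim: eigenspaceD)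
  show "(\<lambda>x. 0) \<in> eigenspace A g \<nu> l"
    by (rule eigenspaceI[where F = "\<lambda>k x. 0" and H = "\<lambda>k x. 0"])
       (auto simp: L2_zero laplacian_zero L2_tendsto_def L2_norm_def)
next
  fix u v a b assume "u \<in> eigenspace A g \<nu> l" and v: "v \<in> eigenspace A g \<nu> l"
  from this(1) obtain F H where u: "u \<in> L2 \<nu>" "\<And>k. is_laplacian A g (F k) (H k)"
    "L2_tendsto \<nu> F u" "L2_tendsto \<nu> (\<lambda>k x. - H k x) (\<lambda>x. l * u x)"
    by (rule eigenspaceD) (rule that)
  from v obtain F' H' where v: "v \<in> L2 \<nu>" "\<And>k. is_laplacian A g (F' k) (H' k)"
    "L2_tendsto \<nu> F' v" "L2_tendsto \<nu> (\<lambda>k x. - H' k x) (\<lambda>x. l * v x)"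
    by (rule eigenspaceD) (rule that)
  show "(\<lambda>x. a * u x + b * v x) \<in> eigenspace A g \<nu> l"
  proof (rule eigenspaceI)
    show "is_laplacian A g (\<lambda>x. a * F k x + b * F' k x) (\<lambda>x. a * H k x + b * H' k x)" for k
      by (rule laplacian_lincomb[OF u(2) v(2)])
    show "L2_tendsto \<nu> (\<lambda>k x. a * F k x + b * F' k x) (\<lambda>x. a * u x + b * v x)"
      by (intro L2_tendsto_lincomb laplacian_L2(1)[OF u(2)] laplacian_L2(1)[OF v(2)] u v)
    have "L2_tendsto \<nu> (\<lambda>k x. a * - H k x + b * - H' k x) (\<lambda>x. a * (l * u x) + b * (l * v x))"
      by (intro L2_tendsto_lincomb laplacian_L2(3)[OF u(2)] laplacian_L2(3)[OF v(2)] u v L2_cmult)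
    then show "L2_tendsto \<nu> (\<lambda>k x. - (a * H k x + b * H' k x)) (\<lambda>x. l * (a * u x + b * v x))"
      by (simp add: algebra_simps)
  qed (rule L2_lincomb[OF u(1) v(1)])
next
  fix W f assume W: "\<forall>k. W k \<in> eigenspace A g \<nu> l" and f: "f \<in> L2 \<nu>" "L2_tendsto \<nu> W f"
  have WL: "W k \<in> L2 \<nu>" for k using W eigenspaceD by blast
  have "\<exists>F H. is_laplacian A g F H \<and> L2_norm \<nu> (\<lambda>x. F x - W k x) < 1 / real (Suc k) \<and>
      L2_norm \<nu> (\<lambda>x. - H x - l * W k x) < 1 / real (Suc k)" for k
  proof -
    obtain F H where w: "\<And>i. is_laplacian A g (F i) (H i)" "L2_tendsto \<nu> F (W k)"
      "L2_tendsto \<nu> (\<lambda>i x. - H i x) (\<lambda>x. l * W k x)"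
      using W eigenspaceD by metis
    have e: "0 < 1 / real (Suc k)" by simp
    have "\<forall>\<^sub>F i in sequentially. L2_norm \<nu> (\<lambda>x. F i x - W k x) < 1 / real (Suc k) \<and>
        L2_norm \<nu> (\<lambda>x. - H i x - l * W k x) < 1 / real (Suc k)"
      using order_tendstoD(2)[OF w(2)[unfolded L2_tendsto_def] e]
        order_tendstoD(2)[OF w(3)[unfolded L2_tendsto_def] e]
      by eventually_elim simp
    then show ?thesis using w(1) eventually_happens'[OF sequentially_bot] by blast
  qed
  then obtain F where "\<forall>k. \<exists>H. is_laplacian A g (F k) H \<and>
      L2_norm \<nu> (\<lambda>x. F k x - W k x) < 1 / real (Suc k) \<and>
      L2_norm \<nu> (\<lambda>x. - H x - l * W k x) < 1 / real (Suc k)"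
    by (rule choice[OF allI, THEN exE])
  then obtain H where "\<forall>k. is_laplacian A g (F k) (H k) \<and>
      L2_norm \<nu> (\<lambda>x. F k x - W k x) < 1 / real (Suc k) \<and>
      L2_norm \<nu> (\<lambda>x. - H k x - l * W k x) < 1 / real (Suc k)"
    by (rule choice[THEN exE])
  then have FH: "is_laplacian A g (F k) (H k)"
    "L2_norm \<nu> (\<lambda>x. F k x - W k x) < 1 / real (Suc k)"
    "L2_norm \<nu> (\<lambda>x. - H k x - l * W k x) < 1 / real (Suc k)" for k by (simp_all only: simp_thms)
  have lim: "(\<lambda>k. 1 / real (Suc k) + c * L2_norm \<nu> (\<lambda>x. W k x - f x)) \<longlonglongrightarrow> 0" for c
  proof -
    have "(\<lambda>k. 1 / real (Suc k) + c * L2_norm \<nu> (\<lambda>x. W k x - f x)) \<longlonglongrightarrow> 0 + c * 0"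
      by (intro tendsto_intros LIMSEQ_Suc[OF lim_1_over_n] f(2)[unfolded L2_tendsto_def])
    then show ?thesis by simp
  qed
  show "f \<in> eigenspace A g \<nu> l"
  proof (rule eigenspaceI[OF f(1) FH(1)])
    show "L2_tendsto \<nu> F f"
      unfolding L2_tendsto_def
    proof (rule tendsto_sandwich[OF _ _ tendsto_const lim[of 1]])
      have "L2_norm \<nu> (\<lambda>x. F k x - f x) \<le> 1 / real (Suc k) + 1 * L2_norm \<nu> (\<lambda>x. W k x - f x)" for k
        using L2_norm_triangle[OF laplacian_L2(1)[OF FH(1)[of k]] WL[of k] f(1)] FH(2)[of k]
        by linarith
      then show "\<forall>\<^sub>F k in sequentially. L2_norm \<nu> (\<lambda>x. F k x - f x)
          \<le> 1 / real (Suc k) + 1 * L2_norm \<nu> (\<lambda>x. W k x - f x)" by (intro always_eventually allI)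
    qed simp
    show "L2_tendsto \<nu> (\<lambda>k x. - H k x) (\<lambda>x. l * f x)"
      unfolding L2_tendsto_def
    proof (rule tendsto_sandwich[OF _ _ tendsto_const lim[of "\<bar>l\<bar>"]])
      have "L2_norm \<nu> (\<lambda>x. - H k x - l * f x)
          \<le> 1 / real (Suc k) + \<bar>l\<bar> * L2_norm \<nu> (\<lambda>x. W k x - f x)" for k
      proof -
        have "L2_norm \<nu> (\<lambda>x. l * W k x - l * f x) = \<bar>l\<bar> * L2_norm \<nu> (\<lambda>x. W k x - f x)"
          using L2_norm_cmult[of \<nu> l "\<lambda>x. W k x - f x"] by (simp add: right_diff_distrib)
        then show ?thesis
          using L2_norm_triangle[OF laplacian_L2(3)[OF FH(1)[of k]] L2_cmult[OF WL[of k], of l]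
              L2_cmult[OF f(1), of l]] FH(3)[of k]
          by linarith
      qed
      then show "\<forall>\<^sub>F k in sequentially. L2_norm \<nu> (\<lambda>x. - H k x - l * f x)
          \<le> 1 / real (Suc k) + \<bar>l\<bar> * L2_norm \<nu> (\<lambda>x. W k x - f x)" by (intro always_eventually allI)
    qed simp
  qed
qed

text \<open>The symmetry of \<open>\<Delta>\<close> on smooth functions passes to the limit along approximations in the graph of
  \<open>L\<close> and gives \<open>l \<langle>u, v\<rangle> = l' \<langle>u, v\<rangle>\<close>.\<close>

lemma eigenspaces_orthogonal:
  assumes "u \<in> eigenspace A g \<nu> l" "v \<in> eigenspace A g \<nu> l'" "l \<noteq> l'"
  shows "L2_inner \<nu> u v = 0"
proof -
  from assms(1) obtain F H where u: "u \<in> L2 \<nu>" "\<And>k. is_laplacian A g (F k) (H k)"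
    "L2_tendsto \<nu> F u" "L2_tendsto \<nu> (\<lambda>k x. - H k x) (\<lambda>x. l * u x)"
    by (rule eigenspaceD) (rule that)
  from assms(2) obtain F' H' where v: "v \<in> L2 \<nu>" "\<And>k. is_laplacian A g (F' k) (H' k)"
    "L2_tendsto \<nu> F' v" "L2_tendsto \<nu> (\<lambda>k x. - H' k x) (\<lambda>x. l' * v x)"
    by (rule eigenspaceD) (rule that)
  have "(\<lambda>k. L2_inner \<nu> (\<lambda>x. - H k x) (F' k)) \<longlonglongrightarrow> L2_inner \<nu> (\<lambda>x. l * u x) v"
    by (intro L2_tendsto_inner laplacian_L2(3)[OF u(2)] laplacian_L2(1)[OF v(2)] L2_cmult u v)
  moreover have "(\<lambda>k. L2_inner \<nu> (F k) (\<lambda>x. - H' k x)) \<longlonglongrightarrow> L2_inner \<nu> u (\<lambda>x. l' * v x)"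
    by (intro L2_tendsto_inner laplacian_L2(3)[OF v(2)] laplacian_L2(1)[OF u(2)] L2_cmult u v)
  moreover have "L2_inner \<nu> (\<lambda>x. - H k x) (F' k) = L2_inner \<nu> (F k) (\<lambda>x. - H' k x)" for k
    using laplacian_symmetric[OF \<nu> u(2) v(2), of k k] by (simp add: L2_inner_def)
  ultimately have "L2_inner \<nu> (\<lambda>x. l * u x) v = L2_inner \<nu> u (\<lambda>x. l' * v x)"
    using LIMSEQ_unique by fastforce
  then have "l * L2_inner \<nu> u v = l' * L2_inner \<nu> u v"
    by (simp add: L2_inner_cmult L2_inner_commute[of \<nu> u])
  then show ?thesis using assms(3) by simp
qed

context
  fixes \<mu> :: "nat \<Rightarrow> real"
  assumes \<mu>: "inj \<mu>"
begin

lemma spectral_projector_L2: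
  assumes "f \<in> L2 \<nu>"
  shows "spectral_projector A g \<nu> \<mu> j f \<in> eigenspace A g \<nu> (\<mu> j)"
    and "spectral_projector A g \<nu> \<mu> j f \<in> L2 \<nu>"
  using orth_projection(1)[OF eigenspace_closed assms, of "\<mu> j"] eigenspace_closed[of "\<mu> j"]
  by (auto simp: spectral_projector_def closed_L2_subspace_def)

lemma spectral_projector_orthogonal:
  assumes "f \<in> L2 \<nu>" "i \<noteq> j"
  shows "L2_inner \<nu> (spectral_projector A g \<nu> \<mu> i f) (spectral_projector A g \<nu> \<mu> j f) = 0"
  using eigenspaces_orthogonal[OF spectral_projector_L2(1)[OF assms(1)]
      spectral_projector_L2(1)[OF assms(1)]] assms(2) injD[OF \<mu>] by blast

lemma spectral_projector_summable:
  assumes f: "f \<in> L2 \<nu>"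
  shows "summable (\<lambda>j. (L2_norm \<nu> (spectral_projector A g \<nu> \<mu> j f))\<^sup>2)"
proof (rule Bessel_summable[OF f spectral_projector_L2(2)[OF f] spectral_projector_orthogonal[OF f]])
  show "L2_inner \<nu> (\<lambda>x. f x - spectral_projector A g \<nu> \<mu> j f x) (spectral_projector A g \<nu> \<mu> j f) = 0"
    for j
    using orth_projection(2)[OF eigenspace_closed f spectral_projector_L2(1)[OF f, of j]]
    by (simp add: spectral_projector_def)
qed

text \<open>For a bounded multiplier Bessel's inequality makes the defining series converge in \<open>L\<^sup>2\<close>, so the
  representative chosen in the definition is indeed a limit of the partial sums.\<close>

lemma spectral_multiplier_norm:
  assumes f: "f \<in> L2 \<nu>" and m: "\<And>j. \<bar>m (\<mu> j)\<bar> \<le> B"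
  shows "(\<lambda>j. (m (\<mu> j))\<^sup>2 * (L2_norm \<nu> (spectral_projector A g \<nu> \<mu> j f))\<^sup>2)
    sums (L2_norm \<nu> (spectral_multiplier A g \<nu> \<mu> m f))\<^sup>2"
proof -
  let ?p = "\<lambda>j. spectral_projector A g \<nu> \<mu> j f"
  note p = spectral_projector_L2(2)[OF f] and orth = spectral_projector_orthogonal[OF f]
  have "summable (\<lambda>j. (m (\<mu> j))\<^sup>2 * (L2_norm \<nu> (?p j))\<^sup>2)"
  proof (rule summable_comparison_test'[OF summable_mult[OF spectral_projector_summable[OF f], of "B\<^sup>2"]])
    fix j
    have "(m (\<mu> j))\<^sup>2 \<le> B\<^sup>2" using m[of j] by (metis abs_ge_zero power2_abs power_mono)
    then show "norm ((m (\<mu> j))\<^sup>2 * (L2_norm \<nu> (?p j))\<^sup>2) \<le> B\<^sup>2 * (L2_norm \<nu> (?p j))\<^sup>2"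
      by (simp add: mult_right_mono)
  qed
  then have "\<exists>h. h \<in> L2 \<nu> \<and> L2_tendsto \<nu> (\<lambda>N x. \<Sum>j<N. m (\<mu> j) * ?p j x) h"
    using L2_orthogonal_series[of ?p \<nu> "\<lambda>j. m (\<mu> j)", OF p orth] by blast
  from someI_ex[OF this]
  have "spectral_multiplier A g \<nu> \<mu> m f \<in> L2 \<nu>"
    "L2_tendsto \<nu> (\<lambda>N x. \<Sum>j<N. m (\<mu> j) * ?p j x) (spectral_multiplier A g \<nu> \<mu> m f)"
    unfolding spectral_multiplier_def by blast+
  from L2_norm_sq_orthogonal_series[of ?p \<nu>, OF p orth this] show ?thesis .
qed

end

end

end

section \<open>Dyadic decompositions of weighted sequences\<close>

text \<open>The multiplier of \<open>Q\<^sub>n\<close> as a function of \<open>t = (1 + \<lambda>)\<^sup>1\<^sup>/\<^sup>2\<close>, where \<open>\<lambda>\<close> is the spectral variable.\<close>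

definition dyadic_block :: "(real \<Rightarrow> real) \<Rightarrow> (real \<Rightarrow> real) \<Rightarrow> nat \<Rightarrow> real \<Rightarrow> real" where
  "dyadic_block \<psi>0 \<psi> n t = (if n = 0 then \<psi>0 t else \<psi> (t / 2 ^ n))"

lemma dyadic_block_sums:
  assumes "dyadic_partition \<psi>0 \<psi>" "t \<ge> 0"
  shows "(\<lambda>n. dyadic_block \<psi>0 \<psi> n t) sums 1"
proof -
  have "(\<lambda>n. dyadic_block \<psi>0 \<psi> (Suc n) t) sums (1 - dyadic_block \<psi>0 \<psi> 0 t)"
    using assms by (simp add: dyadic_partition_def dyadic_block_def)
  then show ?thesis
    using sums_Suc_iff[of "\<lambda>n. dyadic_block \<psi>0 \<psi> n t" "1 - dyadic_block \<psi>0 \<psi> 0 t"] by simp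
qed

lemma smooth_on_continuous: "smooth_on S f \<Longrightarrow> continuous_on S f"
  unfolding smooth_on_def by (metis Ck_on.simps(1))

lemma dyadic_block_bounded:
  assumes "dyadic_partition \<psi>0 \<psi>"
  obtains B where "B \<ge> 0" "\<And>n t. t \<ge> 0 \<Longrightarrow> \<bar>dyadic_block \<psi>0 \<psi> n t\<bar> \<le> B"
proof -
  obtain \<phi> R where \<phi>: "smooth_on UNIV \<phi>" "\<And>t. t \<ge> 0 \<Longrightarrow> \<phi> t = \<psi>0 t" "\<And>t. t > R \<Longrightarrow> \<psi>0 t = 0"
    using assms by (auto simp: dyadic_partition_def)
  obtain a b where \<psi>: "smooth_on UNIV \<psi>" "\<And>t. t \<notin> {a..b} \<Longrightarrow> \<psi> t = 0"
    using assms by (auto simp: dyadic_partition_def)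
  have "bounded (\<phi> ` {0..R})" "bounded (\<psi> ` {a..b})"
    using \<phi>(1) \<psi>(1) smooth_on_continuous
    by (meson compact_Icc compact_continuous_image compact_imp_bounded continuous_on_subset subset_UNIV)+
  then obtain B1 B2 where B1: "\<And>t. t \<in> {0..R} \<Longrightarrow> \<bar>\<phi> t\<bar> \<le> B1"
    and B2: "\<And>t. t \<in> {a..b} \<Longrightarrow> \<bar>\<psi> t\<bar> \<le> B2"
    unfolding bounded_iff by (metis imageI real_norm_def)
  define B where "B = max 0 (max B1 B2)"
  have B: "0 \<le> B" "B1 \<le> B" "B2 \<le> B" unfolding B_def by auto
  have "\<bar>\<psi> t\<bar> \<le> B" for t
    using B2[of t] \<psi>(2)[of t] B by (cases "t \<in> {a..b}") (auto intro: order_trans)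
  moreover have "\<bar>\<psi>0 t\<bar> \<le> B" if "t \<ge> 0" for t
    using B1[of t] \<phi>(2)[OF that] \<phi>(3)[of t] B that by (cases "t \<le> R") (auto intro: order_trans)
  ultimately show ?thesis
    using that[OF B(1)] by (simp add: dyadic_block_def)
qed

text \<open>The \<open>n\<close>-th block with \<open>n \<ge> 1\<close> lives on \<open>2\<^sup>n a \<le> t \<le> 2\<^sup>n b\<close>, and the block \<open>n = 0\<close> on a bounded set.
  The latter contains \<open>t = 0\<close>, near which \<open>t\<^sup>s\<close> and \<open>1\<close> are not comparable if \<open>s > 0\<close>; hence the
  restriction to \<open>t \<ge> 1\<close>.\<close>

lemma dyadic_block_weights_comparable:
  assumes "dyadic_partition \<psi>0 \<psi>" "s \<ge> 0"
  obtains C where "C > 0"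
    "\<And>n t. t \<ge> 1 \<Longrightarrow> dyadic_block \<psi>0 \<psi> n t \<noteq> 0 \<Longrightarrow> 2 powr (real n * s) \<le> C * t powr s"
    "\<And>n t. t \<ge> 1 \<Longrightarrow> dyadic_block \<psi>0 \<psi> n t \<noteq> 0 \<Longrightarrow> t powr s \<le> C * 2 powr (real n * s)"
proof -
  obtain R where R: "\<And>t. t > R \<Longrightarrow> \<psi>0 t = 0"
    using assms by (auto simp: dyadic_partition_def)
  obtain a b where ab: "a > 0" "\<And>t. t \<notin> {a..b} \<Longrightarrow> \<psi> t = 0"
    using assms by (auto simp: dyadic_partition_def)
  define c where "c = max (max 1 R) (max (1 / a) b)"
  have c: "c \<ge> 1" "c \<ge> R" "c \<ge> 1 / a" "c \<ge> b" unfolding c_def by auto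
  have key: "2 ^ n \<le> c * t \<and> t \<le> c * 2 ^ n" if "t \<ge> 1" "dyadic_block \<psi>0 \<psi> n t \<noteq> 0" for n t
  proof (cases "n = 0")
    case True
    then have "t \<le> c" using R[of t] that c by (force simp: dyadic_block_def)
    moreover have "1 * 1 \<le> c * t" using c that by (intro mult_mono) auto
    ultimately show ?thesis using True by simp
  next
    case False
    then have "t / 2 ^ n \<in> {a..b}" using ab(2) that by (auto simp: dyadic_block_def)
    then have n: "a * 2 ^ n \<le> t" "t \<le> b * 2 ^ n" by (auto simp: field_simps)
    have "2 ^ n \<le> (1 / a) * t" using n(1) ab(1) by (simp add: field_simps)
    also have "\<dots> \<le> c * t" using c that by (intro mult_right_mono) auto
    finally have "2 ^ n \<le> c * t" .
    moreover have "b * 2 ^ n \<le> c * 2 ^ n" using c by (intro mult_right_mono) auto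
    ultimately show ?thesis using n by linarith
  qed
  have p: "2 powr (real n * s) = (2 ^ n) powr s" for n
    by (simp add: powr_powr[symmetric] powr_realpow)
  show ?thesis
  proof (rule that[of "c powr s"])
    show "0 < c powr s" using c by simp
    fix n t assume nt: "1 \<le> t" "dyadic_block \<psi>0 \<psi> n t \<noteq> 0"
    show "2 powr (real n * s) \<le> c powr s * t powr s" "t powr s \<le> c powr s * 2 powr (real n * s)"
      using key[OF nt] nt c assms(2) unfolding p
      by (auto simp: powr_mult[symmetric] intro!: powr_mono2)
  qed
qed

text \<open>A block \<open>n \<ge> 1\<close> that does not vanish at \<open>t\<close> satisfies \<open>t / b \<le> 2\<^sup>n \<le> t / a\<close>, which leaves at
  most \<open>log\<^sub>2 (b / a) + 1\<close> consecutive values of \<open>n\<close>, whatever \<open>t\<close> is.\<close>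

lemma dyadic_block_overlap:
  assumes "dyadic_partition \<psi>0 \<psi>"
  obtains K :: nat where "K > 0"
    "\<And>t. \<exists>I. finite I \<and> card I \<le> K \<and> (\<forall>n. dyadic_block \<psi>0 \<psi> n t \<noteq> 0 \<longrightarrow> n \<in> I)"
proof -
  obtain a b where ab: "a > 0" "\<And>t. t \<notin> {a..b} \<Longrightarrow> \<psi> t = 0"
    using assms by (auto simp: dyadic_partition_def)
  obtain k :: nat where k: "b / a < 2 ^ k" using real_arch_pow[of 2 "b / a"] by auto
  show ?thesis
  proof (rule that[of "Suc k"])
    fix t :: real
    define S where "S = {n. a * 2 ^ n \<le> t \<and> t \<le> b * 2 ^ n}"
    have S: "n \<in> insert 0 S" if "dyadic_block \<psi>0 \<psi> n t \<noteq> 0" for n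
    proof (cases "n = 0")
      case False
      then have "t / 2 ^ n \<in> {a..b}" using ab(2) that by (auto simp: dyadic_block_def)
      then show ?thesis by (auto simp: S_def field_simps)
    qed simp
    define n0 where "n0 = (LEAST n. n \<in> S)"
    have "S \<subseteq> {n0..<n0 + k}"
    proof
      fix n assume n: "n \<in> S"
      have n0: "n0 \<in> S" "n0 \<le> n" using n unfolding n0_def by (auto intro: LeastI Least_le)
      have "2 ^ (n - n0) * (a * 2 ^ n0) = a * 2 ^ n"
        using n0(2) by (simp add: power_add[symmetric])
      also have "\<dots> \<le> t" using n by (simp add: S_def)
      also have "\<dots> \<le> b * 2 ^ n0" using n0 by (simp add: S_def)
      finally have "2 ^ (n - n0) * a \<le> b" by simp
      then have "2 ^ (n - n0) \<le> b / a" using ab(1) by (simp add: field_simps)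
      then have "2 ^ (n - n0) < (2::real) ^ k" using k by (rule le_less_trans)
      then have "n - n0 < k" by (rule power_less_imp_less_exp[rotated]) simp
      with n0(2) show "n \<in> {n0..<n0 + k}" by auto
    qed
    then have "\<forall>n. dyadic_block \<psi>0 \<psi> n t \<noteq> 0 \<longrightarrow> n \<in> insert 0 {n0..<n0 + k}"
      using S by blast
    moreover have "card (insert 0 {n0..<n0 + k}) \<le> Suc k"
      using card_insert_le_m1[of "Suc k" "{n0..<n0 + k}" 0] by simp
    ultimately show "\<exists>I. finite I \<and> card I \<le> Suc k \<and>
        (\<forall>n. dyadic_block \<psi>0 \<psi> n t \<noteq> 0 \<longrightarrow> n \<in> I)"
      by (intro exI[of _ "insert 0 {n0..<n0 + k}"]) auto
  qed simp
qed

text \<open>For the upper bounds, boundedly many bounded terms are summed whose weights are comparable to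
  \<open>t\<^sup>s\<close>; the square sum is at most the square of the sum. For the lower bound the Cauchy--Schwarz
  inequality is applied to the boundedly many nonzero terms of \<open>\<Sum>\<^sub>n dyadic_block n t = 1\<close>. That bound
  is stated for all long partial sums, so that it can be used for finitely many \<open>t\<close> at once.\<close>

lemma dyadic_block_square_function:
  assumes dp: "dyadic_partition \<psi>0 \<psi>" and s: "s \<ge> 0"
  obtains C where "C > 0"
    "\<And>t N. t \<ge> 1 \<Longrightarrow> (\<Sum>n<N. 2 powr (real n * s) * \<bar>dyadic_block \<psi>0 \<psi> n t\<bar>) \<le> C * t powr s"
    "\<And>t N. t \<ge> 1 \<Longrightarrow>
        (\<Sum>n<N. (2 powr (real n * s) * dyadic_block \<psi>0 \<psi> n t)\<^sup>2) \<le> C\<^sup>2 * (t powr s)\<^sup>2"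
    "\<And>t. t \<ge> 1 \<Longrightarrow> \<exists>N0. \<forall>N\<ge>N0.
        (t powr s)\<^sup>2 \<le> C\<^sup>2 * (\<Sum>n<N. (2 powr (real n * s) * dyadic_block \<psi>0 \<psi> n t)\<^sup>2)"
proof -
  let ?m = "dyadic_block \<psi>0 \<psi>" and ?w = "\<lambda>n. 2 powr (real n * s)"
  obtain B where B: "B \<ge> 0" "\<And>n t. t \<ge> 0 \<Longrightarrow> \<bar>?m n t\<bar> \<le> B"
    by (rule dyadic_block_bounded[OF dp]) (rule that)
  obtain D where D: "D > 0" "\<And>n t. t \<ge> 1 \<Longrightarrow> ?m n t \<noteq> 0 \<Longrightarrow> ?w n \<le> D * t powr s"
    "\<And>n t. t \<ge> 1 \<Longrightarrow> ?m n t \<noteq> 0 \<Longrightarrow> t powr s \<le> D * ?w n"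
    by (rule dyadic_block_weights_comparable[OF dp s]) (rule that)
  obtain K :: nat where K: "K > 0"
    "\<And>t. \<exists>I. finite I \<and> card I \<le> K \<and> (\<forall>n. ?m n t \<noteq> 0 \<longrightarrow> n \<in> I)"
    by (rule dyadic_block_overlap[OF dp]) (rule that)
  define C where "C = real K * (D * B + D)"
  have K1: "real K \<ge> 1" using K(1) by simp
  have DB: "0 \<le> D * B" using D(1) B(1) by simp
  have "C > 0" unfolding C_def using K(1) D(1) DB by simp
  have up: "(\<Sum>n<N. ?w n * \<bar>?m n t\<bar>) \<le> C * t powr s" if t: "t \<ge> 1" for t N
  proof -
    obtain I where I: "finite I" "card I \<le> K" "\<And>n. ?m n t \<noteq> 0 \<Longrightarrow> n \<in> I" using K(2)[of t] by blast
    have "(\<Sum>n<N. ?w n * \<bar>?m n t\<bar>) = (\<Sum>n\<in>{..<N} \<inter> I. ?w n * \<bar>?m n t\<bar>)"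
      by (rule sum.mono_neutral_right) (use I in auto)
    also have "\<dots> \<le> (\<Sum>n\<in>{..<N} \<inter> I. D * B * t powr s)"
    proof (rule sum_mono)
      fix n
      show "?w n * \<bar>?m n t\<bar> \<le> D * B * t powr s"
      proof (cases "?m n t = 0")
        case False
        have "?w n * \<bar>?m n t\<bar> \<le> (D * t powr s) * B"
          using D(2)[OF t False] B t D(1) by (intro mult_mono) auto
        then show ?thesis by (simp add: mult_ac)
      qed (use DB in simp)
    qed
    also have "\<dots> = real (card ({..<N} \<inter> I)) * (D * B * t powr s)" by simp
    also have "\<dots> \<le> real K * (D * B * t powr s)"
    proof (rule mult_right_mono)
      have "card ({..<N} \<inter> I) \<le> card I" using I by (intro card_mono) auto
      then show "real (card ({..<N} \<inter> I)) \<le> real K" using I by simp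
    qed (use DB in simp)
    also have "\<dots> \<le> C * t powr s"
      unfolding C_def using D(1) by (simp add: algebra_simps)
    finally show ?thesis .
  qed
  show ?thesis
  proof (rule that[OF \<open>C > 0\<close> up])
    fix t :: real and N assume t: "t \<ge> 1"
    have "(\<Sum>n<N. (?w n * ?m n t)\<^sup>2) = (\<Sum>n<N. (?w n * \<bar>?m n t\<bar>)\<^sup>2)"
      by (simp add: power_mult_distrib)
    also have "\<dots> = (L2_set (\<lambda>n. ?w n * \<bar>?m n t\<bar>) {..<N})\<^sup>2"
      by (simp add: L2_set_def sum_nonneg)
    also have "\<dots> \<le> (\<Sum>n<N. ?w n * \<bar>?m n t\<bar>)\<^sup>2"
      by (intro power_mono L2_set_le_sum L2_set_nonneg) auto
    also have "\<dots> \<le> (C * t powr s)\<^sup>2"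
      using up[OF t] by (intro power_mono sum_nonneg) auto
    finally show "(\<Sum>n<N. (?w n * ?m n t)\<^sup>2) \<le> C\<^sup>2 * (t powr s)\<^sup>2"
      by (simp add: power_mult_distrib)
  next
    fix t :: real assume t: "t \<ge> 1"
    obtain I where I: "finite I" "card I \<le> K" "\<And>n. ?m n t \<noteq> 0 \<Longrightarrow> n \<in> I" using K(2)[of t] by blast
    obtain N0 where N0: "I \<subseteq> {..<N0}" using I(1) finite_nat_iff_bounded by blast
    have "(t powr s)\<^sup>2 \<le> C\<^sup>2 * (\<Sum>n<N. (?w n * ?m n t)\<^sup>2)" if "N \<ge> N0" for N
    proof -
      have "(\<lambda>n. ?m n t) sums (\<Sum>n\<in>I. ?m n t)" by (rule sums_finite) (use I in auto)
      then have one: "(\<Sum>n\<in>I. ?m n t) = 1"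
        using dyadic_block_sums[OF dp, of t] t sums_unique2 by auto
      have "(\<Sum>n\<in>I. ?m n t)\<^sup>2 \<le> (\<Sum>n\<in>I. (?m n t)\<^sup>2) * real (card I)"
        using sum_squared_le_sum_of_squares[of "\<lambda>n. ?m n t" I] I(1) by (simp add: mult.commute)
      also have "\<dots> \<le> (\<Sum>n\<in>I. (?m n t)\<^sup>2) * real K"
        using I by (intro mult_left_mono sum_nonneg) auto
      finally have 1: "1 \<le> (\<Sum>n\<in>I. (?m n t)\<^sup>2) * real K" using one by simp
      have "(t powr s)\<^sup>2 * 1 \<le> (t powr s)\<^sup>2 * ((\<Sum>n\<in>I. (?m n t)\<^sup>2) * real K)"
        using 1 by (intro mult_left_mono) auto
      also have "\<dots> = real K * (\<Sum>n\<in>I. (t powr s * \<bar>?m n t\<bar>)\<^sup>2)"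
        by (simp add: sum_distrib_left power_mult_distrib mult_ac)
      also have "\<dots> \<le> real K * (\<Sum>n\<in>I. (D * ?w n * \<bar>?m n t\<bar>)\<^sup>2)"
      proof (intro mult_left_mono sum_mono power_mono)
        fix n
        show "t powr s * \<bar>?m n t\<bar> \<le> D * ?w n * \<bar>?m n t\<bar>"
          using D(3)[OF t, of n] by (cases "?m n t = 0") (auto intro: mult_right_mono)
      qed auto
      also have "\<dots> = (real K * D\<^sup>2) * (\<Sum>n\<in>I. (?w n * ?m n t)\<^sup>2)"
        by (simp add: sum_distrib_left power_mult_distrib mult_ac)
      also have "\<dots> \<le> C\<^sup>2 * (\<Sum>n\<in>I. (?w n * ?m n t)\<^sup>2)"
      proof (intro mult_right_mono sum_nonneg)
        have "real K * D\<^sup>2 \<le> (real K)\<^sup>2 * D\<^sup>2"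
          using K1 by (intro mult_right_mono) (auto simp: power2_eq_square)
        also have "\<dots> = (real K * D)\<^sup>2" by (simp add: power_mult_distrib)
        also have "\<dots> \<le> C\<^sup>2"
          unfolding C_def using D(1) DB by (intro power_mono mult_left_mono) auto
        finally show "real K * D\<^sup>2 \<le> C\<^sup>2" .
      qed auto
      also have "\<dots> \<le> C\<^sup>2 * (\<Sum>n<N. (?w n * ?m n t)\<^sup>2)"
        using N0 that by (intro mult_left_mono sum_mono2) auto
      finally show ?thesis by simp
    qed
    then show "\<exists>N0. \<forall>N\<ge>N0. (t powr s)\<^sup>2 \<le> C\<^sup>2 * (\<Sum>n<N. (?w n * ?m n t)\<^sup>2)" by blast
  qed
qed

lemma summable_square:
  fixes x :: "nat \<Rightarrow> real"
  assumes "\<And>n. 0 \<le> x n" "summable x"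
  shows "summable (\<lambda>n. (x n)\<^sup>2)" "(\<Sum>n. (x n)\<^sup>2) \<le> (\<Sum>n. x n)\<^sup>2"
proof -
  have b: "(\<Sum>n<N. (x n)\<^sup>2) \<le> (\<Sum>n. x n)\<^sup>2" for N
  proof -
    have "(\<Sum>n<N. (x n)\<^sup>2) = (L2_set x {..<N})\<^sup>2"
      by (simp add: L2_set_def sum_nonneg)
    also have "\<dots> \<le> (\<Sum>n<N. x n)\<^sup>2"
      by (intro power_mono L2_set_le_sum L2_set_nonneg assms)
    also have "\<dots> \<le> (\<Sum>n. x n)\<^sup>2"
      by (intro power_mono sum_le_suminf sum_nonneg assms) auto
    finally show ?thesis .
  qed
  show s: "summable (\<lambda>n. (x n)\<^sup>2)"
    by (rule bounded_imp_summable[of _ "(\<Sum>n. x n)\<^sup>2"])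
       (use b in \<open>auto simp flip: lessThan_Suc_atMost simp del: sum.lessThan_Suc\<close>)
  show "(\<Sum>n. (x n)\<^sup>2) \<le> (\<Sum>n. x n)\<^sup>2"
    by (rule suminf_le_const[OF s b])
qed

text \<open>In this lemma and the next two \<open>a j\<close> stands for the norm of the \<open>j\<close>-th spectral component,
  \<open>T j\<close> for its Sobolev weight, \<open>m n j\<close> for the multiplier of the \<open>n\<close>-th block and \<open>q n\<close> for
  the norm of that block. The two sums over \<open>j\<close> and \<open>n\<close> are exchanged on finite sections.\<close>

lemma block_sum_le_l1:
  fixes a T :: "nat \<Rightarrow> real" and m :: "nat \<Rightarrow> nat \<Rightarrow> real"
  assumes q: "\<And>n. (\<lambda>j. (m n j)\<^sup>2 * (a j)\<^sup>2) sums (q n)\<^sup>2" and q0: "\<And>n. 0 \<le> q n"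
    and a0: "\<And>j. 0 \<le> a j" and w: "\<And>n. 0 < w n"
    and up: "\<And>N j. (\<Sum>n<N. w n * \<bar>m n j\<bar>) \<le> C * T j"
    and sm: "summable (\<lambda>j. T j * a j)"
  shows "summable (\<lambda>n. w n * q n)" "(\<Sum>n. w n * q n) \<le> C * (\<Sum>j. T j * a j)"
proof -
  have dom: "\<bar>m n j\<bar> * a j \<le> (C / w n) * (T j * a j)" for n j
  proof -
    have "w n * \<bar>m n j\<bar> \<le> (\<Sum>n<Suc n. w n * \<bar>m n j\<bar>)"
      using w by (simp add: sum_nonneg less_imp_le)
    also have "\<dots> \<le> C * T j" by (rule up)
    finally have "\<bar>m n j\<bar> \<le> (C / w n) * T j" using w[of n] by (simp add: field_simps)
    from mult_right_mono[OF this a0[of j]] show ?thesis by (simp add: mult.assoc)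
  qed
  have sm1: "summable (\<lambda>j. \<bar>m n j\<bar> * a j)" for n
    by (rule summable_comparison_test'[OF summable_mult[OF sm, of "C / w n"]])
       (use dom a0 in \<open>auto simp: abs_mult\<close>)
  have q1: "q n \<le> (\<Sum>j. \<bar>m n j\<bar> * a j)" for n
  proof (rule power2_le_imp_le)
    have "(q n)\<^sup>2 = (\<Sum>j. (\<bar>m n j\<bar> * a j)\<^sup>2)"
      using sums_unique[OF q[of n]] by (simp add: power_mult_distrib)
    also have "\<dots> \<le> (\<Sum>j. \<bar>m n j\<bar> * a j)\<^sup>2"
      by (rule summable_square(2)) (use a0 sm1 in auto)
    finally show "(q n)\<^sup>2 \<le> (\<Sum>j. \<bar>m n j\<bar> * a j)\<^sup>2" .
  qed (use a0 sm1 in \<open>auto intro!: suminf_nonneg\<close>)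
  have b: "(\<Sum>n<N. w n * q n) \<le> C * (\<Sum>j. T j * a j)" for N
  proof -
    have "(\<Sum>n<N. w n * q n) \<le> (\<Sum>n<N. w n * (\<Sum>j. \<bar>m n j\<bar> * a j))"
      using q1 w by (intro sum_mono mult_left_mono) (auto intro: less_imp_le)
    also have "\<dots> = (\<Sum>n<N. \<Sum>j. w n * (\<bar>m n j\<bar> * a j))"
      by (simp add: suminf_mult sm1)
    also have "\<dots> = (\<Sum>j. \<Sum>n<N. w n * (\<bar>m n j\<bar> * a j))"
      by (rule suminf_sum[symmetric]) (simp add: summable_mult sm1)
    also have "\<dots> \<le> (\<Sum>j. C * (T j * a j))"
    proof (rule suminf_le)
      fix j
      have "(\<Sum>n<N. w n * \<bar>m n j\<bar>) * a j \<le> (C * T j) * a j"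
        by (rule mult_right_mono[OF up a0])
      then show "(\<Sum>n<N. w n * (\<bar>m n j\<bar> * a j)) \<le> C * (T j * a j)"
        by (simp add: sum_distrib_right mult.assoc)
    qed (auto intro!: summable_sum summable_mult sm1 sm)
    also have "\<dots> = C * (\<Sum>j. T j * a j)" by (rule suminf_mult[OF sm])
    finally show ?thesis .
  qed
  show s: "summable (\<lambda>n. w n * q n)"
    by (rule bounded_imp_summable[of _ "C * (\<Sum>j. T j * a j)"])
       (use b w q0 in \<open>auto simp flip: lessThan_Suc_atMost simp del: sum.lessThan_Suc
          intro: mult_nonneg_nonneg less_imp_le\<close>)
  show "(\<Sum>n. w n * q n) \<le> C * (\<Sum>j. T j * a j)" by (rule suminf_le_const[OF s b])
qed

lemma block_square_sum_le:
  fixes a T :: "nat \<Rightarrow> real" and m :: "nat \<Rightarrow> nat \<Rightarrow> real"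
  assumes q: "\<And>n. (\<lambda>j. (m n j)\<^sup>2 * (a j)\<^sup>2) sums (q n)\<^sup>2"
    and up: "\<And>N j. (\<Sum>n<N. (w n * m n j)\<^sup>2) \<le> C * (T j)\<^sup>2"
    and sm: "summable (\<lambda>j. (T j)\<^sup>2 * (a j)\<^sup>2)"
  shows "summable (\<lambda>n. (w n * q n)\<^sup>2)" "(\<Sum>n. (w n * q n)\<^sup>2) \<le> C * (\<Sum>j. (T j)\<^sup>2 * (a j)\<^sup>2)"
proof -
  have b: "(\<Sum>n<N. (w n * q n)\<^sup>2) \<le> C * (\<Sum>j. (T j)\<^sup>2 * (a j)\<^sup>2)" for N
  proof -
    have "(\<lambda>j. \<Sum>n<N. (w n)\<^sup>2 * ((m n j)\<^sup>2 * (a j)\<^sup>2)) sums (\<Sum>n<N. (w n)\<^sup>2 * (q n)\<^sup>2)"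
      by (intro sums_sum sums_mult q)
    then have s: "(\<lambda>j. \<Sum>n<N. (w n)\<^sup>2 * ((m n j)\<^sup>2 * (a j)\<^sup>2)) sums (\<Sum>n<N. (w n * q n)\<^sup>2)"
      by (simp add: power_mult_distrib)
    have t: "(\<lambda>j. C * ((T j)\<^sup>2 * (a j)\<^sup>2)) sums (C * (\<Sum>j. (T j)\<^sup>2 * (a j)\<^sup>2))"
      by (intro sums_mult summable_sums sm)
    show ?thesis
    proof (rule sums_le[OF _ s t])
      fix j
      have "(\<Sum>n<N. (w n * m n j)\<^sup>2) * (a j)\<^sup>2 \<le> (C * (T j)\<^sup>2) * (a j)\<^sup>2"
        by (rule mult_right_mono[OF up]) simp
      then show "(\<Sum>n<N. (w n)\<^sup>2 * ((m n j)\<^sup>2 * (a j)\<^sup>2)) \<le> C * ((T j)\<^sup>2 * (a j)\<^sup>2)"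
        by (simp add: sum_distrib_right power_mult_distrib mult.assoc)
    qed
  qed
  show s: "summable (\<lambda>n. (w n * q n)\<^sup>2)"
    by (rule bounded_imp_summable[of _ "C * (\<Sum>j. (T j)\<^sup>2 * (a j)\<^sup>2)"])
       (use b in \<open>auto simp flip: lessThan_Suc_atMost simp del: sum.lessThan_Suc\<close>)
  show "(\<Sum>n. (w n * q n)\<^sup>2) \<le> C * (\<Sum>j. (T j)\<^sup>2 * (a j)\<^sup>2)" by (rule suminf_le_const[OF s b])
qed

lemma block_square_sum_ge:
  fixes a T :: "nat \<Rightarrow> real" and m :: "nat \<Rightarrow> nat \<Rightarrow> real"
  assumes q: "\<And>n. (\<lambda>j. (m n j)\<^sup>2 * (a j)\<^sup>2) sums (q n)\<^sup>2" and C: "C \<ge> 0"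
    and low: "\<And>j. \<exists>N0. \<forall>N\<ge>N0. (T j)\<^sup>2 \<le> C * (\<Sum>n<N. (w n * m n j)\<^sup>2)"
    and sm: "summable (\<lambda>n. (w n * q n)\<^sup>2)"
  shows "summable (\<lambda>j. (T j)\<^sup>2 * (a j)\<^sup>2)" "(\<Sum>j. (T j)\<^sup>2 * (a j)\<^sup>2) \<le> C * (\<Sum>n. (w n * q n)\<^sup>2)"
proof -
  obtain N0 where N0: "\<And>j N. N \<ge> N0 j \<Longrightarrow> (T j)\<^sup>2 \<le> C * (\<Sum>n<N. (w n * m n j)\<^sup>2)"
    using low by metis
  have b: "(\<Sum>j<J. (T j)\<^sup>2 * (a j)\<^sup>2) \<le> C * (\<Sum>n. (w n * q n)\<^sup>2)" for J
  proof -
    define N where "N = (\<Sum>j<J. N0 j)"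
    have N: "N0 j \<le> N" if "j < J" for j
      unfolding N_def using that by (intro member_le_sum) auto
    have "(\<Sum>j<J. (T j)\<^sup>2 * (a j)\<^sup>2) \<le> (\<Sum>j<J. (C * (\<Sum>n<N. (w n * m n j)\<^sup>2)) * (a j)\<^sup>2)"
      using N0 N by (intro sum_mono mult_right_mono) auto
    also have "\<dots> = C * (\<Sum>n<N. (w n)\<^sup>2 * (\<Sum>j<J. (m n j)\<^sup>2 * (a j)\<^sup>2))"
      unfolding sum_distrib_left sum_distrib_right
      by (subst sum.swap) (simp add: power_mult_distrib mult_ac)
    also have "\<dots> \<le> C * (\<Sum>n<N. (w n)\<^sup>2 * (q n)\<^sup>2)"
    proof (intro mult_left_mono sum_mono C)
      fix n
      show "(\<Sum>j<J. (m n j)\<^sup>2 * (a j)\<^sup>2) \<le> (q n)\<^sup>2"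
        using sum_le_suminf[OF sums_summable[OF q[of n]], of "{..<J}"] sums_unique[OF q[of n]]
        by simp
    qed auto
    also have "\<dots> = C * (\<Sum>n<N. (w n * q n)\<^sup>2)" by (simp add: power_mult_distrib)
    also have "\<dots> \<le> C * (\<Sum>n. (w n * q n)\<^sup>2)"
      by (intro mult_left_mono sum_le_suminf sm C) auto
    finally show ?thesis .
  qed
  show s: "summable (\<lambda>j. (T j)\<^sup>2 * (a j)\<^sup>2)"
    by (rule bounded_imp_summable[of _ "C * (\<Sum>n. (w n * q n)\<^sup>2)"])
       (use b in \<open>auto simp flip: lessThan_Suc_atMost simp del: sum.lessThan_Suc\<close>)
  show "(\<Sum>j. (T j)\<^sup>2 * (a j)\<^sup>2) \<le> C * (\<Sum>n. (w n * q n)\<^sup>2)" by (rule suminf_le_const[OF s b])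
qed

section \<open>Embeddings of spectral Barron, Besov and Sobolev spaces\<close>

lemma besov_norm_1:
  assumes "f \<in> besov_space A g \<nu> \<mu> \<psi>0 \<psi> s 1"
  shows "besov_norm A g \<nu> \<mu> \<psi>0 \<psi> s 1 f
       = (\<Sum>n. 2 powr (real n * s) * L2_norm \<nu> (LP_block A g \<nu> \<mu> \<psi>0 \<psi> n f))"
  using assms by (simp add: besov_norm_def besov_space_def suminf_nonneg)

lemma besov_norm_2:
  assumes "f \<in> besov_space A g \<nu> \<mu> \<psi>0 \<psi> s 2"
  shows "besov_norm A g \<nu> \<mu> \<psi>0 \<psi> s 2 f
       = sqrt (\<Sum>n. (2 powr (real n * s) * L2_norm \<nu> (LP_block A g \<nu> \<mu> \<psi>0 \<psi> n f))\<^sup>2)"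
  using assms by (simp add: besov_norm_def besov_space_def suminf_nonneg powr_half_sqrt)

lemma besov_1_embedded_besov_2:
  "continuously_embedded
     (besov_space A g \<nu> \<mu> \<psi>0 \<psi> s 1) (besov_norm A g \<nu> \<mu> \<psi>0 \<psi> s 1)
     (besov_space A g \<nu> \<mu> \<psi>0 \<psi> s 2) (besov_norm A g \<nu> \<mu> \<psi>0 \<psi> s 2)"
proof -
  have "f \<in> besov_space A g \<nu> \<mu> \<psi>0 \<psi> s 2 \<and>
      besov_norm A g \<nu> \<mu> \<psi>0 \<psi> s 2 f \<le> 1 * besov_norm A g \<nu> \<mu> \<psi>0 \<psi> s 1 f"
    if f: "f \<in> besov_space A g \<nu> \<mu> \<psi>0 \<psi> s 1" for f
  proof -
    let ?x = "\<lambda>n. 2 powr (real n * s) * L2_norm \<nu> (LP_block A g \<nu> \<mu> \<psi>0 \<psi> n f)"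
    have x: "\<And>n. 0 \<le> ?x n" "summable ?x" using f by (auto simp: besov_space_def)
    have f2: "f \<in> besov_space A g \<nu> \<mu> \<psi>0 \<psi> s 2"
      using f summable_square(1)[OF x] by (simp add: besov_space_def)
    have "sqrt (\<Sum>n. (?x n)\<^sup>2) \<le> (\<Sum>n. ?x n)"
      using summable_square(2)[OF x] suminf_nonneg[OF x(2,1)] by (intro real_le_lsqrt) auto
    with f2 show ?thesis by (simp only: besov_norm_1[OF f] besov_norm_2[OF f2] mult_1 simp_thms)
  qed
  then show ?thesis unfolding continuously_embedded_def by blast
qed

theorem proposition2p5:
  fixes A :: "('m::{t2_space,second_countable_topology}, 'n::finite) chart set"
    and g :: "('m, 'n) metric"
    and \<nu> :: "'m measure"
    and \<mu> :: "nat \<Rightarrow> real"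
    and \<psi>0 \<psi> :: "real \<Rightarrow> real"
    and s :: real
  assumes "closed_riemannian_manifold A g"
    and "normalized_volume A g \<nu>"
    and "eigenvalue_enumeration A g \<nu> \<mu>"
    and "dyadic_partition \<psi>0 \<psi>"
    and "s \<ge> 0"
  shows "continuously_embedded
           (V_space A g \<nu> \<mu> s) (V_norm A g \<nu> \<mu> s)
           (besov_space A g \<nu> \<mu> \<psi>0 \<psi> s 1) (besov_norm A g \<nu> \<mu> \<psi>0 \<psi> s 1)
       \<and> continuously_embedded
           (besov_space A g \<nu> \<mu> \<psi>0 \<psi> s 1) (besov_norm A g \<nu> \<mu> \<psi>0 \<psi> s 1)
           (besov_space A g \<nu> \<mu> \<psi>0 \<psi> s 2) (besov_norm A g \<nu> \<mu> \<psi>0 \<psi> s 2)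
       \<and> equal_equivalent_norms
           (besov_space A g \<nu> \<mu> \<psi>0 \<psi> s 2) (besov_norm A g \<nu> \<mu> \<psi>0 \<psi> s 2)
           (H_space A g \<nu> \<mu> s) (H_norm A g \<nu> \<mu> s)"
proof -
  interpret closed_manifold A g by (rule closed_manifold.intro[OF assms(1)])
  have sm: "strict_mono \<mu>" and \<mu>0: "\<mu> 0 = 0"
    using assms(3) by (auto simp: eigenvalue_enumeration_def)
  have inj: "inj \<mu>" using sm by (rule strict_mono_imp_inj_on)
  have \<mu>_nonneg: "0 \<le> \<mu> j" for j
    using strict_mono_leD[OF sm, of 0 j] \<mu>0 by simp
  define t where "t j = sqrt (1 + \<mu> j)" for j
  have t: "t j \<ge> 1" for j using \<mu>_nonneg by (simp add: t_def)
  define T where "T j = t j powr s" for j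
  have T1: "(1 + \<mu> j) powr (s / 2) = T j" for j
    using \<mu>_nonneg[of j] by (simp add: T_def t_def powr_half_sqrt[symmetric] powr_powr)
  have T2: "(1 + \<mu> j) powr s = (T j)\<^sup>2" for j
    unfolding T1[symmetric] using \<mu>_nonneg[of j] by (simp add: power2_eq_square powr_add[symmetric])
  define w where "w n = 2 powr (real n * s)" for n
  have w: "0 < w n" for n by (simp add: w_def)
  define m where "m n j = dyadic_block \<psi>0 \<psi> n (t j)" for n j
  define a where "a f j = L2_norm \<nu> (spectral_projector A g \<nu> \<mu> j f)" for f j
  define q where "q f n = L2_norm \<nu> (LP_block A g \<nu> \<mu> \<psi>0 \<psi> n f)" for f n
  obtain B where B: "\<And>n t. t \<ge> 0 \<Longrightarrow> \<bar>dyadic_block \<psi>0 \<psi> n t\<bar> \<le> B"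
    by (rule dyadic_block_bounded[OF assms(4)]) (rule that)
  have q: "(\<lambda>j. (m n j)\<^sup>2 * (a f j)\<^sup>2) sums (q f n)\<^sup>2" if "f \<in> L2 \<nu>" for f n
  proof -
    have "LP_block A g \<nu> \<mu> \<psi>0 \<psi> n
        = spectral_multiplier A g \<nu> \<mu> (\<lambda>l. dyadic_block \<psi>0 \<psi> n (sqrt (1 + l)))"
      by (simp add: LP_block_def dyadic_block_def)
    moreover have "\<bar>dyadic_block \<psi>0 \<psi> n (sqrt (1 + \<mu> j))\<bar> \<le> B" for j
      using \<mu>_nonneg by (intro B) simp
    ultimately show ?thesis
      using spectral_multiplier_norm[OF assms(2) inj that,
          of "\<lambda>l. dyadic_block \<psi>0 \<psi> n (sqrt (1 + l))" B]
      by (simp add: m_def a_def q_def t_def)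
  qed
  obtain C where C: "C > 0" "\<And>j N. (\<Sum>n<N. w n * \<bar>m n j\<bar>) \<le> C * T j"
    "\<And>j N. (\<Sum>n<N. (w n * m n j)\<^sup>2) \<le> C\<^sup>2 * (T j)\<^sup>2"
    "\<And>j. \<exists>N0. \<forall>N\<ge>N0. (T j)\<^sup>2 \<le> C\<^sup>2 * (\<Sum>n<N. (w n * m n j)\<^sup>2)"
    by (rule dyadic_block_square_function[OF assms(4,5)])
       (rule that, unfold w_def m_def T_def, (use t in blast)+)
  have a0: "0 \<le> a f j" and q0: "0 \<le> q f n" for f j n by (simp_all add: a_def q_def)
  have V: "f \<in> V_space A g \<nu> \<mu> s \<longleftrightarrow> f \<in> L2 \<nu> \<and> summable (\<lambda>j. T j * a f j)"
    "V_norm A g \<nu> \<mu> s f = (\<Sum>j. T j * a f j)" for f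
    by (simp_all add: V_space_def V_norm_def T1 a_def)
  have H: "f \<in> H_space A g \<nu> \<mu> s \<longleftrightarrow> f \<in> L2 \<nu> \<and> summable (\<lambda>j. (T j)\<^sup>2 * (a f j)\<^sup>2)"
    "H_norm A g \<nu> \<mu> s f = sqrt (\<Sum>j. (T j)\<^sup>2 * (a f j)\<^sup>2)" for f
    by (simp_all add: H_space_def H_norm_def T2 a_def)
  have B1: "f \<in> besov_space A g \<nu> \<mu> \<psi>0 \<psi> s 1 \<longleftrightarrow> f \<in> L2 \<nu> \<and> summable (\<lambda>n. w n * q f n)"
    and B2: "f \<in> besov_space A g \<nu> \<mu> \<psi>0 \<psi> s 2 \<longleftrightarrow> f \<in> L2 \<nu> \<and> summable (\<lambda>n. (w n * q f n)\<^sup>2)" for f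
    by (simp_all add: besov_space_def w_def q_def)
  have N1: "besov_norm A g \<nu> \<mu> \<psi>0 \<psi> s 1 f = (\<Sum>n. w n * q f n)"
    if "f \<in> besov_space A g \<nu> \<mu> \<psi>0 \<psi> s 1" for f
    using besov_norm_1[OF that] by (simp add: w_def q_def)
  have N2: "besov_norm A g \<nu> \<mu> \<psi>0 \<psi> s 2 f = sqrt (\<Sum>n. (w n * q f n)\<^sup>2)"
    if "f \<in> besov_space A g \<nu> \<mu> \<psi>0 \<psi> s 2" for f
    using besov_norm_2[OF that] by (simp add: w_def q_def)
  have barron: "f \<in> besov_space A g \<nu> \<mu> \<psi>0 \<psi> s 1 \<and>
      besov_norm A g \<nu> \<mu> \<psi>0 \<psi> s 1 f \<le> C * V_norm A g \<nu> \<mu> s f"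
    if "f \<in> V_space A g \<nu> \<mu> s" for f
  proof -
    have f: "f \<in> L2 \<nu>" "summable (\<lambda>j. T j * a f j)" using that V by auto
    note * = block_sum_le_l1[of m "a f" "q f" w C T, OF q[OF f(1)] q0 a0 w C(2) f(2)]
    have "f \<in> besov_space A g \<nu> \<mu> \<psi>0 \<psi> s 1" using f(1) *(1) B1 by blast
    then show ?thesis using *(2) by (simp only: N1 V simp_thms)
  qed
  have sqrt_C: "sqrt x \<le> C * sqrt y" if "x \<le> C\<^sup>2 * y" for x y
    using real_sqrt_le_mono[OF that] C(1) by (simp add: real_sqrt_mult)
  have sobolev1: "f \<in> H_space A g \<nu> \<mu> s \<and> H_norm A g \<nu> \<mu> s f \<le> C * besov_norm A g \<nu> \<mu> \<psi>0 \<psi> s 2 f"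
    if fB: "f \<in> besov_space A g \<nu> \<mu> \<psi>0 \<psi> s 2" for f
  proof -
    have f: "f \<in> L2 \<nu>" "summable (\<lambda>n. (w n * q f n)\<^sup>2)" using fB B2 by auto
    note * = block_square_sum_ge[of m "a f" "q f" "C\<^sup>2" T w, OF q[OF f(1)] zero_le_power2 C(4) f(2)]
    show ?thesis using f(1) *(1) sqrt_C[OF *(2)] by (simp only: H N2[OF fB] simp_thms)
  qed
  have sobolev2: "f \<in> besov_space A g \<nu> \<mu> \<psi>0 \<psi> s 2 \<and>
      besov_norm A g \<nu> \<mu> \<psi>0 \<psi> s 2 f \<le> C * H_norm A g \<nu> \<mu> s f"
    if "f \<in> H_space A g \<nu> \<mu> s" for f
  proof -
    have f: "f \<in> L2 \<nu>" "summable (\<lambda>j. (T j)\<^sup>2 * (a f j)\<^sup>2)" using that H by auto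
    note * = block_square_sum_le[of m "a f" "q f" w "C\<^sup>2" T, OF q[OF f(1)] C(3) f(2)]
    have "f \<in> besov_space A g \<nu> \<mu> \<psi>0 \<psi> s 2" using f(1) *(1) B2 by blast
    then show ?thesis using sqrt_C[OF *(2)] by (simp only: N2 H simp_thms)
  qed
  have "equal_equivalent_norms
      (besov_space A g \<nu> \<mu> \<psi>0 \<psi> s 2) (besov_norm A g \<nu> \<mu> \<psi>0 \<psi> s 2)
      (H_space A g \<nu> \<mu> s) (H_norm A g \<nu> \<mu> s)"
    unfolding equal_equivalent_norms_def
  proof (intro conjI exI ballI)
    show "besov_space A g \<nu> \<mu> \<psi>0 \<psi> s 2 = H_space A g \<nu> \<mu> s" using sobolev1 sobolev2 by blast
    fix f assume fB: "f \<in> besov_space A g \<nu> \<mu> \<psi>0 \<psi> s 2"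
    show "1 / C * H_norm A g \<nu> \<mu> s f \<le> besov_norm A g \<nu> \<mu> \<psi>0 \<psi> s 2 f"
      using sobolev1[OF fB] C(1) by (simp add: field_simps)
    show "besov_norm A g \<nu> \<mu> \<psi>0 \<psi> s 2 f \<le> C * H_norm A g \<nu> \<mu> s f"
      using sobolev1[OF fB] sobolev2 by blast
  qed (use C(1) in auto)
  then show ?thesis
    using besov_1_embedded_besov_2 barron unfolding continuously_embedded_def by blast
qed

end
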